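(* Let $1<p<\infty$, let $\Omega\subset\mathbb{R}^n$ be a $W^{1,p}$-extension domain and let $0<s<\infty$. Let $r$ satisfy $$ \begin{cases} s\leq r \leq \frac{np}{n-p} & \text{if } p< n,\\ s\leq r<\infty & \text{if } p=n>1,\\ s\leq r \leq \infty & \text{if } p>n \text{ or } p=n=1, \end{cases} $$ and let $\theta\in[0,1]$ satisfy $$ \theta \left( \frac{1}{p} - \frac{1}{n} \right) + (1-\theta)\,\frac{1}{s} = \frac{1}{r} $$ (with $1/r=0$ if $r=\infty$). Then $$ W^{1,p}(\Omega)\cap L^s(\Omega) \subset L^r(\Omega), $$ and there is a constant $C$, depending only on $\Omega$, $p$, $s$ and $r$, such that for all $u\in W^{1,p}(\Omega)\cap L^s(\Omega)$ $$ \| u \|_{L^r(\Omega)} \leq C\, \| u \|_{W^{1,p}(\Omega)}^\theta\, \|u \|_{L^s(\Omega)}^{1-\theta}. $$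
   Context: A domain is a (nonempty) connected open set $\Omega\subset\mathbb{R}^n$. $W^{1,p}(\Omega)$ is the space of all functions in $L^p(\Omega)$ whose first order distributional derivatives belong to $L^p(\Omega)$, with its usual norm $\|u\|_{W^{1,p}(\Omega)}=\left(\int_\Omega (|\nabla u|^p+|u|^p)\,dx\right)^{1/p}$. A $W^{1,p}(\Omega)$-extension operator is a map $E:W^{1,p}(\Omega)\to W^{1,p}(\mathbb{R}^n)$ (not assumed linear) with $E(u)|_\Omega = u$ for every $u\in W^{1,p}(\Omega)$. It is bounded if there is a constant $C\ge 1$ such that $\|E(u)\|_{W^{1,p}(\mathbb{R}^n)}\leq C\|u\|_{W^{1,p}(\Omega)}$ for all $u\in W^{1,p}(\Omega)$. A domain $\Omega$ is a $W^{1,p}$-extension domain if it admits a bounded $W^{1,p}(\Omega)$-extension operator. For $0<s<\infty$ (including $s<1$), $\|u\|_{L^s(\Omega)}=\left(\int_\Omega|u|^s\,dx\right)^{1/s}$, and $L^s(\Omega)$ is the set of measurable functions for which this is finite. *)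

theory Defs
  imports "HOL-Analysis.Analysis" "HOL-Probability.Essential_Supremum"
begin

definition domain :: "'a::euclidean_space set \<Rightarrow> bool" where
  "domain \<Omega> \<longleftrightarrow> \<Omega> \<noteq> {} \<and> open \<Omega> \<and> connected \<Omega>"

subsection \<open>Lebesgue spaces\<close>

text \<open>
  Elements are represented by functions on the whole space; only their values on \<open>\<Omega>\<close>, up to null
  sets, matter.  The exponent ranges over \<open>(0, \<infinity>]\<close>, so for finite exponents below one
  \<open>Lp_norm\<close> is only a quasi-norm.
\<close>

definition Lp_space :: "'a::euclidean_space set \<Rightarrow> ereal \<Rightarrow> ('a \<Rightarrow> real) set" where
  "Lp_space \<Omega> s =
    {u. u \<in> borel_measurable (lebesgue_on \<Omega>) \<and>
        (if s = \<infinity> then esssup (lebesgue_on \<Omega>) (\<lambda>x. ereal \<bar>u x\<bar>) < \<infinity>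
         else integrable (lebesgue_on \<Omega>) (\<lambda>x. \<bar>u x\<bar> powr real_of_ereal s))}"

text \<open>The value is meaningful only for members of \<open>Lp_space \<Omega> s\<close>.\<close>

definition Lp_norm :: "'a::euclidean_space set \<Rightarrow> ereal \<Rightarrow> ('a \<Rightarrow> real) \<Rightarrow> real" where
  "Lp_norm \<Omega> s u =
    (if s = \<infinity> then real_of_ereal (esssup (lebesgue_on \<Omega>) (\<lambda>x. ereal \<bar>u x\<bar>))
     else (LINT x|lebesgue_on \<Omega>. \<bar>u x\<bar> powr real_of_ereal s) powr (1 / real_of_ereal s))"

definition locally_integrable :: "'a::euclidean_space set \<Rightarrow> ('a \<Rightarrow> real) \<Rightarrow> bool" where
  "locally_integrable \<Omega> u \<longleftrightarrow> (\<forall>K. compact K \<and> K \<subseteq> \<Omega> \<longrightarrow> set_integrable lebesgue K u)"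

subsection \<open>Test functions and weak derivatives\<close>

abbreviation partial_deriv :: "'a::euclidean_space \<Rightarrow> ('a \<Rightarrow> real) \<Rightarrow> 'a \<Rightarrow> real" where
  "partial_deriv i f \<equiv> (\<lambda>x. frechet_derivative f (at x) i)"

primrec Ck :: "nat \<Rightarrow> ('a::euclidean_space \<Rightarrow> real) \<Rightarrow> bool" where
  "Ck 0 f \<longleftrightarrow> continuous_on UNIV f"
| "Ck (Suc k) f \<longleftrightarrow> (\<forall>x. f differentiable at x) \<and> (\<forall>i\<in>Basis. Ck k (partial_deriv i f))"

definition test_function :: "'a::euclidean_space set \<Rightarrow> ('a \<Rightarrow> real) \<Rightarrow> bool" where
  "test_function \<Omega> \<phi> \<longleftrightarrow>
    (\<forall>k. Ck k \<phi>) \<and> compact (closure {x. \<phi> x \<noteq> 0}) \<and> closure {x. \<phi> x \<noteq> 0} \<subseteq> \<Omega>"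

definition is_weak_partial ::
    "'a::euclidean_space set \<Rightarrow> 'a \<Rightarrow> ('a \<Rightarrow> real) \<Rightarrow> ('a \<Rightarrow> real) \<Rightarrow> bool" where
  "is_weak_partial \<Omega> i u g \<longleftrightarrow>
    locally_integrable \<Omega> u \<and> locally_integrable \<Omega> g \<and>
    (\<forall>\<phi>. test_function \<Omega> \<phi> \<longrightarrow>
      (LINT x|lebesgue_on \<Omega>. u x * partial_deriv i \<phi> x) = - (LINT x|lebesgue_on \<Omega>. g x * \<phi> x))"

text \<open>Weak partial derivatives are unique almost everywhere on \<open>\<Omega>\<close>, so the choice is immaterial.\<close>

definition weak_grad :: "'a::euclidean_space set \<Rightarrow> ('a \<Rightarrow> real) \<Rightarrow> 'a \<Rightarrow> 'a" where
  "weak_grad \<Omega> u x = (\<Sum>i\<in>Basis. (SOME g. is_weak_partial \<Omega> i u g) x *\<^sub>R i)"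

subsection \<open>Sobolev spaces and extension domains\<close>

definition W1p :: "'a::euclidean_space set \<Rightarrow> real \<Rightarrow> ('a \<Rightarrow> real) set" where
  "W1p \<Omega> p =
    {u \<in> Lp_space \<Omega> (ereal p). \<forall>i\<in>Basis. \<exists>g\<in>Lp_space \<Omega> (ereal p). is_weak_partial \<Omega> i u g}"

definition W1p_norm :: "'a::euclidean_space set \<Rightarrow> real \<Rightarrow> ('a \<Rightarrow> real) \<Rightarrow> real" where
  "W1p_norm \<Omega> p u =
    (LINT x|lebesgue_on \<Omega>. norm (weak_grad \<Omega> u x) powr p + \<bar>u x\<bar> powr p) powr (1 / p)"

text \<open>
  Since functions in \<open>W1p\<close> are identified when they agree almost everywhere, an operator on the
  space must respect this identification, and the restriction property holds almost everywhere.
\<close>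

definition W1p_extension_operator ::
    "'a::euclidean_space set \<Rightarrow> real \<Rightarrow> (('a \<Rightarrow> real) \<Rightarrow> ('a \<Rightarrow> real)) \<Rightarrow> bool" where
  "W1p_extension_operator \<Omega> p E \<longleftrightarrow>
    (\<forall>u\<in>W1p \<Omega> p. E u \<in> W1p UNIV p \<and> (AE x in lebesgue_on \<Omega>. E u x = u x)) \<and>
    (\<forall>u\<in>W1p \<Omega> p. \<forall>v\<in>W1p \<Omega> p.
      (AE x in lebesgue_on \<Omega>. u x = v x) \<longrightarrow> (AE x in lebesgue. E u x = E v x))"

definition bounded_extension_operator ::
    "'a::euclidean_space set \<Rightarrow> real \<Rightarrow> (('a \<Rightarrow> real) \<Rightarrow> ('a \<Rightarrow> real)) \<Rightarrow> bool" where
  "bounded_extension_operator \<Omega> p E \<longleftrightarrow>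
    W1p_extension_operator \<Omega> p E \<and>
    (\<exists>C\<ge>1. \<forall>u\<in>W1p \<Omega> p. W1p_norm UNIV p (E u) \<le> C * W1p_norm \<Omega> p u)"

definition W1p_extension_domain :: "'a::euclidean_space set \<Rightarrow> real \<Rightarrow> bool" where
  "W1p_extension_domain \<Omega> p \<longleftrightarrow> domain \<Omega> \<and> (\<exists>E. bounded_extension_operator \<Omega> p E)"

end

theory Submission
  imports Defs
begin

text \<open>
  Let \<open>v\<close> be the extension of \<open>u\<close>.  Testing against smooth functions shows that, for every \<open>h\<close>
  and almost every \<open>x\<close>, \<open>v\<close> is the integral of its weak gradient along the segment from \<open>x\<close> to
  \<open>x + h\<close>.  If \<open>\<bar>v\<bar>\<close> drops from \<open>l'\<close> to \<open>l\<close> on such a segment, then only the part of the gradient over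
  the strip \<open>l \<le> \<bar>v\<bar> \<le> l'\<close> pays for the drop.  Integrating over \<open>x\<close> and over \<open>\<bar>h\<bar> < \<rho>\<close>, where balls of
  radius \<open>\<rho>\<close> meet the domain in twice the measure of \<open>{l \<le> \<bar>v\<bar>}\<close>, yields the level set inequality
  \<open>(l' - l)\<^sup>p \<bar>{l' \<le> \<bar>v\<bar>}\<bar> \<le> C \<bar>{l \<le> \<bar>v\<bar>}\<bar>\<^bsup>p/n\<^esup> \<integral>\<^bsub>l \<le> \<bar>v\<bar> \<le> l'\<^esub> \<bar>\<nabla>v\<bar>\<^sup>p\<close>.

  On the whole space and for \<open>p < n\<close>, integrating it over the levels (with \<open>l' = 2 l\<close>) gives the
  Sobolev inequality, and the claim follows by interpolation between Lebesgue norms.  For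
  \<open>p \<ge> n\<close> the inequality is used on \<open>\<Omega>\<close> itself, which satisfies a measure density condition: the
  extension of a cutoff function takes the values 1 and 0 on sets of known measure in a ball, and
  this costs energy.  If \<open>p = n\<close>, integrating over the levels bounds \<open>\<integral>\<bar>u\<bar>\<^bsup>s+n\<^esup>\<close> by the
  \<open>n\<close>-th power of the norm times \<open>\<integral>\<bar>u\<bar>\<^sup>s\<close>; if \<open>p > n\<close>, De Giorgi's iteration bounds \<open>\<bar>u\<bar>\<close> itself.
\<close>

subsection \<open>Test functions\<close>

text \<open>The obstacle is that the extension is controlled in the Sobolev norm only: off \<Omega>
  its \<open>L^s\<close> norm can be anything. An inequality on the whole space is therefore useful
  only if its right side is the Sobolev norm alone, which happens for \<open>p < n\<close>, where
  the endpoint exponent \<open>np/(n-p)\<close> is available. For \<open>p \<ge> n\<close> the level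
  sets have to be measured inside \<Omega> while the gradient is integrated over the whole space.
  Only the endpoints of the segments are then required to lie in \<Omega>, and the price is that
  balls centred in \<Omega> must carry a fixed share of \<Omega>; this is where measure density
  enters. Truncation between two levels is done on segments, where the function is continuous in one
  variable; this takes the place of smooth approximation and of a chain rule for truncated Sobolev
  functions. All estimates concern moments \<open>\<integral>|u|^s\<close> and measures of level
  sets, never the triangle inequality of a norm, so exponents \<open>s\<close> below one are treated
  like the others.\<close>

lemma partial_deriv_eq:
  "(f has_derivative f') (at x) \<Longrightarrow> partial_deriv i f x = f' i"
  by (metis frechet_derivative_at)

section \<open>Closure properties of smooth functions\<close>

lemma Ck_Suc_imp_Ck: "Ck (Suc k) f \<Longrightarrow> Ck k f"
proof (induction k arbitrary: f)
  case 0
  then have "f differentiable at x" for x by simp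
  then show ?case
    by (auto intro!: continuous_at_imp_continuous_on differentiable_imp_continuous_within)
next
  case (Suc k)
  have "Ck (Suc k) (partial_deriv i f)" if "i \<in> Basis" for i
    using Suc.prems that by simp
  then have "Ck k (partial_deriv i f)" if "i \<in> Basis" for i
    using Suc.IH that by blast
  then show ?case using Suc.prems by simp
qed

lemma Ck_const: "Ck k (\<lambda>_. c)"
proof (induction k arbitrary: c)
  case (Suc k)
  have "partial_deriv i (\<lambda>_::'a. c) = (\<lambda>_. 0)" for i
    by (rule ext, subst partial_deriv_eq[OF has_derivative_const]) simp
  then show ?case using Suc by simp
qed simp

lemma Ck_add: "Ck k f \<Longrightarrow> Ck k g \<Longrightarrow> Ck k (\<lambda>x. f x + g x)"
proof (induction k arbitrary: f g)
  case 0 then show ?case by (simp add: continuous_on_add)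
next
  case (Suc k)
  have "partial_deriv i (\<lambda>x. f x + g x) = (\<lambda>x. partial_deriv i f x + partial_deriv i g x)" for i
    using Suc.prems
    by (intro ext partial_deriv_eq has_derivative_add) (auto simp: frechet_derivative_works)
  with Suc show ?case by (auto intro: differentiable_add)
qed

lemma Ck_mult: "Ck k f \<Longrightarrow> Ck k g \<Longrightarrow> Ck k (\<lambda>x. f x * g x)"
proof (induction k arbitrary: f g)
  case 0 then show ?case by (simp add: continuous_on_mult)
next
  case (Suc k)
  have "partial_deriv i (\<lambda>x. f x * g x) =
      (\<lambda>x. f x * partial_deriv i g x + partial_deriv i f x * g x)" for i
    using Suc.prems
    by (intro ext partial_deriv_eq has_derivative_mult) (auto simp: frechet_derivative_works)
  moreover have "Ck k (\<lambda>x. f x * partial_deriv i g x + partial_deriv i f x * g x)"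
    if "i \<in> Basis" for i
    using Suc.prems that Ck_Suc_imp_Ck by (intro Ck_add Suc.IH) auto
  ultimately show ?case using Suc.prems by (auto intro: differentiable_mult)
qed

lemma Ck_prod: "(\<And>i. i \<in> I \<Longrightarrow> Ck k (f i)) \<Longrightarrow> Ck k (\<lambda>x. \<Prod>i\<in>I. f i x)"
  by (induction I rule: infinite_finite_induct) (auto intro: Ck_const Ck_mult)

lemma Ck_exp:
  assumes "\<And>k. Ck k f" shows "Ck k (\<lambda>x. exp (f x))"
proof (induction k)
  case 0 then show ?case using assms[of 0] by (simp add: continuous_on_exp)
next
  case (Suc k)
  have d: "f differentiable at x" for x using assms[of 1] by simp
  have "partial_deriv i (\<lambda>x. exp (f x)) = (\<lambda>x. partial_deriv i f x * exp (f x))" for i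
    using d by (intro ext partial_deriv_eq has_derivative_exp) (auto simp: frechet_derivative_works)
  moreover have "Ck k (\<lambda>x. partial_deriv i f x * exp (f x))" if "i \<in> Basis" for i
    using assms[of "Suc k"] that by (intro Ck_mult Suc) auto
  moreover have "(\<lambda>x. exp (f x)) differentiable at x" for x
    using d[of x] has_derivative_exp unfolding differentiable_def by blast
  ultimately show ?case by simp
qed

lemma partial_deriv_translate:
  fixes f :: "'a::euclidean_space \<Rightarrow> real"
  assumes "\<And>x. f differentiable at x"
  shows "partial_deriv i (\<lambda>x. f (x + c)) = (\<lambda>x. partial_deriv i f (x + c))"
proof (intro ext partial_deriv_eq)
  fix x
  have "(f has_derivative frechet_derivative f (at (x + c))) (at (x + c))"
    using assms by (simp add: frechet_derivative_works)
  moreover have "((\<lambda>x. x + c) has_derivative (\<lambda>x. x)) (at x)"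
    by (auto intro!: derivative_eq_intros)
  ultimately show "((\<lambda>x. f (x + c)) has_derivative frechet_derivative f (at (x + c))) (at x)"
    using has_derivative_compose[of "\<lambda>x. x + c" "\<lambda>x. x" x UNIV f] by simp
qed

lemma Ck_translate: "Ck k f \<Longrightarrow> Ck k (\<lambda>x. f (x + c))"
proof (induction k arbitrary: f)
  case 0 then show ?case
    by (auto intro!: continuous_on_compose2[of UNIV f _ "\<lambda>x. x + c"] continuous_intros)
next
  case (Suc k)
  then have d: "f differentiable at x" for x by simp
  have "(\<lambda>x. f (x + c)) differentiable at x" for x
    by (rule differentiable_compose[where f=f]) (auto intro!: d derivative_intros)
  moreover have "Ck k (\<lambda>x. partial_deriv i f (x + c))" if "i \<in> Basis" for i
    using Suc.IH[of "partial_deriv i f"] Suc.prems that by simp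
  ultimately show ?case by (simp add: partial_deriv_translate[OF d])
qed

text \<open>The classical \<open>exp (- 1 / t)\<close>, together with its quotients by powers of
  \<open>t\<close>. The family is closed under differentiation up to linear combinations, so
  smoothness of all members follows by one induction with \<open>m\<close> arbitrary.\<close>

definition flat :: "nat \<Rightarrow> real \<Rightarrow> real" where
  "flat m t = (if t > 0 then exp (- 1 / t) / t ^ m else 0)"

lemma flat_tendsto_0: "((\<lambda>t. exp (- 1 / t) / t ^ m) \<longlongrightarrow> (0::real)) (at_right 0)"
proof -
  have "((\<lambda>t::real. inverse t ^ m / exp (inverse t)) \<longlongrightarrow> 0) (at_right 0)"
    by (rule filterlim_compose[OF tendsto_power_div_exp_0 filterlim_inverse_at_top_right])
  then show ?thesis by (simp add: exp_minus field_simps)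
qed

lemma flat_deriv: "(flat m has_real_derivative flat (m + 2) t - of_nat m * flat (m + 1) t) (at t)"
proof -
  consider "t > 0" | "t < 0" | "t = 0" by linarith
  then show ?thesis
  proof cases
    case 1
    have "((\<lambda>t. exp (- 1 / t) / t ^ m) has_real_derivative
        flat (m + 2) t - of_nat m * flat (m + 1) t) (at t)"
    proof -
      have "t * t ^ (k - Suc 0) = (if k = 0 then t else t ^ k)" for k
        by (cases k) auto
      then show ?thesis
        using 1 by (auto intro!: derivative_eq_intros
          simp: flat_def field_simps power2_eq_square power_add split: if_splits)
    qed
    from has_field_derivative_transform_within_open[OF this, of "{0<..}"] 1
    show ?thesis by (auto simp: flat_def)
  next
    case 2
    have "((\<lambda>t. 0) has_real_derivative flat (m + 2) t - of_nat m * flat (m + 1) t) (at t)"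
      using 2 by (simp add: flat_def)
    from has_field_derivative_transform_within_open[OF this, of "{..<0}"] 2
    show ?thesis by (auto simp: flat_def)
  next
    case 3
    have "((\<lambda>h. flat m h / h) \<longlongrightarrow> 0) (at 0)"
      unfolding filterlim_at_split
    proof
      show "((\<lambda>h. flat m h / h) \<longlongrightarrow> 0) (at_left 0)"
        by (rule tendsto_eventually) (auto simp: eventually_at_left_field flat_def intro: exI[of _ "-1"])
      \<comment> \<open>For \<open>h > 0\<close> the difference quotient at 0 is
        \<open>flat (m + 1) h\<close>.\<close>
      show "((\<lambda>h. flat m h / h) \<longlongrightarrow> 0) (at_right 0)"
        using flat_tendsto_0[of "m + 1"]
        by (rule Lim_transform_eventually)
          (auto simp: eventually_at_right_field flat_def mult.commute intro: exI[of _ 1])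
    qed
    then show ?thesis using 3 by (simp add: DERIV_def flat_def)
  qed
qed

lemma Ck_flat: "Ck k (\<lambda>x::'a::euclidean_space. flat m (c * (x \<bullet> i) + d))"
proof (induction k arbitrary: m)
  case 0
  have "continuous_on UNIV (flat m)"
    using DERIV_isCont[OF flat_deriv] by (simp add: continuous_at_imp_continuous_on)
  then show ?case
    by (auto intro!: continuous_on_compose2[of UNIV "flat m"] continuous_intros)
next
  case (Suc k)
  let ?f = "\<lambda>m x::'a. flat m (c * (x \<bullet> i) + d)"
  have d: "(?f m has_derivative (\<lambda>h. (?f (m + 2) x - of_nat m * ?f (m + 1) x) * (c * (h \<bullet> i)))) (at x)" for x
    using flat_deriv[of m "c * (x \<bullet> i) + d"] unfolding has_field_derivative_def
    by (rule has_derivative_compose[rotated]) (auto intro!: derivative_eq_intros)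
  have "partial_deriv j (?f m) =
      (\<lambda>x. (?f (m + 2) x + (- of_nat m) * ?f (m + 1) x) * (c * (j \<bullet> i)))" for j
    using partial_deriv_eq[OF d] by auto
  moreover have "Ck k (\<lambda>x. (?f (m + 2) x + (- of_nat m) * ?f (m + 1) x) * (c * (j \<bullet> i)))" for j
    by (intro Ck_add Ck_mult Suc Ck_const)
  moreover have "?f m differentiable at x" for x
    using d unfolding differentiable_def by blast
  ultimately show ?case by simp
qed

text \<open>The witnesses are \<open>1 - exp (- m \<psi>)\<close>, where \<open>\<psi>\<close> is smooth and positive exactly on the box.\<close>

lemma box_indicator_limit_of_smooth:
  fixes a b :: "'a::euclidean_space"
  obtains \<phi> :: "nat \<Rightarrow> 'a \<Rightarrow> real"
  where "\<And>m k. Ck k (\<phi> m)" "\<And>m x. 0 \<le> \<phi> m x" "\<And>m x. \<phi> m x \<le> 1"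
    "\<And>m x. x \<notin> box a b \<Longrightarrow> \<phi> m x = 0" "\<And>x. (\<lambda>m. \<phi> m x) \<longlonglongrightarrow> indicator (box a b) x"
proof -
  define \<psi> where "\<psi> x = (\<Prod>i\<in>Basis. flat 0 (1 * (x \<bullet> i) + - (a \<bullet> i)) * flat 0 ((-1) * (x \<bullet> i) + b \<bullet> i))" for x
  define \<phi> where "\<phi> m x = 1 + (-1) * exp ((- real m) * \<psi> x)" for m x
  have C: "Ck k \<psi>" for k
    unfolding \<psi>_def by (intro Ck_prod Ck_mult Ck_flat)
  have 0: "\<psi> x = 0" if "x \<notin> box a b" for x
  proof -
    obtain i where "i \<in> Basis" "\<not> (a \<bullet> i < x \<bullet> i \<and> x \<bullet> i < b \<bullet> i)"
      using \<open>x \<notin> box a b\<close> by (auto simp: mem_box)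
    then show ?thesis
      unfolding \<psi>_def by (intro prod_zero finite_Basis) (auto simp: flat_def intro!: bexI[of _ i])
  qed
  have pos: "\<psi> x > 0" if "x \<in> box a b" for x
    unfolding \<psi>_def using that by (intro prod_pos) (auto simp: mem_box flat_def)
  have nn: "\<psi> x \<ge> 0" for x using 0[of x] pos[of x] by (cases "x \<in> box a b") auto
  show ?thesis
  proof
    show "Ck k (\<phi> m)" for k m
      unfolding \<phi>_def by (intro Ck_add Ck_mult Ck_const Ck_exp C)
    show "0 \<le> \<phi> m x" "\<phi> m x \<le> 1" for m x
      using nn[of x] by (auto simp: \<phi>_def)
    show "\<phi> m x = 0" if "x \<notin> box a b" for m x
      using 0[OF that] by (simp add: \<phi>_def)
    show "(\<lambda>m. \<phi> m x) \<longlonglongrightarrow> indicator (box a b) x" for x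
    proof (cases "x \<in> box a b")
      case True
      have "(\<lambda>m. exp (- \<psi> x) ^ m) \<longlonglongrightarrow> 0"
        using LIMSEQ_realpow_zero[of "exp (- \<psi> x)"] pos[OF True] by simp
      then have "(\<lambda>m. 1 - exp (- \<psi> x) ^ m) \<longlonglongrightarrow> 1 - 0"
        by (intro tendsto_diff tendsto_const)
      then show ?thesis using True by (simp add: \<phi>_def exp_of_nat_mult[symmetric])
    qed (simp add: \<phi>_def 0)
  qed
qed

subsection \<open>The fundamental lemma of the calculus of variations\<close>

text \<open>Open boxes form an intersection-stable generator of the Borel sets, so the vanishing of
  the integrals spreads to all Borel sets. The complement step requires the integral over the whole
  space, which is reached by an increasing sequence of boxes. A density all of whose integrals
  vanish is zero.\<close>

lemma AE_zero_if_box_integrals_zero: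
  fixes f :: "'a::euclidean_space \<Rightarrow> real"
  assumes f: "integrable lborel f"
    and box0: "\<And>c d. (LINT x:box c d|lborel. f x) = 0"
  shows "AE x in lborel. f x = 0"
proof -
  have si: "set_integrable lborel A f" if "A \<in> sets borel" for A
    unfolding set_integrable_def by (rule integrable_mult_indicator[OF _ f]) (simp add: that)
  have U: "(LINT x:UNIV|lborel. f x) = 0"
  proof -
    let ?B = "\<lambda>i::nat. box (- real i *\<^sub>R One) (real i *\<^sub>R One) :: 'a set"
    have U: "(\<Union>i. ?B i) = UNIV" using UN_box_eq_UNIV by simp
    have "incseq ?B"
      by (auto simp: incseq_def mem_box) (smt (verit) of_nat_mono)+
    then have "(\<lambda>i. LINT x:?B i|lborel. f x) \<longlonglongrightarrow> (LINT x:(\<Union>i. ?B i)|lborel. f x)"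
      by (intro set_integral_cont_up si) auto
    then show ?thesis unfolding U box0 by (simp add: LIMSEQ_const_iff)
  qed
  have "(LINT x:A|lborel. f x) = 0" if "A \<in> sets borel" for A
  proof -
    have "Int_stable (range (\<lambda>(a, b). box a b :: 'a set))"
      by (auto simp: Int_stable_def box_Int_box)
    moreover have "range (\<lambda>(a, b). box a b :: 'a set) \<subseteq> Pow UNIV"
      by simp
    moreover have "A \<in> sigma_sets UNIV (range (\<lambda>(a, b). box a b :: 'a set))"
      using that by (simp add: borel_eq_box)
    ultimately show ?thesis
    proof (induction A rule: sigma_sets_induct_disjoint)
      case (compl A)
      then have A[measurable]: "A \<in> sets borel" by (simp add: borel_eq_box)
      have "(LINT x:A \<union> (UNIV - A)|lborel. f x) = (LINT x:A|lborel. f x) + (LINT x:UNIV - A|lborel. f x)"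
        by (intro set_integral_Un si) auto
      then show ?case using U compl by simp
    next
      case (union A)
      then have A: "range A \<subseteq> sets borel" by (simp add: borel_eq_box)
      have "(LINT x:(\<Union>i. A i)|lborel. f x) = (\<Sum>i. LINT x:A i|lborel. f x)"
        using A union(1) by (intro lebesgue_integral_countable_add si) (auto simp: disjoint_family_on_def)
      then show ?case using union by simp
    qed (auto simp: box0, simp add: set_lebesgue_integral_def)
  qed
  then show ?thesis
    using density_unique_real[OF f, of "\<lambda>_. 0"] by simp
qed

lemma test_function_continuous: "test_function \<Omega> \<phi> \<Longrightarrow> continuous_on S \<phi>"
  unfolding test_function_def using Ck.simps(1) continuous_on_subset by blast

lemma test_function_bounded:
  assumes "test_function \<Omega> \<phi>"
  obtains B where "\<And>x. \<bar>\<phi> x\<bar> \<le> B"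
proof -
  let ?K = "closure {x. \<phi> x \<noteq> 0}"
  have "compact ?K" "continuous_on ?K \<phi>"
    using assms test_function_continuous by (auto simp: test_function_def)
  then have "bounded (\<phi> ` ?K)" by (simp add: compact_continuous_image compact_imp_bounded)
  then obtain B where B: "\<And>x. x \<in> ?K \<Longrightarrow> \<bar>\<phi> x\<bar> \<le> B" by (auto simp: bounded_iff)
  have "\<bar>\<phi> x\<bar> \<le> max B 0" for x
    using B[of x] closure_subset[of "{x. \<phi> x \<noteq> 0}"] by (cases "\<phi> x = 0") (auto simp: max_def)
  then show thesis using that by blast
qed

lemma test_function_measurable: "test_function \<Omega> \<phi> \<Longrightarrow> \<phi> \<in> borel_measurable borel"
  by (intro borel_measurable_continuous_onI test_function_continuous)

lemma locally_integrable_mult: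
  fixes u :: "'a::euclidean_space \<Rightarrow> real"
  assumes u: "locally_integrable \<Omega> u" and K: "compact K" "K \<subseteq> \<Omega>" and \<phi>: "\<phi> \<in> borel_measurable borel"
    and B: "\<And>x. \<bar>\<phi> x\<bar> \<le> B" and 0: "\<And>x. x \<notin> K \<Longrightarrow> \<phi> x = 0" and \<Omega>: "\<Omega> \<in> sets lebesgue"
  shows "integrable (lebesgue_on \<Omega>) (\<lambda>x. u x * \<phi> x)"
proof -
  have si: "integrable lebesgue (\<lambda>x. indicator K x * u x)"
    using u K unfolding locally_integrable_def set_integrable_def by simp
  have "\<phi> \<in> borel_measurable lebesgue" using \<phi> by (simp add: measurable_completion)
  then have m: "(\<lambda>x. indicator K x * u x * \<phi> x) \<in> borel_measurable lebesgue"
    using borel_measurable_integrable[OF si] by (rule borel_measurable_times[rotated])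
  have "integrable lebesgue (\<lambda>x. indicator K x * u x * \<phi> x)"
  proof (rule Bochner_Integration.integrable_bound[OF integrable_mult_right[OF si, of B] m], intro AE_I2)
    fix x
    have "\<bar>\<phi> x\<bar> \<le> \<bar>B\<bar>" using B[of x] by simp
    then show "norm (indicator K x * u x * \<phi> x) \<le> norm (B * (indicator K x * u x))"
      by (simp add: abs_mult mult.commute mult_right_mono)
  qed
  moreover have "(\<lambda>x. indicator K x * u x * \<phi> x) = (\<lambda>x. indicator \<Omega> x *\<^sub>R (u x * \<phi> x))"
    using 0 K(2) by (auto simp: indicator_def fun_eq_iff)
  ultimately show ?thesis using \<Omega> by (simp add: integrable_restrict_space)
qed

lemma test_function_integrable_mult:
  assumes "locally_integrable \<Omega> u" "test_function \<Omega> \<phi>" "open \<Omega>"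
  shows "integrable (lebesgue_on \<Omega>) (\<lambda>x. u x * \<phi> x)"
proof -
  obtain B where "\<And>x. \<bar>\<phi> x\<bar> \<le> B" using test_function_bounded[OF assms(2)] by blast
  moreover have "\<phi> x = 0" if "x \<notin> closure {x. \<phi> x \<noteq> 0}" for x
    using that closure_subset[of "{x. \<phi> x \<noteq> 0}"] by auto
  moreover have "compact (closure {x. \<phi> x \<noteq> 0})" "closure {x. \<phi> x \<noteq> 0} \<subseteq> \<Omega>"
    using assms(2) by (simp_all add: test_function_def)
  moreover have "\<Omega> \<in> sets lebesgue" using assms(3) by simp
  ultimately show ?thesis
    using locally_integrable_mult[OF assms(1) _ _ test_function_measurable[OF assms(2)]] by blast
qed

text \<open>Since the closed box lies in \<Omega>, \<open>h\<close> is integrable on it and can be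
  replaced there by a Borel function \<open>f\<close>. The indicator of any smaller box is a bounded
  limit of test functions, so by dominated convergence \<open>f\<close> has zero integral over every
  box.\<close>

lemma fundamental_lemma_box:
  fixes h :: "'a::euclidean_space \<Rightarrow> real"
  assumes \<Omega>: "open \<Omega>" and h: "locally_integrable \<Omega> h"
    and 0: "\<And>\<phi>. test_function \<Omega> \<phi> \<Longrightarrow> (LINT x|lebesgue_on \<Omega>. h x * \<phi> x) = 0"
    and ab: "cbox a b \<subseteq> \<Omega>"
  shows "AE x in lebesgue. x \<in> box a b \<longrightarrow> h x = 0"
proof -
  let ?f = "\<lambda>x. indicator (box a b) x * h x"
  have ic: "integrable lebesgue (\<lambda>x. indicator (cbox a b) x * h x)"
    using h ab unfolding locally_integrable_def set_integrable_def by simp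
  have box_eq: "?f = (\<lambda>x. indicator (box a b) x *\<^sub>R (indicator (cbox a b) x * h x))"
    using box_subset_cbox[of a b] by (auto simp: indicator_def fun_eq_iff)
  have if': "integrable lebesgue ?f"
    unfolding box_eq by (rule integrable_mult_indicator[OF _ ic]) simp
  then obtain f where f[measurable]: "f \<in> borel_measurable borel" and fae: "AE x in lborel. ?f x = f x"
    using completion_ex_borel_measurable_real[of ?f lborel] by (auto dest: borel_measurable_integrable)
  have fae': "AE x in lebesgue. ?f x = f x" using fae by (rule AE_completion)
  have "integrable lebesgue f"
    using if' by (rule integrable_cong_AE_imp) (use fae' in \<open>auto simp: measurable_completion\<close>)
  then have fi: "integrable lborel f" by (simp add: integrable_completion)
  have "(LINT x:box c d|lborel. f x) = 0" for c d
  proof -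
    \<comment> \<open>The intersection is again a box, hence its smooth approximations have support
      in \<open>cbox a b\<close> and are test functions on \<Omega>.\<close>
    obtain e g where eg: "box a b \<inter> box c d = box e g" using box_Int_box[of a b c d] by blast
    obtain \<phi> :: "nat \<Rightarrow> 'a \<Rightarrow> real" where \<phi>: "\<And>m k. Ck k (\<phi> m)" "\<And>m x. 0 \<le> \<phi> m x" "\<And>m x. \<phi> m x \<le> 1"
      "\<And>m x. x \<notin> box e g \<Longrightarrow> \<phi> m x = 0" "\<And>x. (\<lambda>m. \<phi> m x) \<longlonglongrightarrow> indicator (box e g) x"
      by (rule box_indicator_limit_of_smooth[of e g]) (rule that)
    have sub: "{x. \<phi> m x \<noteq> 0} \<subseteq> box a b" for m using \<phi>(4)[of _ m] eg by auto
    have cl: "closure {x. \<phi> m x \<noteq> 0} \<subseteq> cbox a b" for m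
      using sub[of m] box_subset_cbox[of a b] by (intro closure_minimal) auto
    have "compact (closure {x. \<phi> m x \<noteq> 0})" for m
      unfolding compact_eq_bounded_closed using bounded_subset[OF bounded_cbox cl] closed_closure by blast
    then have t: "test_function \<Omega> (\<phi> m)" for m
      using \<phi>(1) cl[of m] ab by (auto simp: test_function_def)
    have [measurable]: "\<phi> m \<in> borel_measurable lebesgue" for m
      using test_function_measurable[OF t] by (simp add: measurable_completion)
    have hm: "?f \<in> borel_measurable lebesgue" using if' by (rule borel_measurable_integrable)
    have z: "(LINT x|lebesgue. ?f x * \<phi> m x) = 0" for m
    proof -
      have "(LINT x|lebesgue_on \<Omega>. h x * \<phi> m x) = (LINT x|lebesgue. indicator \<Omega> x *\<^sub>R (h x * \<phi> m x))"
        using \<Omega> by (simp add: integral_restrict_space)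
      also have "(\<lambda>x. indicator \<Omega> x *\<^sub>R (h x * \<phi> m x)) = (\<lambda>x. ?f x * \<phi> m x)"
        using sub[of m] ab box_subset_cbox[of a b] by (fastforce simp: indicator_def fun_eq_iff)
      finally show ?thesis using 0[OF t] by simp
    qed
    have "(\<lambda>m. LINT x|lebesgue. ?f x * \<phi> m x) \<longlonglongrightarrow> (LINT x|lebesgue. ?f x * indicator (box e g) x)"
    proof (rule integral_dominated_convergence[where w="\<lambda>x. norm (?f x)"])
      show "(\<lambda>x. ?f x * indicator (box e g) x) \<in> borel_measurable lebesgue"
        by (intro borel_measurable_times hm borel_measurable_indicator) simp
      show "(\<lambda>x. ?f x * \<phi> m x) \<in> borel_measurable lebesgue" for m
        by (intro borel_measurable_times hm) simp
      show "integrable lebesgue (\<lambda>x. norm (?f x))" using if' by (rule integrable_norm)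
      show "AE x in lebesgue. (\<lambda>m. ?f x * \<phi> m x) \<longlonglongrightarrow> ?f x * indicator (box e g) x"
        by (intro AE_I2 tendsto_intros \<phi>(5))
      show "AE x in lebesgue. norm (?f x * \<phi> m x) \<le> norm (?f x)" for m
        by (intro AE_I2, subst norm_mult, rule mult_left_le) (use \<phi>(2,3) in auto)
    qed
    then have "(LINT x|lebesgue. ?f x * indicator (box e g) x) = 0"
      unfolding z by (simp add: LIMSEQ_const_iff)
    also have "(LINT x|lebesgue. ?f x * indicator (box e g) x) = (LINT x|lebesgue. indicator (box c d) x *\<^sub>R f x)"
    proof (rule integral_cong_AE)
      show "(\<lambda>x. ?f x * indicator (box e g) x) \<in> borel_measurable lebesgue"
        by (intro borel_measurable_times hm borel_measurable_indicator) simp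
      show "(\<lambda>x. indicator (box c d) x *\<^sub>R f x) \<in> borel_measurable lebesgue"
        by (auto simp: measurable_completion)
      show "AE x in lebesgue. ?f x * indicator (box e g) x = indicator (box c d) x *\<^sub>R f x"
        using fae' by (rule eventually_mono) (use eg in \<open>auto simp: set_eq_iff split: split_indicator split_indicator_asm\<close>)
    qed
    finally show ?thesis
      unfolding set_lebesgue_integral_def by (subst (asm) integral_completion) auto
  qed
  then have "AE x in lborel. f x = 0"
    using AE_zero_if_box_integrals_zero[OF fi] by blast
  then have "AE x in lebesgue. f x = 0" by (rule AE_completion)
  with fae' show ?thesis
    by eventually_elim (auto simp: indicator_def split: if_splits)
qed

text \<open>An open set is a countable union of closed boxes, and each of them exceeds its open box
  by a null set only.\<close>

lemma fundamental_lemma: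
  fixes h :: "'a::euclidean_space \<Rightarrow> real"
  assumes \<Omega>: "open \<Omega>" and h: "locally_integrable \<Omega> h"
    and 0: "\<And>\<phi>. test_function \<Omega> \<phi> \<Longrightarrow> (LINT x|lebesgue_on \<Omega>. h x * \<phi> x) = 0"
  shows "AE x in lebesgue_on \<Omega>. h x = 0"
proof -
  obtain D where D: "countable D" "D \<subseteq> Pow \<Omega>" "\<And>X. X \<in> D \<Longrightarrow> \<exists>a b. X = cbox a b" "\<Union>D = \<Omega>"
    using open_countable_Union_open_cbox[OF \<Omega>] by metis
  have "AE x in lebesgue. x \<in> X \<longrightarrow> h x = 0" if X: "X \<in> D" for X
  proof -
    obtain a b where ab: "X = cbox a b" using D X by blast
    have "cbox a b - box a b \<in> null_sets lebesgue"
      using negligible_iff_null_sets negligible_frontier_interval by blast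
    then have "AE x in lebesgue. x \<notin> cbox a b - box a b" by (rule AE_not_in)
    moreover have "AE x in lebesgue. x \<in> box a b \<longrightarrow> h x = 0"
      using D X ab by (intro fundamental_lemma_box[OF \<Omega> h 0]) auto
    ultimately show ?thesis unfolding ab by eventually_elim auto
  qed
  then have "AE x in lebesgue. \<forall>X\<in>D. x \<in> X \<longrightarrow> h x = 0"
    by (subst AE_ball_countable[OF D(1)]) blast
  then have "AE x in lebesgue. x \<in> \<Omega> \<longrightarrow> h x = 0"
    by (rule eventually_mono) (use D(4) in auto)
  then show ?thesis using \<Omega> by (simp add: AE_restrict_space_iff)
qed

lemma weak_partial_unique:
  assumes \<Omega>: "open \<Omega>" and f: "is_weak_partial \<Omega> i u f" and g: "is_weak_partial \<Omega> i u g"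
  shows "AE x in lebesgue_on \<Omega>. f x = g x"
proof -
  have "AE x in lebesgue_on \<Omega>. f x - g x = 0"
  proof (rule fundamental_lemma[OF \<Omega>])
    show "locally_integrable \<Omega> (\<lambda>x. f x - g x)"
      using f g by (auto simp: is_weak_partial_def locally_integrable_def)
    show "(LINT x|lebesgue_on \<Omega>. (f x - g x) * \<phi> x) = 0" if t: "test_function \<Omega> \<phi>" for \<phi>
    proof -
      have "integrable (lebesgue_on \<Omega>) (\<lambda>x. f x * \<phi> x)" "integrable (lebesgue_on \<Omega>) (\<lambda>x. g x * \<phi> x)"
        using f g by (auto intro!: test_function_integrable_mult t \<Omega> simp: is_weak_partial_def)
      then show ?thesis using f g t by (simp add: left_diff_distrib is_weak_partial_def)
    qed
  qed
  then show ?thesis by simp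
qed

subsection \<open>Weak derivatives along segments\<close>

lemma nn_integral_lborel_translate:
  fixes f :: "'a::euclidean_space \<Rightarrow> ennreal"
  assumes [measurable]: "f \<in> borel_measurable borel"
  shows "(\<integral>\<^sup>+x. f (x + c) \<partial>lborel) = (\<integral>\<^sup>+x. f x \<partial>lborel)"
proof -
  have "(\<integral>\<^sup>+x. f x \<partial>lborel) = (\<integral>\<^sup>+x. f x \<partial>distr lborel borel ((+) c))"
    by (simp add: lborel_distr_plus)
  also have "\<dots> = (\<integral>\<^sup>+x. f (c + x) \<partial>lborel)"
    by (rule nn_integral_distr) auto
  finally show ?thesis by (simp add: add.commute)
qed

lemma lborel_integral_translate:
  fixes f :: "'a::euclidean_space \<Rightarrow> real"
  assumes [measurable]: "f \<in> borel_measurable borel"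
  shows "(\<integral>x. f (x + c) \<partial>lborel) = (\<integral>x. f x \<partial>lborel)"
proof -
  have "(\<integral>x. f x \<partial>lborel) = (\<integral>x. f x \<partial>distr lborel borel ((+) c))"
    by (simp add: lborel_distr_plus)
  also have "\<dots> = (\<integral>x. f (c + x) \<partial>lborel)"
    by (rule integral_distr) auto
  finally show ?thesis by (simp add: add.commute)
qed

lemma integrable_lborel_translate:
  fixes f :: "'a::euclidean_space \<Rightarrow> real"
  assumes "integrable lborel f"
  shows "integrable lborel (\<lambda>x. f (x + c))"
proof -
  have m[measurable]: "f \<in> borel_measurable borel" using assms by auto
  show ?thesis
    using assms nn_integral_lborel_translate[of "\<lambda>x. ennreal (norm (f x))" c]
    unfolding integrable_iff_bounded by auto
qed

lemma line_product_integrable: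
  fixes F :: "real \<Rightarrow> 'a::euclidean_space \<Rightarrow> real"
  assumes [measurable]: "(\<lambda>(t, x). F t x) \<in> borel_measurable (lborel \<Otimes>\<^sub>M lborel)"
    and K: "\<And>t. t \<in> {0..1} \<Longrightarrow> (\<integral>\<^sup>+x. ennreal \<bar>F t x\<bar> \<partial>lborel) \<le> ennreal K"
  shows "integrable (lborel \<Otimes>\<^sub>M lborel) (\<lambda>(t, x). indicator {0..1} t * F t x)"
  unfolding integrable_iff_bounded
proof
  show "(\<lambda>(t, x). indicator {0..1} t * F t x) \<in> borel_measurable (lborel \<Otimes>\<^sub>M lborel)"
    by measurable
  have "(\<integral>\<^sup>+z. ennreal (norm (case z of (t, x) \<Rightarrow> indicator {0..1} t * F t x)) \<partial>(lborel \<Otimes>\<^sub>M lborel))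
      = (\<integral>\<^sup>+t. \<integral>\<^sup>+x. ennreal \<bar>indicator {0..1} t * F t x\<bar> \<partial>lborel \<partial>lborel)"
    by (subst lborel.nn_integral_fst[symmetric]) (auto simp: case_prod_beta)
  also have "\<dots> \<le> (\<integral>\<^sup>+t. ennreal K * indicator {0..1::real} t \<partial>lborel)"
    using K by (intro nn_integral_mono) (auto split: split_indicator)
  also have "\<dots> < \<infinity>" by (simp add: nn_integral_cmult_indicator ennreal_mult_less_top)
  finally show "(\<integral>\<^sup>+z. ennreal (norm (case z of (t, x) \<Rightarrow> indicator {0..1} t * F t x)) \<partial>(lborel \<Otimes>\<^sub>M lborel)) < \<infinity>" .
qed

lemma test_function_outside_support:
  fixes \<phi> :: "'a::euclidean_space \<Rightarrow> real"
  assumes x: "x \<notin> closure {x. \<phi> x \<noteq> 0}"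
  shows "\<phi> x = 0" and "partial_deriv i \<phi> x = 0"
proof -
  have b: "0 = \<phi> y" if "y \<in> - closure {x. \<phi> x \<noteq> 0}" for y
    using that closure_subset[of "{x. \<phi> x \<noteq> 0}"]
    by (metis (mono_tags, lifting) ComplD mem_Collect_eq subsetD)
  show "\<phi> x = 0" using b[of x] x by simp
  have a: "((\<lambda>x. 0) has_derivative (\<lambda>x. 0)) (at x)" by simp
  have "(\<phi> has_derivative (\<lambda>x. 0)) (at x)"
    by (rule has_derivative_transform_within_open[OF a open_Compl[OF closed_closure] _ b])
      (use x in blast)
  then show "partial_deriv i \<phi> x = 0" by (simp add: partial_deriv_eq)
qed

lemma test_function_directional:
  fixes \<phi> :: "'a::euclidean_space \<Rightarrow> real"
  assumes t: "test_function UNIV \<phi>" and i: "i \<in> Basis"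
  shows "test_function UNIV (\<lambda>x. \<phi> (x - c))"
    and "partial_deriv i (\<lambda>x. \<phi> (x - c)) = (\<lambda>x. partial_deriv i \<phi> (x - c))"
    and "test_function UNIV (partial_deriv i \<phi>)"
proof -
  have C: "Ck k \<phi>" for k using t by (simp add: test_function_def)
  have d: "\<phi> differentiable at x" for x using C[of 1] by simp
  have K: "compact (closure {x. \<phi> x \<noteq> 0})" using t by (simp add: test_function_def)
  have "{x. \<phi> (x - c) \<noteq> 0} = (\<lambda>x. c + x) ` {x. \<phi> x \<noteq> 0}"
    by (force simp: image_iff algebra_simps)
  then have "compact (closure {x. \<phi> (x - c) \<noteq> 0})"
    using K by (simp add: closure_translation compact_translation)
  then show "test_function UNIV (\<lambda>x. \<phi> (x - c))"
    using Ck_translate[OF C, of _ "- c"] by (simp add: test_function_def)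
  show "partial_deriv i (\<lambda>x. \<phi> (x - c)) = (\<lambda>x. partial_deriv i \<phi> (x - c))"
    using partial_deriv_translate[OF d, where i=i and c="- c"] by simp
  have "partial_deriv i \<phi> x = 0" if "x \<notin> closure {x. \<phi> x \<noteq> 0}" for x
    using that by (rule test_function_outside_support)
  then have "closure {x. partial_deriv i \<phi> x \<noteq> 0} \<subseteq> closure {x. \<phi> x \<noteq> 0}"
    by (intro closure_minimal) auto
  then have "compact (closure {x. partial_deriv i \<phi> x \<noteq> 0})"
    using compact_Int_closed[OF K, of "closure {x. partial_deriv i \<phi> x \<noteq> 0}"] by (simp add: Int_absorb1)
  moreover have "Ck k (partial_deriv i \<phi>)" for k using C[of "Suc k"] i by simp
  ultimately show "test_function UNIV (partial_deriv i \<phi>)" by (simp add: test_function_def)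
qed

lemma test_function_cball:
  fixes \<phi> :: "'a::euclidean_space \<Rightarrow> real"
  assumes t: "test_function UNIV \<phi>"
  obtains B R where "\<And>x. \<bar>\<phi> x\<bar> \<le> B" "\<And>x. x \<notin> cball 0 R \<Longrightarrow> \<phi> x = 0"
proof -
  obtain B where B: "\<And>x. \<bar>\<phi> x\<bar> \<le> B" using test_function_bounded[OF t] by blast
  have "compact (closure {x. \<phi> x \<noteq> 0})" using t by (simp only: test_function_def)
  then have "bounded {x. \<phi> x \<noteq> 0}"
    by (rule bounded_subset[OF compact_imp_bounded closure_subset])
  then obtain R where R: "\<And>x. \<phi> x \<noteq> 0 \<Longrightarrow> norm x \<le> R" by (auto simp: bounded_iff)
  show thesis by (rule that[OF B]) (use R in auto)
qed

text \<open>Translating \<open>\<phi>\<close> by \<open>t *\<^sub>R h\<close> with \<open>t\<close>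
  in \<open>[0,1]\<close> keeps its support in the ball of radius \<open>R + norm h\<close>. The
  bound is therefore uniform in \<open>t\<close>, which makes the product integrable over
  \<open>[0,1]\<close> times the space.\<close>

lemma nn_integral_local_bound:
  fixes f \<phi> :: "'a::euclidean_space \<Rightarrow> real"
  assumes [measurable]: "f \<in> borel_measurable borel"
    and loc: "set_integrable lborel (cball 0 (R + norm h)) f"
    and B: "\<And>x. \<bar>\<phi> x\<bar> \<le> B" and 0: "\<And>x. x \<notin> cball 0 R \<Longrightarrow> \<phi> x = 0" and t: "t \<in> {0..1}"
  shows "(\<integral>\<^sup>+y. ennreal \<bar>f y * \<phi> (y - t *\<^sub>R h)\<bar> \<partial>lborel)
    \<le> ennreal (B * (LINT x:cball 0 (R + norm h)|lborel. \<bar>f x\<bar>))"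
proof -
  let ?I = "\<lambda>x. indicator (cball 0 (R + norm h)) x * \<bar>f x\<bar>"
  have B0: "B \<ge> 0" using B[of 0] by linarith
  have int: "integrable lborel ?I"
    using integrable_norm[OF loc[unfolded set_integrable_def]] by (simp add: abs_mult)
  have "(\<integral>\<^sup>+y. ennreal \<bar>f y * \<phi> (y - t *\<^sub>R h)\<bar> \<partial>lborel) \<le> (\<integral>\<^sup>+y. ennreal (B * ?I y) \<partial>lborel)"
  proof (intro nn_integral_mono ennreal_leI)
    fix y :: 'a
    show "\<bar>f y * \<phi> (y - t *\<^sub>R h)\<bar> \<le> B * ?I y"
    proof (cases "y - t *\<^sub>R h \<in> cball 0 R")
      case True
      have "norm y \<le> norm (y - t *\<^sub>R h) + norm (t *\<^sub>R h)" by (metis diff_add_cancel norm_triangle_ineq)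
      also have "\<dots> \<le> R + norm h" using True t by (auto intro!: add_mono mult_left_le_one_le)
      finally show ?thesis using mult_right_mono[OF B, of "\<bar>f y\<bar>" "y - t *\<^sub>R h"]
        by (simp add: abs_mult mult.commute)
    next
      case False
      then show ?thesis using 0 B0 by simp
    qed
  qed
  also have "\<dots> = ennreal (LINT y|lborel. B * ?I y)"
    using int B0 by (intro nn_integral_eq_integral) auto
  finally show ?thesis by (simp add: set_lebesgue_integral_def)
qed

text \<open>The two versions differ by a translation in \<open>x\<close>. In the segment formula the
  first serves the gradient, evaluated along the segment, and the second serves \<open>v\<close>
  against translated test functions.\<close>

lemma line_Fubini:
  fixes f \<phi> :: "'a::euclidean_space \<Rightarrow> real"
  assumes [measurable]: "f \<in> borel_measurable borel" "\<phi> \<in> borel_measurable borel"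
    and loc: "\<And>R. set_integrable lborel (cball 0 R) f"
    and B: "\<And>x. \<bar>\<phi> x\<bar> \<le> B" and 0: "\<And>x. x \<notin> cball 0 R \<Longrightarrow> \<phi> x = 0"
  shows "integrable (lborel \<Otimes>\<^sub>M lborel) (\<lambda>(t, x). indicator {0..1} t * (f (x + t *\<^sub>R h) * \<phi> x))"
    and "integrable (lborel \<Otimes>\<^sub>M lborel) (\<lambda>(t, y). indicator {0..1} t * (f y * \<phi> (y - t *\<^sub>R h)))"
proof -
  have b: "(\<integral>\<^sup>+y. ennreal \<bar>f y * \<phi> (y - t *\<^sub>R h)\<bar> \<partial>lborel)
    \<le> ennreal (B * (LINT x:cball 0 (R + norm h)|lborel. \<bar>f x\<bar>))" if "t \<in> {0..1}" for t
    by (rule nn_integral_local_bound[OF assms(1) loc B 0 that])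
  show "integrable (lborel \<Otimes>\<^sub>M lborel) (\<lambda>(t, y). indicator {0..1} t * (f y * \<phi> (y - t *\<^sub>R h)))"
    by (rule line_product_integrable[OF _ b]) auto
  have "(\<integral>\<^sup>+x. ennreal \<bar>f (x + t *\<^sub>R h) * \<phi> x\<bar> \<partial>lborel) \<le> ennreal (B * (LINT x:cball 0 (R + norm h)|lborel. \<bar>f x\<bar>))"
    if "t \<in> {0..1}" for t
    using b[OF that] nn_integral_lborel_translate[of "\<lambda>y. ennreal \<bar>f y * \<phi> (y - t *\<^sub>R h)\<bar>" "t *\<^sub>R h"]
    by simp
  then show "integrable (lborel \<Otimes>\<^sub>M lborel) (\<lambda>(t, x). indicator {0..1} t * (f (x + t *\<^sub>R h) * \<phi> x))"
    by (rule line_product_integrable[rotated]) auto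
qed

text \<open>Borel representatives of a function and its weak gradient, so that Fubini's theorem applies on \<open>lborel\<close>.\<close>

locale sobolev_gradient =
  fixes v :: "'a::euclidean_space \<Rightarrow> real" and gr :: "'a \<Rightarrow> 'a"
  assumes v_meas[measurable]: "v \<in> borel_measurable borel"
    and gr_meas[measurable]: "gr \<in> borel_measurable borel"
    and v_loc: "\<And>R. set_integrable lborel (cball 0 R) v"
    and gr_loc: "\<And>R. set_integrable lborel (cball 0 R) gr"
    and weak: "\<And>i \<phi>. i \<in> Basis \<Longrightarrow> test_function UNIV \<phi> \<Longrightarrow>
      (LINT x|lborel. v x * partial_deriv i \<phi> x) = - (LINT x|lborel. (gr x \<bullet> i) * \<phi> x)"

context sobolev_gradient begin

lemma gr_comp_loc: "set_integrable lborel (cball 0 R) (\<lambda>x. gr x \<bullet> h)"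
proof -
  have "integrable lborel (\<lambda>x. (indicator (cball 0 R) x *\<^sub>R gr x) \<bullet> h)"
    using gr_loc[of R] unfolding set_integrable_def by (rule integrable_inner_left)
  then show ?thesis by (simp add: set_integrable_def)
qed

text \<open>With the indicator of a ball in the role of \<open>\<phi>\<close>, Fubini's theorem
  gives integrability on almost every section with \<open>x\<close> in that ball. Countably many
  balls cover the space.\<close>

lemma AE_line_integrable:
  "AE x in lborel. set_integrable lborel {0..1} (\<lambda>t. gr (x + t *\<^sub>R h) \<bullet> h)"
proof -
  let ?P = "\<lambda>x. set_integrable lborel {0..1} (\<lambda>t. gr (x + t *\<^sub>R h) \<bullet> h)"
  have "AE x in lborel. x \<in> cball 0 (real n) \<longrightarrow> ?P x" for n
  proof -
    have "integrable (lborel \<Otimes>\<^sub>M lborel)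
        (\<lambda>(t, x). indicator {0..1} t * ((gr (x + t *\<^sub>R h) \<bullet> h) * indicator (cball 0 (real n)) x))"
      by (rule line_Fubini(1)[where f="\<lambda>x. gr x \<bullet> h" and B=1 and R="real n"])
        (auto intro: gr_comp_loc borel_measurable_indicator split: split_indicator)
    from lborel_pair.AE_integrable_snd[OF this]
    show ?thesis
      by eventually_elim (auto simp: set_integrable_def)
  qed
  then have "AE x in lborel. \<forall>n. x \<in> cball 0 (real n) \<longrightarrow> ?P x" unfolding AE_all_countable by blast
  then show ?thesis
    by eventually_elim (use real_arch_simple in auto)
qed

text \<open>The weak formulation is linear in the direction, so it passes from basis vectors to
  \<open>h\<close>. The shift \<open>c\<close> will be a point \<open>t *\<^sub>R h\<close> of the
  segment.\<close>

lemma weak_directional: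
  assumes t: "test_function UNIV \<phi>"
  shows "(LINT x|lborel. v x * (\<Sum>i\<in>Basis. (h \<bullet> i) * partial_deriv i \<phi> (x - c)))
    = - (LINT x|lborel. (gr x \<bullet> h) * \<phi> (x - c))"
proof -
  have int: "integrable lborel (\<lambda>x. f x * \<psi> x)"
    if \<psi>: "test_function UNIV \<psi>" and f[measurable]: "f \<in> borel_measurable borel"
      and loc: "\<And>R. set_integrable lborel (cball 0 R) f" for f \<psi> :: "'a \<Rightarrow> real"
  proof -
    note [measurable] = test_function_measurable[OF \<psi>]
    obtain B R where BR: "\<And>x. \<bar>\<psi> x\<bar> \<le> B" "\<And>x. x \<notin> cball 0 R \<Longrightarrow> \<psi> x = 0"
      by (rule test_function_cball[OF \<psi>]) (rule that)
    with nn_integral_local_bound[where h=0 and t=0 and f=f and \<phi>=\<psi> and B=B and R=R] f loc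
    have "(\<integral>\<^sup>+y. ennreal \<bar>f y * \<psi> y\<bar> \<partial>lborel) < \<infinity>"
      by (force intro: le_less_trans)
    then show ?thesis by (simp add: integrable_iff_bounded)
  qed
  let ?\<phi> = "\<lambda>x. \<phi> (x - c)"
  have t': "test_function UNIV ?\<phi>"
    using test_function_directional(1)[OF t SOME_Basis] .
  have p: "partial_deriv i \<phi> (x - c) = partial_deriv i ?\<phi> x" if "i \<in> Basis" for i x
    using test_function_directional(2)[OF t that, of c] by metis
  have t'': "test_function UNIV (partial_deriv i ?\<phi>)" if "i \<in> Basis" for i
    using test_function_directional(3)[OF t' that] .
  have "(LINT x|lborel. v x * (\<Sum>i\<in>Basis. (h \<bullet> i) * partial_deriv i \<phi> (x - c)))
      = (LINT x|lborel. (\<Sum>i\<in>Basis. (h \<bullet> i) * (v x * partial_deriv i ?\<phi> x)))"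
    by (intro Bochner_Integration.integral_cong) (auto simp: sum_distrib_left p mult_ac intro!: sum.cong)
  also have "\<dots> = (\<Sum>i\<in>Basis. (h \<bullet> i) * (LINT x|lborel. v x * partial_deriv i ?\<phi> x))"
    by (subst Bochner_Integration.integral_sum)
      (auto intro!: integrable_mult_right int[OF t''] v_loc)
  also have "\<dots> = - (\<Sum>i\<in>Basis. (h \<bullet> i) * (LINT x|lborel. (gr x \<bullet> i) * ?\<phi> x))"
    by (simp add: weak[OF _ t'] sum_negf)
  also have "(\<Sum>i\<in>Basis. (h \<bullet> i) * (LINT x|lborel. (gr x \<bullet> i) * ?\<phi> x))
      = (LINT x|lborel. (\<Sum>i\<in>Basis. (h \<bullet> i) * ((gr x \<bullet> i) * ?\<phi> x)))"
    by (subst Bochner_Integration.integral_sum)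
      (auto intro!: integrable_mult_right int[OF t'] gr_comp_loc)
  also have "\<dots> = (LINT x|lborel. (gr x \<bullet> h) * ?\<phi> x)"
    by (intro Bochner_Integration.integral_cong)
      (auto simp: euclidean_inner[of "gr _" h] sum_distrib_left mult_ac intro!: sum.cong)
  finally show ?thesis .
qed


text \<open>The difference \<open>D\<close> of the two sides is tested against
  \<open>\<phi>\<close>. A translation moves the increment from \<open>v\<close> to
  \<open>\<phi>\<close>, where the classical fundamental theorem of calculus applies along the
  segment. Fubini's theorem and the weak derivative then turn the averaged directional derivative of
  \<open>\<phi>\<close> into the averaged \<open>gr\<close>, so \<open>D\<close> integrates to zero
  against all test functions. The exceptional null set depends on \<open>h\<close>.\<close>

lemma segment_formula:
  "AE x in lborel. v (x + h) = v x + (LINT t:{0..1}|lborel. gr (x + t *\<^sub>R h) \<bullet> h)"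
proof -
  define S where "S x = (LINT t:{0..1}|lborel. gr (x + t *\<^sub>R h) \<bullet> h)" for x
  define D where "D x = v (x + h) - v x - S x" for x
  have S_meas[measurable]: "S \<in> borel_measurable borel"
    unfolding S_def set_lebesgue_integral_def by measurable
  have D_meas[measurable]: "D \<in> borel_measurable borel" unfolding D_def by measurable
  have gh[measurable]: "(\<lambda>x. gr x \<bullet> h) \<in> borel_measurable borel" by measurable
  have int_v: "integrable lborel (\<lambda>x. v (x + c) * \<phi> x)"
    if B: "\<And>x. \<bar>\<phi> x\<bar> \<le> B" and 0: "\<And>x. x \<notin> cball 0 R \<Longrightarrow> \<phi> x = 0"
      and [measurable]: "\<phi> \<in> borel_measurable borel" for \<phi> B R c
  proof -
    have "(\<integral>\<^sup>+y. ennreal \<bar>v y * \<phi> (y - 1 *\<^sub>R c)\<bar> \<partial>lborel)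
      \<le> ennreal (B * (LINT x:cball 0 (R + norm c)|lborel. \<bar>v x\<bar>))"
      by (rule nn_integral_local_bound[OF v_meas v_loc B 0]) auto
    then have "(\<integral>\<^sup>+y. ennreal \<bar>v y * \<phi> (y - c)\<bar> \<partial>lborel) < \<infinity>"
      by (auto intro: le_less_trans)
    then have "integrable lborel (\<lambda>y. v y * \<phi> (y - c))"
      by (simp add: integrable_iff_bounded)
    from integrable_lborel_translate[OF this, of c] show ?thesis by simp
  qed
  have int_S: "integrable lborel (\<lambda>x. S x * \<phi> x)"
    and eq_S: "(LINT x|lborel. S x * \<phi> x)
      = (LINT t:{0..1}|lborel. LINT x|lborel. (gr (x + t *\<^sub>R h) \<bullet> h) * \<phi> x)"
    if B: "\<And>x. \<bar>\<phi> x\<bar> \<le> B" and 0: "\<And>x. x \<notin> cball 0 R \<Longrightarrow> \<phi> x = 0"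
      and [measurable]: "\<phi> \<in> borel_measurable borel" for \<phi> B R
  proof -
    note I = line_Fubini(1)[OF gh that(3) gr_comp_loc B 0, where h=h]
    have e: "(LINT t|lborel. indicator {0..1} t * (gr (x + t *\<^sub>R h) \<bullet> h * \<phi> x)) = S x * \<phi> x" for x
      by (simp add: S_def set_lebesgue_integral_def mult.assoc[symmetric])
    show "integrable lborel (\<lambda>x. S x * \<phi> x)"
      using lborel_pair.integrable_snd[OF I] by (simp add: e)
    show "(LINT x|lborel. S x * \<phi> x)
      = (LINT t:{0..1}|lborel. LINT x|lborel. (gr (x + t *\<^sub>R h) \<bullet> h) * \<phi> x)"
      using lborel_pair.Fubini_integral[OF I] by (simp add: e set_lebesgue_integral_def)
  qed
  have int_D: "integrable lborel (\<lambda>x. D x * \<phi> x)"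
    if "\<And>x. \<bar>\<phi> x\<bar> \<le> B" "\<And>x. x \<notin> cball 0 R \<Longrightarrow> \<phi> x = 0" "\<phi> \<in> borel_measurable borel" for \<phi> B R
  proof -
    have "integrable lborel (\<lambda>x. v (x + c) * \<phi> x)" for c
      by (rule int_v[where B=B and R=R]) (use that in auto)
    from this[of h] this[of 0] show ?thesis
      using int_S[where B=B and R=R and \<phi>=\<phi>] that by (simp add: D_def left_diff_distrib)
  qed
  have "AE x in lebesgue_on UNIV. D x = 0"
  proof (rule fundamental_lemma)
    show "locally_integrable UNIV D"
      unfolding locally_integrable_def
    proof safe
      fix K :: "'a set" assume "compact K"
      then have K[measurable]: "K \<in> sets borel" by (rule borel_compact)
      obtain R where R: "\<And>x. x \<in> K \<Longrightarrow> norm x \<le> R"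
        using compact_imp_bounded[OF \<open>compact K\<close>] by (auto simp: bounded_iff)
      have "integrable lborel (\<lambda>x. D x * indicator K x)"
        using R by (intro int_D[where B=1 and R=R]) (auto split: split_indicator)
      then have "integrable lebesgue (\<lambda>x. D x * indicator K x)"
        by (simp add: integrable_completion)
      then show "set_integrable lebesgue K D"
        by (simp add: set_integrable_def mult.commute)
    qed
    fix \<phi> :: "'a \<Rightarrow> real" assume t: "test_function UNIV \<phi>"
    note [measurable] = test_function_measurable[OF t]
    obtain B R where BR: "\<And>x. \<bar>\<phi> x\<bar> \<le> B" "\<And>x. x \<notin> cball 0 R \<Longrightarrow> \<phi> x = 0"
      by (rule test_function_cball[OF t]) (rule that)
    have iv: "integrable lborel (\<lambda>x. v (x + c) * \<phi> x)" for c
      by (rule int_v[where B=B and R=R]) (use BR in auto)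
    have iS: "integrable lborel (\<lambda>x. S x * \<phi> x)"
      by (rule int_S[where B=B and R=R]) (use BR in auto)
    have eS: "(LINT x|lborel. S x * \<phi> x)
      = (LINT t:{0..1}|lborel. LINT x|lborel. (gr (x + t *\<^sub>R h) \<bullet> h) * \<phi> x)"
      by (rule eq_S[where B=B and R=R]) (use BR in auto)
    have t': "test_function UNIV (partial_deriv i \<phi>)" if "i \<in> Basis" for i
      using test_function_directional(3)[OF t that] .
    \<comment> \<open>The derivative of \<open>\<phi>\<close> in direction \<open>h\<close>; it is
      again a test function.\<close>
    define \<psi> where "\<psi> x = (\<Sum>i\<in>Basis. (h \<bullet> i) * partial_deriv i \<phi> x)" for x
    have t\<psi>: "test_function UNIV \<psi>"
    proof -
      have "Ck k \<psi>" for k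
      proof -
        have "Ck k (\<lambda>x. \<Sum>i\<in>I. (h \<bullet> i) * partial_deriv i \<phi> x)" if "I \<subseteq> Basis" for I
          using finite_subset[OF that finite_Basis] that
          by (induction I rule: finite_induct)
            (use t' in \<open>auto intro!: Ck_add Ck_mult Ck_const simp: test_function_def\<close>)
        then show ?thesis by (auto simp: \<psi>_def[abs_def])
      qed
      have "\<psi> x = 0" if "x \<notin> (\<Union>i\<in>Basis. closure {x. partial_deriv i \<phi> x \<noteq> 0})" for x
      proof -
        have "partial_deriv i \<phi> x = 0" if "i \<in> Basis" for i
          using \<open>x \<notin> _\<close> that closure_subset[of "{x. partial_deriv i \<phi> x \<noteq> 0}"] by blast
        then show ?thesis by (simp add: \<psi>_def)
      qed
      then have "{x. \<psi> x \<noteq> 0} \<subseteq> (\<Union>i\<in>Basis. closure {x. partial_deriv i \<phi> x \<noteq> 0})" by blast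
      moreover have "bounded (\<Union>i\<in>Basis. closure {x. partial_deriv i \<phi> x \<noteq> 0})"
      proof (intro bounded_UN finite_Basis ballI compact_imp_bounded)
        fix i :: 'a assume "i \<in> Basis"
        from t'[OF this] show "compact (closure {x. partial_deriv i \<phi> x \<noteq> 0})"
          by (simp only: test_function_def)
      qed
      ultimately have "bounded {x. \<psi> x \<noteq> 0}" using bounded_subset by blast
      with \<open>\<And>k. Ck k \<psi>\<close> show ?thesis by (simp add: test_function_def)
    qed
    note [measurable] = test_function_measurable[OF t\<psi>]
    obtain B' R' where BR': "\<And>x. \<bar>\<psi> x\<bar> \<le> B'" "\<And>x. x \<notin> cball 0 R' \<Longrightarrow> \<psi> x = 0"
      by (rule test_function_cball[OF t\<psi>]) (rule that)
    have FTC: "\<phi> (y - h) - \<phi> y = - (LINT t:{0..1}|lborel. \<psi> (y - t *\<^sub>R h))" for y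
    proof -
      have d: "(\<phi> has_derivative (\<lambda>k. frechet_derivative \<phi> (at x) k)) (at x)" for x
        using t by (simp add: test_function_def frechet_derivative_works[symmetric]) (metis Ck.simps(2))
      have \<psi>': "frechet_derivative \<phi> (at x) h = \<psi> x" for x
      proof -
        interpret linear "frechet_derivative \<phi> (at x)" using d has_derivative_linear by blast
        have "frechet_derivative \<phi> (at x) (\<Sum>i\<in>Basis. (h \<bullet> i) *\<^sub>R i) = \<psi> x"
          by (simp add: sum scale \<psi>_def)
        then show ?thesis by (simp add: euclidean_representation)
      qed
      have "((\<lambda>t. \<phi> (y - t *\<^sub>R h)) has_real_derivative - \<psi> (y - t *\<^sub>R h)) (at t)" for t
      proof -
        have "((\<lambda>t. y - t *\<^sub>R h) has_derivative (\<lambda>s. - s *\<^sub>R h)) (at t)"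
          by (auto intro!: derivative_eq_intros)
        from has_derivative_compose[OF this d]
        have "((\<lambda>t. \<phi> (y - t *\<^sub>R h)) has_derivative
          (\<lambda>s. frechet_derivative \<phi> (at (y - t *\<^sub>R h)) (- s *\<^sub>R h))) (at t)" .
        moreover have "frechet_derivative \<phi> (at x) (- s *\<^sub>R h) = - \<psi> x * s" for s x
        proof -
          interpret linear "frechet_derivative \<phi> (at x)" using d has_derivative_linear by blast
          show ?thesis by (simp only: scale \<psi>') simp
        qed
        ultimately show ?thesis by (simp only: has_field_derivative_def)
      qed
      moreover have "isCont (\<lambda>t. - \<psi> (y - t *\<^sub>R h)) t" for t
      proof -
        have "continuous_on UNIV \<psi>" using t\<psi> by (rule test_function_continuous)
        moreover have "continuous_on UNIV (\<lambda>t. y - t *\<^sub>R h)" by (intro continuous_intros)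
        ultimately have "continuous_on UNIV (\<lambda>t. \<psi> (y - t *\<^sub>R h))"
          by (rule continuous_on_compose2) simp
        then have "isCont (\<lambda>t. \<psi> (y - t *\<^sub>R h)) t"
          by (simp add: continuous_on_eq_continuous_at)
        then show ?thesis by (rule continuous_minus)
      qed
      ultimately have "(LINT t|lborel. - \<psi> (y - t *\<^sub>R h) * indicator {0..1} t) = \<phi> (y - 1 *\<^sub>R h) - \<phi> (y - 0 *\<^sub>R h)"
        by (intro integral_FTC_Icc_real) auto
      then show ?thesis by (simp add: set_lebesgue_integral_def mult.commute)
    qed
    have I2: "integrable (lborel \<Otimes>\<^sub>M lborel) (\<lambda>(t, y). indicator {0..1} t * (v y * \<psi> (y - t *\<^sub>R h)))"
      by (rule line_Fubini(2)[OF v_meas _ v_loc BR']) auto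
    have "(LINT x|lborel. (v (x + h) - v x) * \<phi> x) = (LINT x|lborel. v (x + h) * \<phi> x) - (LINT x|lborel. v (x + 0) * \<phi> x)"
      using iv[of h] iv[of 0] by (simp add: left_diff_distrib)
    also have "(LINT x|lborel. v (x + h) * \<phi> x) = (LINT y|lborel. v y * \<phi> (y - h))"
      using lborel_integral_translate[of "\<lambda>y. v y * \<phi> (y - h)" h] by simp
    also have "\<dots> - (LINT x|lborel. v (x + 0) * \<phi> x) = (LINT y|lborel. v y * (\<phi> (y - h) - \<phi> y))"
    proof -
      have "integrable lborel (\<lambda>y. v y * \<phi> (y - h))"
        using integrable_lborel_translate[OF iv[of h], where c="- h"] by simp
      then show ?thesis
        using iv[of 0] by (simp add: right_diff_distrib)
    qed
    also have "\<dots> = - (LINT y|lborel. LINT t|lborel. indicator {0..1} t * (v y * \<psi> (y - t *\<^sub>R h)))"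
    proof -
      have "v y * (\<phi> (y - h) - \<phi> y) = - (LINT t|lborel. indicator {0..1} t * (v y * \<psi> (y - t *\<^sub>R h)))" for y
      proof -
        have "(LINT t|lborel. indicator {0..1} t * (v y * \<psi> (y - t *\<^sub>R h)))
            = (LINT t|lborel. v y * (indicator {0..1} t * \<psi> (y - t *\<^sub>R h)))"
          by (intro Bochner_Integration.integral_cong) auto
        then show ?thesis by (simp add: FTC set_lebesgue_integral_def)
      qed
      then show ?thesis by simp
    qed
    also have "\<dots> = - (LINT t|lborel. LINT y|lborel. indicator {0..1} t * (v y * \<psi> (y - t *\<^sub>R h)))"
      by (subst lborel_pair.Fubini_integral[OF I2]) simp
    also have "\<dots> = (LINT t:{0..1}|lborel. LINT y|lborel. (gr y \<bullet> h) * \<phi> (y - t *\<^sub>R h))"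
      using weak_directional[OF t, where h=h] by (simp add: \<psi>_def set_lebesgue_integral_def)
    also have "\<dots> = (LINT t:{0..1}|lborel. LINT x|lborel. (gr (x + t *\<^sub>R h) \<bullet> h) * \<phi> x)"
    proof -
      have "(LINT y|lborel. (gr y \<bullet> h) * \<phi> (y - c)) = (LINT x|lborel. (gr (x + c) \<bullet> h) * \<phi> x)" for c
        using lborel_integral_translate[of "\<lambda>y. (gr y \<bullet> h) * \<phi> (y - c)" c] by simp
      then show ?thesis by simp
    qed
    also have "\<dots> = (LINT x|lborel. S x * \<phi> x)"
      using eS by simp
    finally have "(LINT x|lborel. (v (x + h) - v x) * \<phi> x) = (LINT x|lborel. S x * \<phi> x)" .
    moreover have "(LINT x|lborel. D x * \<phi> x)
        = (LINT x|lborel. (v (x + h) - v x) * \<phi> x) - (LINT x|lborel. S x * \<phi> x)"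
      using iv[of h] iv[of 0] iS
      by (simp add: D_def left_diff_distrib)
    ultimately have "(LINT x|lborel. D x * \<phi> x) = 0" by simp
    then show "(LINT x|lebesgue_on UNIV. D x * \<phi> x) = 0"
      by (simp add: lebesgue_on_UNIV_eq integral_completion)
  qed simp
  then have "AE x in lborel. D x = 0" unfolding lebesgue_on_UNIV_eq AE_completion_iff .
  then show ?thesis by eventually_elim (auto simp: D_def S_def)
qed

end

subsection \<open>Crossing a strip of levels\<close>

text \<open>The graph of \<open>y powr p\<close> lies above its tangent at \<open>c\<close>; in this
  form it is Young's inequality with exponents \<open>p\<close> and
  \<open>p / (p - 1)\<close>.\<close>

lemma powr_tangent_le:
  fixes c y p :: real
  assumes "1 < p" "0 \<le> c" "0 \<le> y"
  shows "p * c powr (p - 1) * y \<le> y powr p + (p - 1) * c powr p"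
proof -
  let ?q = "p / (p - 1)"
  have q: "1 < ?q" "1 / p + 1 / ?q = 1" using assms by (auto simp: field_simps)
  have "y * c powr (p - 1) \<le> y powr p / p + (c powr (p - 1)) powr ?q / ?q"
    using q assms by (intro Youngs_inequality) auto
  also have "(c powr (p - 1)) powr ?q = c powr p"
    using assms by (simp add: powr_powr)
  finally show ?thesis using assms by (simp add: field_simps)
qed

text \<open>Integrating the tangent inequality at \<open>c\<close> gives
  \<open>p c^p \<le> \<integral> f^p + (p - 1) c^p\<close>, and the finite last term cancels. The
  argument also covers infinite integrals.\<close>

lemma nn_integral_unit_interval_Jensen:
  fixes f :: "real \<Rightarrow> real"
  assumes p: "1 < p" and c: "0 \<le> c" and [measurable]: "f \<in> borel_measurable borel"
    and f: "\<And>t. 0 \<le> f t"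
    and le: "ennreal c \<le> (\<integral>\<^sup>+t\<in>{0..1}. ennreal (f t) \<partial>lborel)"
  shows "ennreal (c powr p) \<le> (\<integral>\<^sup>+t\<in>{0..1}. ennreal (f t powr p) \<partial>lborel)"
proof -
  let ?I = "\<integral>\<^sup>+t\<in>{0..1}. ennreal (f t powr p) \<partial>lborel"
  have "ennreal (p * c powr p) = ennreal (p * c powr (p - 1)) * ennreal c"
    using p c by (cases "c = 0") (auto simp: ennreal_mult'[symmetric] powr_mult_base mult.assoc powr_diff)
  also have "\<dots> \<le> ennreal (p * c powr (p - 1)) * (\<integral>\<^sup>+t\<in>{0..1}. ennreal (f t) \<partial>lborel)"
    by (intro mult_left_mono le) simp
  also have "\<dots> = (\<integral>\<^sup>+t. ennreal (p * c powr (p - 1)) * (ennreal (f t) * indicator {0..1} t) \<partial>lborel)"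
    by (subst nn_integral_cmult) auto
  also have "\<dots> \<le> (\<integral>\<^sup>+t. ennreal (f t powr p) * indicator {0..1} t
      + ennreal ((p - 1) * c powr p) * indicator {0..1} t \<partial>lborel)"
    using powr_tangent_le[OF p c f] p c f
    by (intro nn_integral_mono)
      (auto simp: ennreal_mult'[symmetric] ennreal_plus[symmetric] simp del: ennreal_plus
        intro!: ennreal_leI split: split_indicator)
  also have "\<dots> = ?I + ennreal ((p - 1) * c powr p)"
    by (subst nn_integral_add) (auto simp: nn_integral_cmult_indicator)
  finally have "ennreal (p * c powr p) \<le> ?I + ennreal ((p - 1) * c powr p)" .
  moreover have "ennreal (p * c powr p) = ennreal (c powr p) + ennreal ((p - 1) * c powr p)"
  proof -
    have *: "p * c powr p = c powr p + (p - 1) * c powr p" by (simp add: algebra_simps)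
    show ?thesis by (subst *, rule ennreal_plus) (use p in auto)
  qed
  ultimately show ?thesis
    by (metis add.commute ennreal_add_left_cancel_le ennreal_neq_top infinity_ennreal_def)
qed

text \<open>Let \<phi> be the continuous version of \<open>w\<close>, let \<open>b\<close> be the
  first time at which \<open>|\<phi>| \<le> l\<close>, and \<open>a\<close> the last time before
  \<open>b\<close> at which \<open>|\<phi>| \<ge> l'\<close>. Between \<open>a\<close> and
  \<open>b\<close> the values of \<open>|\<phi>|\<close> stay in the strip, and the increment over
  \<open>[a,b]\<close> already pays for the whole drop. The values at the two ends are separate
  hypotheses because a formula for almost every \<open>t\<close> says nothing about
  \<open>t = 1\<close>.\<close>

lemma line_crossing:
  fixes q w :: "real \<Rightarrow> real"
  assumes q: "set_integrable lborel {0..1} q" and l: "l < l'"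
    and w: "AE t in lborel. t \<in> {0<..1} \<longrightarrow> w t = w 0 + (LINT s:{0..t}|lborel. q s)"
    and w1: "w 1 = w 0 + (LINT s:{0..1}|lborel. q s)"
    and w0: "l' \<le> \<bar>w 0\<bar>" and w1': "\<bar>w 1\<bar> \<le> l"
  shows "ennreal (l' - l) \<le> (\<integral>\<^sup>+t\<in>{0..1}. ennreal (\<bar>q t\<bar> * indicator {l..l'} \<bar>w t\<bar>) \<partial>lborel)"
proof -
  define \<phi> where "\<phi> t = w 0 + (LINT s:{0..t}|lborel. q s)" for t
  have q': "set_integrable lborel {0..t} q" if "t \<in> {0..1}" for t
    using q by (rule set_integrable_subset) (use that in auto)
  have \<phi>_eq: "\<phi> t = w 0 + integral {0..t} q" if "t \<in> {0..1}" for t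
    using set_borel_integral_eq_integral(2)[OF q'[OF that]] by (simp add: \<phi>_def)
  have "continuous_on {0..1} (\<lambda>t. integral {0..t} q)"
    by (intro indefinite_integral_continuous_1 set_borel_integral_eq_integral(1) q)
  then have "continuous_on {0..1} (\<lambda>t. w 0 + integral {0..t} q)" by (intro continuous_intros)
  then have c\<phi>: "continuous_on {0..1} \<phi>"
    by (rule continuous_on_eq) (use \<phi>_eq in auto)
  have \<phi>0: "\<phi> 0 = w 0" by (simp add: \<phi>_eq)
  let ?g = "\<lambda>t. \<bar>\<phi> t\<bar>"
  have cg: "continuous_on {0..1} ?g" using c\<phi> by (rule continuous_on_rabs)
  let ?S = "{t \<in> {0..1}. ?g t \<in> {..l}}"
  have "closed ?S" by (rule continuous_closed_preimage[OF cg, unfolded vimage_def Int_def mem_Collect_eq]) auto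
  then have "compact ?S"
    unfolding compact_eq_bounded_closed by (auto intro: bounded_subset[of "{0..1}"])
  moreover have "1 \<in> ?S" using w1 w1' by (simp add: \<phi>_def)
  ultimately obtain b where b: "b \<in> ?S" "\<And>t. t \<in> ?S \<Longrightarrow> b \<le> t"
    using compact_attains_inf[of ?S] by blast
  have cb: "continuous_on {0..b} ?g" using cg by (rule continuous_on_subset) (use b in auto)
  let ?T = "{t \<in> {0..b}. ?g t \<in> {l'..}}"
  have "closed ?T" by (rule continuous_closed_preimage[OF cb, unfolded vimage_def Int_def mem_Collect_eq]) auto
  then have "compact ?T"
    unfolding compact_eq_bounded_closed by (auto intro: bounded_subset[of "{0..b}"])
  moreover have "0 \<in> ?T" using w0 b(1) by (simp add: \<phi>0)
  ultimately obtain a where a: "a \<in> ?T" "\<And>t. t \<in> ?T \<Longrightarrow> t \<le> a"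
    using compact_attains_sup[of ?T] by blast
  have ab: "0 \<le> a" "a \<le> b" "b \<le> 1" "l' \<le> \<bar>\<phi> a\<bar>" "\<bar>\<phi> b\<bar> \<le> l" using a b by auto
  have between: "\<bar>\<phi> t\<bar> \<in> {l..l'}" if "a < t" "t < b" for t
    using a(2)[of t] b(2)[of t] that ab by (auto intro: ccontr)
  have I: "integrable lborel (\<lambda>s. indicator {0..t} s * q s)" if "t \<in> {0..1}" for t
    using q'[OF that] by (simp add: set_integrable_def)
  have d: "\<phi> b - \<phi> a = (LINT s|lborel. indicator {0..b} s * q s - indicator {0..a} s * q s)"
    using I[of a] I[of b] ab by (subst Bochner_Integration.integral_diff) (auto simp: \<phi>_def set_lebesgue_integral_def)
  have "l' - l \<le> \<bar>\<phi> b - \<phi> a\<bar>" using ab by linarith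
  then have "ennreal (l' - l) \<le> ennreal (norm (LINT s|lborel. indicator {0..b} s * q s - indicator {0..a} s * q s))"
    by (simp add: d[symmetric] ennreal_leI)
  also have "\<dots> \<le> (\<integral>\<^sup>+s. ennreal (norm (indicator {0..b} s * q s - indicator {0..a} s * q s)) \<partial>lborel)"
    using I[of a] I[of b] ab by (intro integral_norm_bound_ennreal Bochner_Integration.integrable_diff) auto
  also have "\<dots> \<le> (\<integral>\<^sup>+t\<in>{0..1}. ennreal (\<bar>q t\<bar> * indicator {l..l'} \<bar>w t\<bar>) \<partial>lborel)"
  proof (rule nn_integral_mono_AE)
    show "AE s in lborel. ennreal (norm (indicator {0..b} s * q s - indicator {0..a} s * q s))
        \<le> ennreal (\<bar>q s\<bar> * indicator {l..l'} \<bar>w s\<bar>) * indicator {0..1} s"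
      using w AE_lborel_singleton[of b]
    proof eventually_elim
      case (elim s)
      show ?case
      proof (cases "a < s \<and> s < b")
        case True
        then have "w s = \<phi> s" using elim ab by (auto simp: \<phi>_def)
        then show ?thesis using between[of s] True ab by (auto simp: indicator_def)
      next
        case False
        then show ?thesis using elim ab by (auto simp: indicator_def)
      qed
    qed
  qed
  finally show ?thesis .
qed

context sobolev_gradient begin

text \<open>For fixed \<open>t\<close> this is the segment formula for \<open>t *\<^sub>R h\<close>,
  rescaled, valid for almost every \<open>x\<close>. Exchanging the order of the two exceptional
  sets gives almost every \<open>t\<close> for almost every \<open>x\<close>.\<close>

lemma segment_formula_line:
  "AE x in lborel. AE t in lborel. t \<in> {0<..1} \<longrightarrow>
    v (x + t *\<^sub>R h) = v x + (LINT s:{0..t}|lborel. gr (x + s *\<^sub>R h) \<bullet> h)"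
proof -
  have *: "AE x in lborel. t \<in> {0<..1} \<longrightarrow>
      v (x + t *\<^sub>R h) = v x + (LINT s:{0..t}|lborel. gr (x + s *\<^sub>R h) \<bullet> h)" for t
  proof (cases "t \<in> {0<..1}")
    case True
    have "(LINT s:{0..1}|lborel. gr (x + s *\<^sub>R t *\<^sub>R h) \<bullet> t *\<^sub>R h) = (LINT s:{0..t}|lborel. gr (x + s *\<^sub>R h) \<bullet> h)" for x
    proof -
      have "(LINT s:{0..t}|lborel. gr (x + s *\<^sub>R h) \<bullet> h)
          = \<bar>t\<bar> *\<^sub>R (LINT s|lborel. indicator {0..t} (0 + t * s) *\<^sub>R (gr (x + (0 + t * s) *\<^sub>R h) \<bullet> h))"
        using True unfolding set_lebesgue_integral_def
        by (intro lborel_integral_real_affine) auto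
      also have "\<dots> = (LINT s|lborel. t *\<^sub>R (indicator {0..t} (0 + t * s) *\<^sub>R (gr (x + (0 + t * s) *\<^sub>R h) \<bullet> h)))"
        using True by simp
      also have "\<dots> = (LINT s:{0..1}|lborel. gr (x + s *\<^sub>R t *\<^sub>R h) \<bullet> t *\<^sub>R h)"
        unfolding set_lebesgue_integral_def using True
        by (intro Bochner_Integration.integral_cong)
          (auto simp: indicator_def mult.commute zero_le_mult_iff)
      finally show ?thesis ..
    qed
    then show ?thesis using segment_formula[of "t *\<^sub>R h"] True by simp
  next
    case False
    then show ?thesis by (intro AE_I2) blast
  qed
  \<comment> \<open>The upper limit of integration is written as a condition on \<open>s\<close>; in
    this form joint measurability in \<open>t\<close> and \<open>x\<close> can be read off.\<close>
  have m: "{z \<in> space (lborel \<Otimes>\<^sub>M lborel). fst z \<in> {0<..1} \<longrightarrow>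
      v (snd z + fst z *\<^sub>R h) = v (snd z) + (LINT s|lborel. (if 0 \<le> s \<and> s \<le> fst z then gr (snd z + s *\<^sub>R h) \<bullet> h else 0))}
      \<in> sets (lborel \<Otimes>\<^sub>M lborel)"
    by measurable
  have e: "(LINT s:{0..t}|lborel. gr (x + s *\<^sub>R h) \<bullet> h) = (LINT s|lborel. (if 0 \<le> s \<and> s \<le> t then gr (x + s *\<^sub>R h) \<bullet> h else 0))" for x t
    unfolding set_lebesgue_integral_def by (intro Bochner_Integration.integral_cong) auto
  show ?thesis
    unfolding e using lborel_pair.AE_commute[OF m] * unfolding e by simp
qed

text \<open>The version that keeps the whole gradient. It serves the estimate for separated sets in
  a ball, where the size of the increment is known directly.\<close>

lemma AE_difference_powr_le:
  assumes p: "1 < p"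
  shows "AE x in lborel. ennreal (\<bar>v (x + h) - v x\<bar> powr p)
    \<le> (\<integral>\<^sup>+t\<in>{0..1}. ennreal (norm h powr p * norm (gr (x + t *\<^sub>R h)) powr p) \<partial>lborel)"
  using segment_formula[of h] AE_line_integrable[of h]
proof eventually_elim
  case (elim x)
  let ?f = "\<lambda>t. norm h * norm (gr (x + t *\<^sub>R h))"
  have "ennreal \<bar>v (x + h) - v x\<bar> = ennreal (norm (LINT t|lborel. indicator {0..1} t *\<^sub>R (gr (x + t *\<^sub>R h) \<bullet> h)))"
    using elim by (simp add: set_lebesgue_integral_def)
  also have "\<dots> \<le> (\<integral>\<^sup>+t. ennreal (norm (indicator {0..1} t *\<^sub>R (gr (x + t *\<^sub>R h) \<bullet> h))) \<partial>lborel)"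
    using elim by (intro integral_norm_bound_ennreal) (auto simp: set_integrable_def)
  also have "\<dots> \<le> (\<integral>\<^sup>+t\<in>{0..1}. ennreal (?f t) \<partial>lborel)"
    by (intro nn_integral_mono)
      (auto simp: Cauchy_Schwarz_ineq2 mult.commute[of "norm h"] intro!: ennreal_leI split: split_indicator)
  finally have "ennreal (\<bar>v (x + h) - v x\<bar> powr p) \<le> (\<integral>\<^sup>+t\<in>{0..1}. ennreal (?f t powr p) \<partial>lborel)"
    by (intro nn_integral_unit_interval_Jensen[OF p]) auto
  then show ?case by (simp add: powr_mult)
qed

lemma AE_crossing_powr_le:
  assumes p: "1 < p" and l: "l < l'"
  shows "AE x in lborel. l' \<le> \<bar>v x\<bar> \<and> \<bar>v (x + h)\<bar> \<le> l \<longrightarrow> ennreal ((l' - l) powr p)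
    \<le> (\<integral>\<^sup>+t\<in>{0..1}. ennreal (norm h powr p * (norm (gr (x + t *\<^sub>R h)) powr p * indicator {l..l'} \<bar>v (x + t *\<^sub>R h)\<bar>)) \<partial>lborel)"
  using segment_formula[of h] AE_line_integrable[of h] segment_formula_line[of h]
proof eventually_elim
  case (elim x)
  let ?f = "\<lambda>t. norm h * norm (gr (x + t *\<^sub>R h)) * indicator {l..l'} \<bar>v (x + t *\<^sub>R h)\<bar>"
  show ?case
  proof
    assume "l' \<le> \<bar>v x\<bar> \<and> \<bar>v (x + h)\<bar> \<le> l"
    then have "ennreal (l' - l) \<le> (\<integral>\<^sup>+t\<in>{0..1}. ennreal (\<bar>gr (x + t *\<^sub>R h) \<bullet> h\<bar> * indicator {l..l'} \<bar>v (x + t *\<^sub>R h)\<bar>) \<partial>lborel)"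
      using elim l by (intro line_crossing[where w="\<lambda>t. v (x + t *\<^sub>R h)"]) auto
    also have "\<dots> \<le> (\<integral>\<^sup>+t\<in>{0..1}. ennreal (?f t) \<partial>lborel)"
      by (intro nn_integral_mono)
        (auto simp: Cauchy_Schwarz_ineq2 mult.commute[of "norm h"] intro!: ennreal_leI split: split_indicator)
    finally have "ennreal ((l' - l) powr p) \<le> (\<integral>\<^sup>+t\<in>{0..1}. ennreal (?f t powr p) \<partial>lborel)"
      using l by (intro nn_integral_unit_interval_Jensen[OF p]) auto
    also have "(\<lambda>t. ?f t powr p) = (\<lambda>t. norm h powr p * (norm (gr (x + t *\<^sub>R h)) powr p * indicator {l..l'} \<bar>v (x + t *\<^sub>R h)\<bar>))"
      by (auto simp: powr_mult indicator_def fun_eq_iff)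
    finally show "ennreal ((l' - l) powr p)
      \<le> (\<integral>\<^sup>+t\<in>{0..1}. ennreal (norm h powr p * (norm (gr (x + t *\<^sub>R h)) powr p * indicator {l..l'} \<bar>v (x + t *\<^sub>R h)\<bar>)) \<partial>lborel)" .
  qed
qed

text \<open>After exchanging the integrals over \<open>x\<close> and \<open>t\<close>, the
  translation by \<open>t *\<^sub>R h\<close> leaves the integral of the strip gradient unchanged
  for each \<open>t\<close>, so averaging along the segment costs no constant.\<close>

lemma level_shift:
  assumes p: "1 < p" and l: "l < l'"
  shows "(\<integral>\<^sup>+x. ennreal ((l' - l) powr p) * indicator {x. l' \<le> \<bar>v x\<bar> \<and> \<bar>v (x + h)\<bar> \<le> l} x \<partial>lborel)
    \<le> ennreal (norm h powr p) * (\<integral>\<^sup>+x. ennreal (norm (gr x) powr p * indicator {l..l'} \<bar>v x\<bar>) \<partial>lborel)"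
proof -
  let ?G = "\<lambda>x. ennreal (norm (gr x) powr p * indicator {l..l'} \<bar>v x\<bar>)"
  have "(\<integral>\<^sup>+x. ennreal ((l' - l) powr p) * indicator {x. l' \<le> \<bar>v x\<bar> \<and> \<bar>v (x + h)\<bar> \<le> l} x \<partial>lborel)
    \<le> (\<integral>\<^sup>+x. \<integral>\<^sup>+t. ennreal (norm h powr p) * (?G (x + t *\<^sub>R h) * indicator {0..1} t) \<partial>lborel \<partial>lborel)"
    using AE_crossing_powr_le[OF p l, of h]
    by (intro nn_integral_mono_AE, eventually_elim)
      (auto simp: ennreal_mult mult.assoc split: split_indicator)
  also have "\<dots> = (\<integral>\<^sup>+t. \<integral>\<^sup>+x. ennreal (norm h powr p) * (?G (x + t *\<^sub>R h) * indicator {0..1} t) \<partial>lborel \<partial>lborel)"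
    by (intro lborel_pair.Fubini') measurable
  also have "\<dots> = (\<integral>\<^sup>+t. ennreal (norm h powr p) * (\<integral>\<^sup>+x. ?G x \<partial>lborel) * indicator {0..1} (t::real) \<partial>lborel)"
  proof (intro nn_integral_cong)
    fix t :: real
    have "(\<integral>\<^sup>+x. ennreal (norm h powr p) * (?G (x + t *\<^sub>R h) * indicator {0..1} t) \<partial>lborel)
      = ennreal (norm h powr p) * (\<integral>\<^sup>+x. ?G (x + t *\<^sub>R h) \<partial>lborel) * indicator {0..1} t"
      by (simp add: nn_integral_cmult nn_integral_multc mult.assoc)
    also have "(\<integral>\<^sup>+x. ?G (x + t *\<^sub>R h) \<partial>lborel) = (\<integral>\<^sup>+x. ?G x \<partial>lborel)"
      by (rule nn_integral_lborel_translate) measurable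
    finally show "(\<integral>\<^sup>+x. ennreal (norm h powr p) * (?G (x + t *\<^sub>R h) * indicator {0..1} t) \<partial>lborel)
      = ennreal (norm h powr p) * (\<integral>\<^sup>+x. ?G x \<partial>lborel) * indicator {0..1} t" .
  qed
  also have "\<dots> = ennreal (norm h powr p) * (\<integral>\<^sup>+x. ?G x \<partial>lborel)"
    by (simp add: nn_integral_cmult_indicator)
  finally show ?thesis .
qed

text \<open>\<open>level_shift\<close> is integrated over \<open>h\<close> in the ball of radius
  \<rho>. Each \<open>x\<close> of the upper level set meets at least mass \<open>m\<close> of
  endpoints on the low side. The set \<open>D\<close> constrains only the endpoints: the segments
  may leave \<open>D\<close>, which is why the gradient on the right is taken over the whole space
  and why a function extended beyond \<open>D\<close> is required.\<close>

lemma level_set_inequality: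
  assumes p: "1 < p" and l: "l < l'" and [measurable]: "D \<in> sets borel" and \<rho>: "0 < \<rho>"
    and m: "\<And>x. x \<in> D \<Longrightarrow> m \<le> emeasure lborel ({y \<in> D. \<bar>v y\<bar> \<le> l} \<inter> ball x \<rho>)"
  shows "ennreal ((l' - l) powr p) * emeasure lborel {x \<in> D. l' \<le> \<bar>v x\<bar>} * m
    \<le> ennreal (\<rho> powr p) * emeasure lborel (ball (0::'a) \<rho>)
      * (\<integral>\<^sup>+x. ennreal (norm (gr x) powr p * indicator {l..l'} \<bar>v x\<bar>) \<partial>lborel)"
proof -
  define A Z where "A = {x \<in> D. l' \<le> \<bar>v x\<bar>}" and "Z = {y \<in> D. \<bar>v y\<bar> \<le> l}"
  let ?I = "\<integral>\<^sup>+x. ennreal (norm (gr x) powr p * indicator {l..l'} \<bar>v x\<bar>) \<partial>lborel"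
  let ?c = "ennreal ((l' - l) powr p)"
  have [measurable]: "A \<in> sets borel" "Z \<in> sets borel" unfolding A_def Z_def by measurable
  have [measurable]: "ball (x::'a) \<rho> \<in> sets borel" for x by simp
  have "?c * emeasure lborel A * m = (\<integral>\<^sup>+x. (?c * m) * indicator A x \<partial>lborel)"
    by (subst nn_integral_cmult_indicator) (auto simp: mult_ac)
  also have "\<dots> \<le> (\<integral>\<^sup>+x. \<integral>\<^sup>+h. ?c * indicator A x * (indicator (ball 0 \<rho>) h * indicator Z (h + x)) \<partial>lborel \<partial>lborel)"
  proof (intro nn_integral_mono)
    fix x :: 'a
    have "(\<integral>\<^sup>+h. indicator (ball 0 \<rho>) h * indicator Z (h + x) \<partial>lborel)
        = (\<integral>\<^sup>+h. indicator (Z \<inter> ball x \<rho>) (h + x) \<partial>lborel)"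
      by (intro nn_integral_cong) (auto simp: indicator_def dist_norm)
    also have "\<dots> = (\<integral>\<^sup>+y. indicator (Z \<inter> ball x \<rho>) y \<partial>lborel)"
      by (rule nn_integral_lborel_translate) measurable
    also have "\<dots> = emeasure lborel (Z \<inter> ball x \<rho>)" by simp
    finally have e: "(\<integral>\<^sup>+h. indicator (ball 0 \<rho>) h * indicator Z (h + x) \<partial>lborel) = emeasure lborel (Z \<inter> ball x \<rho>)" .
    have "?c * m * indicator A x \<le> ?c * indicator A x * emeasure lborel (Z \<inter> ball x \<rho>)"
      using m[of x] by (auto simp: A_def Z_def split: split_indicator intro: mult_left_mono)
    also have "\<dots> = (\<integral>\<^sup>+h. ?c * indicator A x * (indicator (ball 0 \<rho>) h * indicator Z (h + x)) \<partial>lborel)"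
      unfolding e[symmetric] by (rule nn_integral_cmult[symmetric]) measurable
    finally show "?c * m * indicator A x \<le> (\<integral>\<^sup>+h. ?c * indicator A x * (indicator (ball 0 \<rho>) h * indicator Z (h + x)) \<partial>lborel)" .
  qed
  also have "\<dots> = (\<integral>\<^sup>+h. \<integral>\<^sup>+x. ?c * indicator A x * (indicator (ball 0 \<rho>) h * indicator Z (h + x)) \<partial>lborel \<partial>lborel)"
    by (intro lborel_pair.Fubini') measurable
  also have "\<dots> \<le> (\<integral>\<^sup>+h. (ennreal (\<rho> powr p) * ?I) * indicator (ball 0 \<rho>) (h::'a) \<partial>lborel)"
  proof (intro nn_integral_mono)
    fix h :: 'a
    have "(\<integral>\<^sup>+x. ?c * indicator A x * (indicator (ball 0 \<rho>) h * indicator Z (h + x)) \<partial>lborel)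
        \<le> (\<integral>\<^sup>+x. ?c * indicator {x. l' \<le> \<bar>v x\<bar> \<and> \<bar>v (x + h)\<bar> \<le> l} x \<partial>lborel) * indicator (ball 0 \<rho>) h"
      by (subst nn_integral_multc[symmetric])
        (auto intro!: nn_integral_mono simp: A_def Z_def add.commute split: split_indicator)
    also have "\<dots> \<le> (ennreal (norm h powr p) * ?I) * indicator (ball 0 \<rho>) h"
      using level_shift[OF p l, of h] by (intro mult_right_mono) auto
    also have "\<dots> \<le> (ennreal (\<rho> powr p) * ?I) * indicator (ball 0 \<rho>) h"
      using p by (auto split: split_indicator intro!: mult_right_mono ennreal_leI powr_mono2)
    finally show "(\<integral>\<^sup>+x. ?c * indicator A x * (indicator (ball 0 \<rho>) h * indicator Z (h + x)) \<partial>lborel)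
      \<le> (ennreal (\<rho> powr p) * ?I) * indicator (ball 0 \<rho>) h" .
  qed
  also have "\<dots> = ennreal (\<rho> powr p) * emeasure lborel (ball (0::'a) \<rho>) * ?I"
    by (subst nn_integral_cmult_indicator) (auto simp: mult_ac)
  finally show ?thesis by (simp only: A_def)
qed

end

subsection \<open>Consequences of level set inequalities\<close>

lemma set_nn_integral_powr:
  fixes y r :: real
  assumes "0 < r" "0 \<le> y"
  shows "(\<integral>\<^sup>+t. indicator {0<..} t * (ennreal (t powr (r - 1)) * indicator {..y} t) \<partial>lborel) = ennreal (y powr r / r)"
proof -
  have "(\<integral>\<^sup>+t. indicator {0<..} t * (ennreal (t powr (r - 1)) * indicator {..y} t) \<partial>lborel)
      = (\<integral>\<^sup>+t. ennreal (indicator {0..y} t * t powr (r - 1)) \<partial>lborel)"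
    by (intro nn_integral_cong) (auto simp: indicator_def)
  also have "\<dots> = ennreal (y powr r / r)"
    using nn_integral_has_integral_lebesgue[OF _ has_integral_powr_from_0[of "r - 1" y]] assms by simp
  finally show ?thesis .
qed

lemma layer_cake:
  fixes v :: "'a::euclidean_space \<Rightarrow> real"
  assumes [measurable]: "v \<in> borel_measurable borel" "D \<in> sets borel" and r: "0 < r"
  shows "(\<integral>\<^sup>+t. indicator {0<..} t * (ennreal (t powr (r - 1)) * emeasure lborel {x \<in> D. t \<le> \<bar>v x\<bar>}) \<partial>lborel)
    = (\<integral>\<^sup>+x. ennreal (indicator D x * (\<bar>v x\<bar> powr r / r)) \<partial>lborel)"
proof -
  have "(\<integral>\<^sup>+t. indicator {0<..} t * (ennreal (t powr (r - 1)) * emeasure lborel {x \<in> D. t \<le> \<bar>v x\<bar>}) \<partial>lborel)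
    = (\<integral>\<^sup>+t. \<integral>\<^sup>+x. indicator {0<..} t * (ennreal (t powr (r - 1)) * (if x \<in> D \<and> t \<le> \<bar>v x\<bar> then 1 else 0)) \<partial>lborel \<partial>lborel)"
  proof (intro nn_integral_cong)
    fix t :: real
    have "(\<integral>\<^sup>+x. (if x \<in> D \<and> t \<le> \<bar>v x\<bar> then 1 else 0) \<partial>lborel)
        = (\<integral>\<^sup>+x. indicator {x \<in> D. t \<le> \<bar>v x\<bar>} x \<partial>lborel)"
      by (intro nn_integral_cong) (auto simp: indicator_def)
    also have "\<dots> = emeasure lborel {x \<in> D. t \<le> \<bar>v x\<bar>}"
      by (rule nn_integral_indicator) measurable
    finally have "emeasure lborel {x \<in> D. t \<le> \<bar>v x\<bar>} = (\<integral>\<^sup>+x. (if x \<in> D \<and> t \<le> \<bar>v x\<bar> then 1 else 0) \<partial>lborel)"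
      by simp
    then show "indicator {0<..} t * (ennreal (t powr (r - 1)) * emeasure lborel {x \<in> D. t \<le> \<bar>v x\<bar>})
      = (\<integral>\<^sup>+x. indicator {0<..} t * (ennreal (t powr (r - 1)) * (if x \<in> D \<and> t \<le> \<bar>v x\<bar> then 1 else 0)) \<partial>lborel)"
      by (simp add: nn_integral_cmult)
  qed
  also have "\<dots> = (\<integral>\<^sup>+x. \<integral>\<^sup>+t. indicator {0<..} t * (ennreal (t powr (r - 1)) * (if x \<in> D \<and> t \<le> \<bar>v x\<bar> then 1 else 0)) \<partial>lborel \<partial>lborel)"
    by (intro lborel_pair.Fubini'[symmetric]) measurable
  also have "\<dots> = (\<integral>\<^sup>+x. ennreal (indicator D x * (\<bar>v x\<bar> powr r / r)) \<partial>lborel)"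
  proof (intro nn_integral_cong)
    fix x
    have "(\<integral>\<^sup>+t. indicator {0<..} t * (ennreal (t powr (r - 1)) * (if x \<in> D \<and> t \<le> \<bar>v x\<bar> then 1 else 0)) \<partial>lborel)
      = (\<integral>\<^sup>+t. indicator D x * (indicator {0<..} t * (ennreal (t powr (r - 1)) * indicator {..\<bar>v x\<bar>} t)) \<partial>lborel)"
      by (intro nn_integral_cong) (auto simp: indicator_def)
    also have "\<dots> = indicator D x * ennreal (\<bar>v x\<bar> powr r / r)"
      by (subst nn_integral_cmult) (auto simp: set_nn_integral_powr[OF r])
    finally show "(\<integral>\<^sup>+t. indicator {0<..} t * (ennreal (t powr (r - 1)) * (if x \<in> D \<and> t \<le> \<bar>v x\<bar> then 1 else 0)) \<partial>lborel)
      = ennreal (indicator D x * (\<bar>v x\<bar> powr r / r))"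
      by (auto simp: indicator_def)
  qed
  finally show ?thesis .
qed

text \<open>Finiteness is stated separately because \<open>measure\<close> is 0 on sets of infinite
  measure, so a bound on \<open>measure\<close> alone would carry no information there.\<close>

lemma Chebyshev_powr:
  fixes v :: "'a::euclidean_space \<Rightarrow> real"
  assumes [measurable]: "v \<in> borel_measurable borel" "D \<in> sets borel" and t: "0 < t" and r: "0 < r"
    and int: "integrable lborel (\<lambda>x. indicator D x * \<bar>v x\<bar> powr r)"
  shows "emeasure lborel {x \<in> D. t \<le> \<bar>v x\<bar>} < \<infinity>"
    and "t powr r * measure lborel {x \<in> D. t \<le> \<bar>v x\<bar>} \<le> (LINT x|lborel. indicator D x * \<bar>v x\<bar> powr r)"
proof -
  let ?A = "{x \<in> D. t \<le> \<bar>v x\<bar>}"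
  have "ennreal (t powr r) * emeasure lborel ?A = (\<integral>\<^sup>+x. ennreal (t powr r) * indicator ?A x \<partial>lborel)"
    by (subst nn_integral_cmult_indicator) auto
  also have "\<dots> \<le> (\<integral>\<^sup>+x. ennreal (indicator D x * \<bar>v x\<bar> powr r) \<partial>lborel)"
    using t r by (intro nn_integral_mono) (auto split: split_indicator intro!: ennreal_leI powr_mono2)
  also have "\<dots> = ennreal (LINT x|lborel. indicator D x * \<bar>v x\<bar> powr r)"
    using int by (intro nn_integral_eq_integral) auto
  finally have le: "ennreal (t powr r) * emeasure lborel ?A \<le> ennreal (LINT x|lborel. indicator D x * \<bar>v x\<bar> powr r)" .
  show fin: "emeasure lborel ?A < \<infinity>"
  proof (rule ccontr)
    assume "\<not> emeasure lborel ?A < \<infinity>"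
    then have "emeasure lborel ?A = \<infinity>" by (metis infinity_ennreal_def less_top)
    then show False using le t by (simp add: ennreal_mult_top top_unique)
  qed
  then have "emeasure lborel ?A = ennreal (measure lborel ?A)"
    by (simp add: emeasure_eq_ennreal_measure)
  then have "ennreal (t powr r * measure lborel ?A) \<le> ennreal (LINT x|lborel. indicator D x * \<bar>v x\<bar> powr r)"
    using le by (simp add: ennreal_mult'[symmetric])
  then show "t powr r * measure lborel ?A \<le> (LINT x|lborel. indicator D x * \<bar>v x\<bar> powr r)"
    by (subst (asm) ennreal_le_iff) (auto intro: integral_nonneg_AE)
qed

text \<open>The ratio \<open>c = b powr (- 1 / \<alpha>)\<close> is chosen so that
  \<open>c powr \<alpha>\<close> cancels the growth factor \<open>b\<close> in each step. The
  hypothesis \<open>start\<close> says that \<open>A * y 0 powr \<alpha> \<le> c\<close>, and with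
  this \<open>y j \<le> y 0 * c ^ j\<close> reproduces itself.\<close>

lemma De_Giorgi_iteration:
  fixes y :: "nat \<Rightarrow> real"
  assumes A: "0 \<le> A" and b: "1 < b" and \<alpha>: "0 < \<alpha>" and y: "\<And>j. 0 \<le> y j"
    and step: "\<And>j. y (Suc j) \<le> A * b ^ j * y j powr (1 + \<alpha>)"
    and start: "A * b powr (1 / \<alpha>) * y 0 powr \<alpha> \<le> 1"
  shows "y \<longlonglongrightarrow> 0"
proof -
  define c where "c = b powr (- 1 / \<alpha>)"
  have c: "0 < c" "c < 1" using b \<alpha> by (auto simp: c_def powr_less_one)
  have c\<alpha>: "c powr \<alpha> = 1 / b" unfolding c_def powr_powr using b \<alpha> by (simp add: powr_minus_divide)
  have bc: "b powr (1 / \<alpha>) = 1 / c" by (simp add: c_def powr_minus_divide)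
  have bound: "y j \<le> y 0 * c ^ j" for j
  proof (induction j)
    case (Suc j)
    have "y (Suc j) \<le> A * b ^ j * y j powr (1 + \<alpha>)" by (rule step)
    also have "\<dots> \<le> A * b ^ j * (y 0 * c ^ j) powr (1 + \<alpha>)"
      using A b \<alpha> y Suc by (intro mult_left_mono powr_mono2) auto
    also have "(y 0 * c ^ j) powr (1 + \<alpha>) = y 0 * c ^ j * (y 0 powr \<alpha> * (c powr \<alpha>) ^ j)"
    proof -
      have "(c ^ j) powr \<alpha> = (c powr \<alpha>) ^ j"
        using c by (simp add: powr_realpow[symmetric] powr_powr mult.commute)
      then show ?thesis using y[of 0] c by (simp add: powr_add powr_mult)
    qed
    also have "A * b ^ j * \<dots> = (A * y 0 powr \<alpha>) * (y 0 * c ^ j)"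
      using b by (simp add: c\<alpha> power_one_over field_simps)
    also have "\<dots> \<le> c * (y 0 * c ^ j)"
      using start c y by (intro mult_right_mono) (auto simp: bc field_simps)
    finally show ?case by (simp add: mult_ac)
  qed simp
  have "(\<lambda>j. y 0 * c ^ j) \<longlonglongrightarrow> y 0 * 0"
    using c by (intro tendsto_intros LIMSEQ_realpow_zero) auto
  then have l: "(\<lambda>j. y 0 * c ^ j) \<longlonglongrightarrow> 0" by simp
  show ?thesis
    by (rule tendsto_sandwich[OF _ _ tendsto_const l]) (use y bound in auto)
qed

text \<open>For Sobolev functions, \<open>\<beta> = p / n\<close> and \<open>H\<close> is a multiple of the energy.\<close>

definition level_decay :: "('a::euclidean_space \<Rightarrow> real) \<Rightarrow> 'a set \<Rightarrow> real \<Rightarrow> real \<Rightarrow> real \<Rightarrow> bool" where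
  "level_decay v D p \<beta> H \<longleftrightarrow> (\<forall>l l'. 0 < l \<longrightarrow> l < l' \<longrightarrow>
    (l' - l) powr p * measure lborel {x \<in> D. l' \<le> \<bar>v x\<bar>} \<le> H * measure lborel {x \<in> D. l \<le> \<bar>v x\<bar>} powr \<beta>)"

text \<open>The levels \<open>l j\<close> rise from \<open>M\<close> to \<open>2 M\<close> with gaps
  \<open>M / 2 ^ (j + 1)\<close>, so the decay inequality becomes a De Giorgi recursion with growth
  factor \<open>2 powr p\<close>. Chebyshev's inequality at the level \<open>M\<close> bounds the
  first term, and \<open>le\<close> is exactly what turns this bound into the smallness condition of
  the iteration.\<close>

lemma level_decay_sup_bound:
  fixes v :: "'a::euclidean_space \<Rightarrow> real"
  assumes [measurable]: "v \<in> borel_measurable borel" "D \<in> sets borel"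
    and p: "0 < p" and \<alpha>: "0 < \<alpha>" and s: "0 < s" and H: "0 \<le> H" and M: "0 < M"
    and decay: "level_decay v D p (1 + \<alpha>) H"
    and int: "integrable lborel (\<lambda>x. indicator D x * \<bar>v x\<bar> powr s)"
    and le: "H * 2 powr p * (2 powr p) powr (1 / \<alpha>) * (LINT x|lborel. indicator D x * \<bar>v x\<bar> powr s) powr \<alpha>
      \<le> M powr (p + s * \<alpha>)"
  shows "AE x in lborel. x \<in> D \<longrightarrow> \<bar>v x\<bar> \<le> 2 * M"
proof -
  define S where "S = (LINT x|lborel. indicator D x * \<bar>v x\<bar> powr s)"
  define l where "l j = M * (2 - (1 / 2) ^ j)" for j :: nat
  define y where "y j = measure lborel {x \<in> D. l j \<le> \<bar>v x\<bar>}" for j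
  have l: "M \<le> l j" "l j < 2 * M" "l j < l (Suc j)" "l (Suc j) - l j = M * (1 / 2) ^ Suc j" for j
    using M by (auto simp: l_def field_simps power_le_one)
  have fin: "emeasure lborel {x \<in> D. t \<le> \<bar>v x\<bar>} < \<infinity>" if "0 < t" for t
    using Chebyshev_powr(1)[OF _ _ that s int] by simp
  have "y \<longlonglongrightarrow> 0"
  proof (rule De_Giorgi_iteration[where b="2 powr p" and A="H * 2 powr p / M powr p"])
    have aux: "Y \<le> H * k / P * k' * Z"
      if "e * Y \<le> H * Z" "e = P / (k * k')" "0 < P" "0 < k" "0 < k'" for e Y H Z P k k' :: real
      using that by (simp add: field_simps)
    show "y (Suc j) \<le> H * 2 powr p / M powr p * (2 powr p) ^ j * y j powr (1 + \<alpha>)" for j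
    proof -
      have "(M * (1 / 2) ^ Suc j) powr p * y (Suc j) \<le> H * y j powr (1 + \<alpha>)"
        using decay l[of j] M unfolding level_decay_def y_def l(4)[symmetric] by simp
      moreover have "(M * (1 / 2) ^ Suc j) powr p = M powr p / (2 powr p * (2 powr p) ^ j)"
        using M by (simp add: powr_mult powr_divide powr_power power_divide powr_realpow[symmetric] powr_powr powr_add[symmetric] algebra_simps)
      ultimately show ?thesis by (rule aux) (use M in auto)
    qed
    have "y 0 \<le> S / M powr s"
      using Chebyshev_powr(2)[OF _ _ M s int] M by (simp add: y_def l_def S_def field_simps)
    then have "y 0 powr \<alpha> \<le> (S / M powr s) powr \<alpha>"
      using \<alpha> by (intro powr_mono2) (auto simp: y_def)
    then have "H * 2 powr p * (2 powr p) powr (1 / \<alpha>) / M powr p * y 0 powr \<alpha>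
        \<le> H * 2 powr p * (2 powr p) powr (1 / \<alpha>) / M powr p * (S / M powr s) powr \<alpha>"
      using H by (intro mult_left_mono) auto
    also have "(S / M powr s) powr \<alpha> = S powr \<alpha> / M powr (s * \<alpha>)"
      by (simp add: powr_divide powr_powr S_def integral_nonneg_AE)
    also have "H * 2 powr p * (2 powr p) powr (1 / \<alpha>) / M powr p * (S powr \<alpha> / M powr (s * \<alpha>))
        = H * 2 powr p * (2 powr p) powr (1 / \<alpha>) * S powr \<alpha> / M powr (p + s * \<alpha>)"
      by (simp add: powr_add)
    also have "\<dots> \<le> 1" using le M by (simp add: S_def)
    finally show "H * 2 powr p / M powr p * (2 powr p) powr (1 / \<alpha>) * y 0 powr \<alpha> \<le> 1"
      by (simp add: mult_ac)
  qed (use H p \<alpha> in \<open>auto simp: y_def\<close>)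
  moreover have "measure lborel {x \<in> D. 2 * M \<le> \<bar>v x\<bar>} \<le> y j" for j
    unfolding y_def using fin[of "l j"] l[of j] M by (intro measure_mono_fmeasurable) (auto simp: fmeasurable_def)
  ultimately have "measure lborel {x \<in> D. 2 * M \<le> \<bar>v x\<bar>} \<le> 0"
    by (intro LIMSEQ_le_const[of y]) auto
  then have "measure lborel {x \<in> D. 2 * M \<le> \<bar>v x\<bar>} = 0"
    by (simp add: antisym)
  then have "emeasure lborel {x \<in> D. 2 * M \<le> \<bar>v x\<bar>} = 0"
    using fin[of "2 * M"] M by (simp add: emeasure_eq_ennreal_measure)
  then have "{x \<in> D. 2 * M \<le> \<bar>v x\<bar>} \<in> null_sets lborel" by (simp add: null_sets_def)
  then show ?thesis by (rule AE_not_in[THEN eventually_mono]) auto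
qed

text \<open>For \<beta> = 1 and the levels \<open>t\<close>, \<open>2 t\<close> the decay inequality
  is linear in the distribution function and carries a factor \<open>t powr p\<close>. Multiplying
  by \<open>t powr (s - 1)\<close> and integrating gives, by the layer cake formula, the moment of
  order \<open>s + p\<close> of \<open>v / 2\<close> on the left and the moment of order
  \<open>s\<close> of \<open>v\<close> on the right.\<close>

lemma level_decay_moment_step:
  fixes v :: "'a::euclidean_space \<Rightarrow> real"
  assumes [measurable]: "v \<in> borel_measurable borel" "D \<in> sets borel"
    and p: "0 < p" and s: "0 < s" and H: "0 \<le> H"
    and decay: "level_decay v D p 1 H"
    and int: "integrable lborel (\<lambda>x. indicator D x * \<bar>v x\<bar> powr s)"
  shows "integrable lborel (\<lambda>x. indicator D x * \<bar>v x\<bar> powr (s + p))"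
    and "(LINT x|lborel. indicator D x * \<bar>v x\<bar> powr (s + p))
      \<le> 2 powr (s + p) * (s + p) / s * H * (LINT x|lborel. indicator D x * \<bar>v x\<bar> powr s)"
proof -
  let ?S = "LINT x|lborel. indicator D x * \<bar>v x\<bar> powr s"
  have fin: "emeasure lborel {x \<in> D. t \<le> \<bar>v x\<bar>} < \<infinity>" if "0 < t" for t
    using Chebyshev_powr(1)[OF _ _ that s int] by simp
  have em: "emeasure lborel {x \<in> D. t \<le> \<bar>v x\<bar>} = ennreal (measure lborel {x \<in> D. t \<le> \<bar>v x\<bar>})" if "0 < t" for t
    using fin[OF that] by (simp add: emeasure_eq_ennreal_measure)
  have "(\<integral>\<^sup>+x. ennreal (indicator D x * (\<bar>v x / 2\<bar> powr (s + p) / (s + p))) \<partial>lborel)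
    = (\<integral>\<^sup>+t. indicator {0<..} t * (ennreal (t powr (s + p - 1)) * emeasure lborel {x \<in> D. t \<le> \<bar>v x / 2\<bar>}) \<partial>lborel)"
    using p s by (intro layer_cake[symmetric]) auto
  also have "\<dots> \<le> (\<integral>\<^sup>+t. ennreal H * (indicator {0<..} t * (ennreal (t powr (s - 1)) * emeasure lborel {x \<in> D. t \<le> \<bar>v x\<bar>})) \<partial>lborel)"
  proof (intro nn_integral_mono)
    fix t :: real
    show "indicator {0<..} t * (ennreal (t powr (s + p - 1)) * emeasure lborel {x \<in> D. t \<le> \<bar>v x / 2\<bar>})
      \<le> ennreal H * (indicator {0<..} t * (ennreal (t powr (s - 1)) * emeasure lborel {x \<in> D. t \<le> \<bar>v x\<bar>}))"
    proof (cases "0 < t")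
      case True
      have e: "{x \<in> D. t \<le> \<bar>v x / 2\<bar>} = {x \<in> D. 2 * t \<le> \<bar>v x\<bar>}" by auto
      have "t powr p * measure lborel {x \<in> D. 2 * t \<le> \<bar>v x\<bar>} \<le> H * measure lborel {x \<in> D. t \<le> \<bar>v x\<bar>}"
        using decay[unfolded level_decay_def, rule_format, of t "2 * t"] True by simp
      then have "t powr (s - 1) * (t powr p * measure lborel {x \<in> D. 2 * t \<le> \<bar>v x\<bar>})
          \<le> t powr (s - 1) * (H * measure lborel {x \<in> D. t \<le> \<bar>v x\<bar>})"
        by (intro mult_left_mono) auto
      moreover have "t powr (s - 1) * t powr p = t powr (s + p - 1)"
        by (simp add: powr_add[symmetric] algebra_simps)
      ultimately have "t powr (s + p - 1) * measure lborel {x \<in> D. 2 * t \<le> \<bar>v x\<bar>}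
          \<le> H * (t powr (s - 1) * measure lborel {x \<in> D. t \<le> \<bar>v x\<bar>})"
        by (simp add: mult.assoc[symmetric]) (simp add: mult_ac)
      then show ?thesis
        using True H unfolding e by (simp add: em ennreal_mult'[symmetric] ennreal_leI)
    qed simp
  qed
  also have "\<dots> = ennreal H * (\<integral>\<^sup>+x. ennreal (indicator D x * (\<bar>v x\<bar> powr s / s)) \<partial>lborel)"
    by (subst layer_cake[OF _ _ s, symmetric]) (auto intro!: nn_integral_cmult)
  also have "(\<integral>\<^sup>+x. ennreal (indicator D x * (\<bar>v x\<bar> powr s / s)) \<partial>lborel) = ennreal (?S / s)"
  proof -
    have "(\<integral>\<^sup>+x. ennreal (indicator D x * (\<bar>v x\<bar> powr s / s)) \<partial>lborel)
        = (\<integral>\<^sup>+x. ennreal ((indicator D x * \<bar>v x\<bar> powr s) / s) \<partial>lborel)" by simp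
    also have "\<dots> = ennreal (LINT x|lborel. (indicator D x * \<bar>v x\<bar> powr s) / s)"
      using int s by (intro nn_integral_eq_integral integrable_divide) auto
    finally show ?thesis by simp
  qed
  also have "ennreal H * ennreal (?S / s) = ennreal (H * (?S / s))"
    by (rule ennreal_mult'[OF H, symmetric])
  finally have le: "(\<integral>\<^sup>+x. ennreal (indicator D x * (\<bar>v x / 2\<bar> powr (s + p) / (s + p))) \<partial>lborel) \<le> ennreal (H * (?S / s))" .
  have S0: "0 \<le> ?S" by (intro integral_nonneg_AE) auto
  let ?c = "2 powr (s + p) * (s + p)"
  have "(\<integral>\<^sup>+x. ennreal (indicator D x * \<bar>v x\<bar> powr (s + p)) \<partial>lborel)
    = (\<integral>\<^sup>+x. ennreal ?c * ennreal (indicator D x * (\<bar>v x / 2\<bar> powr (s + p) / (s + p))) \<partial>lborel)"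
    using p s by (intro nn_integral_cong) (simp add: ennreal_mult'[symmetric] powr_divide)
  also have "\<dots> = ennreal ?c * (\<integral>\<^sup>+x. ennreal (indicator D x * (\<bar>v x / 2\<bar> powr (s + p) / (s + p))) \<partial>lborel)"
    by (rule nn_integral_cmult) measurable
  also have "\<dots> \<le> ennreal ?c * ennreal (H * (?S / s))"
    by (intro mult_left_mono le) auto
  also have "\<dots> = ennreal (?c / s * H * ?S)"
    using p s by (simp add: ennreal_mult'[symmetric] mult.assoc)
  finally have le': "(\<integral>\<^sup>+x. ennreal (indicator D x * \<bar>v x\<bar> powr (s + p)) \<partial>lborel) \<le> ennreal (?c / s * H * ?S)" .
  then show I: "integrable lborel (\<lambda>x. indicator D x * \<bar>v x\<bar> powr (s + p))"
    by (intro integrableI_bounded) (auto intro: le_less_trans)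
  have "ennreal (LINT x|lborel. indicator D x * \<bar>v x\<bar> powr (s + p)) \<le> ennreal (?c / s * H * ?S)"
    using le' nn_integral_eq_integral[OF I] by simp
  then show "(LINT x|lborel. indicator D x * \<bar>v x\<bar> powr (s + p)) \<le> ?c / s * H * ?S"
    using p s H S0 by (subst (asm) ennreal_le_iff) auto
qed

subsection \<open>Sobolev functions on the whole space\<close>

lemma powr_inverse_power: "0 < z \<Longrightarrow> 0 < n \<Longrightarrow> (z powr (1 / real n)) ^ n = (z::real)"
  by (simp add: powr_powr powr_realpow[symmetric])

text \<open>A value \<open>y > 0\<close> lies in the strip from \<open>t\<close> to
  \<open>2 t\<close> exactly for \<open>t\<close> between \<open>y / 2\<close> and \<open>y\<close>,
  an interval of measure \<open>ln 2\<close> for \<open>dt / t\<close>. Integrating strip energies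
  against \<open>dt / t\<close> therefore counts the gradient at each point at most once.\<close>

lemma dyadic_strip_integral:
  fixes y :: real
  assumes "0 \<le> y"
  shows "(\<integral>\<^sup>+t. indicator {0<..} t * (ennreal (1 / t) * indicator {t..2 * t} y) \<partial>lborel) \<le> 1"
proof (cases "y = 0")
  case True
  then have "(\<integral>\<^sup>+t. indicator {0<..} t * (ennreal (1 / t) * indicator {t..2 * t} y) \<partial>lborel)
      = (\<integral>\<^sup>+(t::real). 0 \<partial>lborel)"
    by (intro nn_integral_cong) (auto simp: indicator_def)
  then show ?thesis by simp
next
  case False
  with assms have y: "0 < y" by simp
  have "(\<integral>\<^sup>+t. indicator {0<..} t * (ennreal (1 / t) * indicator {t..2 * t} y) \<partial>lborel)
    \<le> (\<integral>\<^sup>+t. ennreal (2 / y) * indicator {y / 2..y} t \<partial>lborel)"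
    using y by (intro nn_integral_mono) (auto simp: field_simps split: split_indicator intro!: ennreal_leI)
  also have "\<dots> = ennreal (2 / y) * ennreal (y / 2)"
    using y by (simp add: nn_integral_cmult_indicator)
  also have "\<dots> = 1" using y by (simp add: ennreal_mult'[symmetric])
  finally show ?thesis .
qed

locale sobolev_function = sobolev_gradient v gr for v :: "'a::euclidean_space \<Rightarrow> real" and gr +
  fixes p :: real
  assumes p: "1 < p"
    and v_int: "integrable lborel (\<lambda>x. \<bar>v x\<bar> powr p)"
    and gr_int: "integrable lborel (\<lambda>x. norm (gr x) powr p)"
begin

text \<open>For the representatives built later this is the \<open>p\<close>-th power of the Sobolev
  norm.\<close>

definition energy :: real where
  "energy = (LINT x|lborel. norm (gr x) powr p) + (LINT x|lborel. \<bar>v x\<bar> powr p)"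

definition strip_energy :: "real \<Rightarrow> real \<Rightarrow> real" where
  "strip_energy l l' = (LINT x|lborel. norm (gr x) powr p * indicator {l..l'} \<bar>v x\<bar>)"

lemma strip_integrable: "integrable lborel (\<lambda>x. norm (gr x) powr p * indicator {l..l'} \<bar>v x\<bar>)"
  using gr_int by (rule Bochner_Integration.integrable_bound) (auto split: split_indicator)

lemma energy_nonneg: "0 \<le> energy"
  by (simp add: energy_def integral_nonneg_AE)

lemma gr_le_energy: "(LINT x|lborel. norm (gr x) powr p) \<le> energy"
  by (simp add: energy_def integral_nonneg_AE)

lemma strip_nonneg: "0 \<le> strip_energy l l'"
  by (simp add: strip_energy_def integral_nonneg_AE)

lemma strip_le_energy: "strip_energy l l' \<le> energy"
proof -
  have "strip_energy l l' \<le> (LINT x|lborel. norm (gr x) powr p)"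
    unfolding strip_energy_def using strip_integrable gr_int
    by (intro integral_mono) (auto split: split_indicator)
  then show ?thesis using gr_le_energy by simp
qed

lemma v_int_on: "D \<in> sets borel \<Longrightarrow> integrable lborel (\<lambda>x. indicator D x * \<bar>v x\<bar> powr p)"
  using integrable_mult_indicator[OF _ v_int, of D] by simp

lemma level_fin: "D \<in> sets borel \<Longrightarrow> 0 < t \<Longrightarrow> emeasure lborel {x \<in> D. t \<le> \<bar>v x\<bar>} < \<infinity>"
  using Chebyshev_powr(1)[OF v_meas _ _ _ v_int_on] p by simp

lemma level_le_energy:
  assumes D: "D \<in> sets borel" and t: "0 < t"
  shows "t powr p * measure lborel {x \<in> D. t \<le> \<bar>v x\<bar>} \<le> energy"
proof -
  have "t powr p * measure lborel {x \<in> D. t \<le> \<bar>v x\<bar>} \<le> (LINT x|lborel. indicator D x * \<bar>v x\<bar> powr p)"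
    using Chebyshev_powr(2)[OF v_meas D t _ v_int_on[OF D]] p by simp
  also have "\<dots> \<le> (LINT x|lborel. \<bar>v x\<bar> powr p)"
    using v_int_on[OF D] v_int by (intro integral_mono) (auto split: split_indicator)
  also have "\<dots> \<le> energy" by (simp add: energy_def integral_nonneg_AE)
  finally show ?thesis .
qed

lemma level_set_mono:
  assumes D: "D \<in> sets borel" and l: "0 < l" "l \<le> l'"
  shows "measure lborel {x \<in> D. l' \<le> \<bar>v x\<bar>} \<le> measure lborel {x \<in> D. l \<le> \<bar>v x\<bar>}"
  using level_fin[OF D l(1)] l D by (intro measure_mono_fmeasurable) (auto simp: fmeasurable_def)

text \<open>The radius \<rho> satisfies \<open>c * \<rho> ^ n = 2 a\<close>, where \<open>n\<close>
  is the dimension. A ball of this radius around a point of \<open>D\<close> contains mass at least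
  \<open>2 a\<close> of \<open>D\<close>; removing the level set, of mass \<open>a\<close>, leaves
  mass \<open>a\<close> on the low side. With \<open>m = a\<close> in the level set inequality a
  factor \<open>a\<close> cancels, and \<open>\<rho> ^ n * \<rho> powr p\<close> leaves the power
  \<open>p / n\<close> of \<open>a\<close>.\<close>

lemma level_measure_le:
  assumes [measurable]: "D \<in> sets borel" and c: "0 < c" and l: "0 < l" "l < l'"
    and a: "a = measure lborel {x \<in> D. l \<le> \<bar>v x\<bar>}" "0 < a"
    and dens: "\<And>x. x \<in> D \<Longrightarrow> 2 * a \<le> measure lborel (D \<inter> ball x ((2 * a / c) powr (1 / DIM('a))))"
  shows "(l' - l) powr p * measure lborel {x \<in> D. l' \<le> \<bar>v x\<bar>}
    \<le> unit_ball_vol (real DIM('a)) * (2 / c) powr (1 + p / DIM('a)) * a powr (p / DIM('a)) * strip_energy l l'"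
proof -
  define \<rho> where "\<rho> = (2 * a / c) powr (1 / DIM('a))"
  have \<rho>: "0 < \<rho>" "\<rho> ^ DIM('a) = 2 * a / c" "\<rho> powr p = (2 * a / c) powr (p / DIM('a))"
    using c a by (auto simp: \<rho>_def powr_powr powr_realpow[symmetric])
  let ?A = "{x \<in> D. l \<le> \<bar>v x\<bar>}"
  have fA: "?A \<in> fmeasurable lborel"
    using level_fin[OF assms(1) l(1)] by (auto simp: fmeasurable_def)
  have bm[measurable]: "ball x \<rho> \<in> sets borel" for x :: 'a by simp
  have fb: "ball x \<rho> \<in> fmeasurable lborel" for x :: 'a
    using \<rho> by (auto simp: fmeasurable_def emeasure_ball)
  have "ennreal ((l' - l) powr p) * emeasure lborel {x \<in> D. l' \<le> \<bar>v x\<bar>} * ennreal a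
    \<le> ennreal (\<rho> powr p) * emeasure lborel (ball (0::'a) \<rho>)
      * (\<integral>\<^sup>+x. ennreal (norm (gr x) powr p * indicator {l..l'} \<bar>v x\<bar>) \<partial>lborel)"
  proof (rule level_set_inequality[OF p l(2) assms(1) \<rho>(1)])
    fix x assume x: "x \<in> D"
    let ?Z = "{y \<in> D. \<bar>v y\<bar> \<le> l} \<inter> ball x \<rho>"
    have fZ: "?Z \<in> fmeasurable lborel" by (rule fmeasurableI2[OF fb[of x]]) auto
    have "2 * a \<le> measure lborel (D \<inter> ball x \<rho>)" using dens[OF x] by (simp add: \<rho>_def)
    also have "\<dots> \<le> measure lborel (?Z \<union> ?A)"
      using fZ fA by (intro measure_mono_fmeasurable) auto
    also have "\<dots> \<le> measure lborel ?Z + a"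
      unfolding a by (rule measure_Un_le) auto
    finally have "a \<le> measure lborel ?Z" by simp
    then show "ennreal a \<le> emeasure lborel ?Z"
      using fZ by (simp add: emeasure_eq_measure2 ennreal_leI)
  qed
  also have "(\<integral>\<^sup>+x. ennreal (norm (gr x) powr p * indicator {l..l'} \<bar>v x\<bar>) \<partial>lborel) = ennreal (strip_energy l l')"
    unfolding strip_energy_def by (rule nn_integral_eq_integral[OF strip_integrable]) auto
  also have "emeasure lborel (ball (0::'a) \<rho>) = ennreal (unit_ball_vol (real DIM('a)) * \<rho> ^ DIM('a))"
    using \<rho> by (simp add: emeasure_ball)
  also have "emeasure lborel {x \<in> D. l' \<le> \<bar>v x\<bar>} = ennreal (measure lborel {x \<in> D. l' \<le> \<bar>v x\<bar>})"
    using level_fin[OF assms(1), of l'] l by (simp add: emeasure_eq_ennreal_measure)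
  finally have "ennreal ((l' - l) powr p * measure lborel {x \<in> D. l' \<le> \<bar>v x\<bar>} * a)
      \<le> ennreal (\<rho> powr p * (unit_ball_vol (real DIM('a)) * \<rho> ^ DIM('a)) * strip_energy l l')"
    using a(2) \<rho>(1) by (simp add: ennreal_mult')
  then have le: "(l' - l) powr p * measure lborel {x \<in> D. l' \<le> \<bar>v x\<bar>} * a
      \<le> \<rho> powr p * (unit_ball_vol (real DIM('a)) * \<rho> ^ DIM('a)) * strip_energy l l'"
    using \<rho>(1) by (subst (asm) ennreal_le_iff) (auto intro!: mult_nonneg_nonneg strip_nonneg)
  have "\<rho> powr p * (unit_ball_vol (real DIM('a)) * \<rho> ^ DIM('a)) = unit_ball_vol (real DIM('a)) * (2 / c) powr (1 + p / DIM('a)) * a powr (p / DIM('a)) * a"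
  proof -
    have "(2 * a / c) powr (p / DIM('a)) = (2 / c) powr (p / DIM('a)) * a powr (p / DIM('a))"
      using a c by (simp add: powr_mult[symmetric])
    then show ?thesis using a c by (simp add: \<rho> powr_add)
  qed
  with le have "((l' - l) powr p * measure lborel {x \<in> D. l' \<le> \<bar>v x\<bar>}) * a
    \<le> (unit_ball_vol (real DIM('a)) * (2 / c) powr (1 + p / DIM('a)) * a powr (p / DIM('a)) * strip_energy l l') * a"
    by (simp add: mult_ac)
  then show ?thesis using a by (simp only: mult_le_cancel_right_pos)
qed

text \<open>If the level set is so small that the required radius is at most \<open>R\<close>, the
  density hypothesis applies. Otherwise \<open>a\<close> exceeds \<open>c * R ^ n / 2\<close>: then
  Chebyshev's inequality bounds the left side by the energy, and the second summand of the constant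
  is normalised so that its product with \<open>a powr (p / n)\<close> is at least 1.\<close>

lemma level_decay_of_density:
  assumes D: "D \<in> sets borel" and c: "0 < c" and R: "0 < R"
    and dens: "\<And>x \<rho>. x \<in> D \<Longrightarrow> 0 < \<rho> \<Longrightarrow> \<rho> \<le> R \<Longrightarrow> c * \<rho> ^ DIM('a) \<le> measure lborel (D \<inter> ball x \<rho>)"
  shows "level_decay v D p (p / DIM('a)) ((unit_ball_vol (real DIM('a)) * (2 / c) powr (1 + p / DIM('a)) + (c * R ^ DIM('a) / 2) powr (- (p / DIM('a)))) * energy)"
  unfolding level_decay_def
proof (intro allI impI)
  fix l l' :: real assume l: "0 < l" "l < l'"
  define a where "a = measure lborel {x \<in> D. l \<le> \<bar>v x\<bar>}"
  define a' where "a' = measure lborel {x \<in> D. l' \<le> \<bar>v x\<bar>}"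
  let ?K1 = "unit_ball_vol (real DIM('a)) * (2 / c) powr (1 + p / DIM('a))" and ?K2 = "(c * R ^ DIM('a) / 2) powr (- (p / DIM('a)))"
  have a': "0 \<le> a'" "a' \<le> a" using level_set_mono[OF D, of l l'] l by (auto simp: a_def a'_def)
  have pn: "0 < p / DIM('a)" using p by simp
  have "(l' - l) powr p * a' \<le> (?K1 + ?K2) * energy * a powr (p / DIM('a))"
  proof -
    consider "a = 0" | "0 < a" "2 * a \<le> c * R ^ DIM('a)" | "c * R ^ DIM('a) / 2 < a" using a' by linarith
    then show ?thesis
    proof cases
      case 1 then show ?thesis using a' by simp
    next
      case 2
      define \<rho> where "\<rho> = (2 * a / c) powr (1 / DIM('a))"
      have \<rho>: "0 < \<rho>" "\<rho> ^ DIM('a) = 2 * a / c"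
        using c 2 by (auto simp: \<rho>_def powr_powr powr_realpow[symmetric])
      have "\<rho> ^ DIM('a) \<le> R ^ DIM('a)" using 2 c by (simp add: \<rho> field_simps)
      then have "\<rho> \<le> R" using power_mono_iff[of \<rho> R "DIM('a)"] R \<rho>(1) by simp
      then have d: "2 * a \<le> measure lborel (D \<inter> ball x \<rho>)" if "x \<in> D" for x
        using dens[OF that \<rho>(1)] c by (simp add: \<rho>)
      have "(l' - l) powr p * a' \<le> ?K1 * a powr (p / DIM('a)) * strip_energy l l'"
        unfolding a'_def using level_measure_le[OF D c l a_def \<open>0 < a\<close>] d by (simp add: \<rho>_def)
      also have "\<dots> \<le> ?K1 * a powr (p / DIM('a)) * energy"
        by (intro mult_left_mono strip_le_energy) auto
      also have "\<dots> \<le> (?K1 + ?K2) * energy * a powr (p / DIM('a))"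
        using energy_nonneg by (simp add: algebra_simps)
      finally show ?thesis .
    next
      case 3
      let ?a0 = "c * R ^ DIM('a) / 2"
      have a0: "0 < ?a0" using c R by simp
      have "(l' - l) powr p * a' \<le> l' powr p * a'"
        using l p a' by (intro mult_right_mono powr_mono2) auto
      also have "\<dots> \<le> energy"
        unfolding a'_def using level_le_energy[OF D, of l'] l by simp
      also have "\<dots> \<le> energy * (?K2 * a powr (p / DIM('a)))"
      proof -
        have "1 = ?K2 * ?a0 powr (p / DIM('a))" unfolding powr_add[symmetric] using c R by simp
        also have "\<dots> \<le> ?K2 * a powr (p / DIM('a))"
          using 3 a0 pn by (intro mult_left_mono powr_mono2) auto
        finally show ?thesis using mult_left_mono[OF _ energy_nonneg, of 1] by simp
      qed
      also have "\<dots> \<le> (?K1 + ?K2) * energy * a powr (p / DIM('a))"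
        using energy_nonneg by (simp add: algebra_simps)
      finally show ?thesis .
    qed
  qed
  then show "(l' - l) powr p * measure lborel {x \<in> D. l' \<le> \<bar>v x\<bar>}
    \<le> (?K1 + ?K2) * energy * measure lborel {x \<in> D. l \<le> \<bar>v x\<bar>} powr (p / DIM('a))"
    by (simp add: a_def a'_def)
qed

text \<open>The whole space has density at every radius, with the volume of the unit ball as
  constant, so the case of large level sets does not arise and only the strip energy remains on the
  right.\<close>

lemma weak_sobolev:
  assumes pn: "p < DIM('a)" and t: "0 < t"
  defines "K \<equiv> unit_ball_vol (real DIM('a)) * (2 / unit_ball_vol (real DIM('a))) powr (1 + p / DIM('a))"
  shows "t powr p * measure lborel {x. 2 * t \<le> \<bar>v x\<bar>}
    \<le> K * measure lborel {x. t \<le> \<bar>v x\<bar>} powr (p / DIM('a)) * strip_energy t (2 * t)"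
proof (cases "measure lborel {x. t \<le> \<bar>v x\<bar>} = 0")
  case True
  have "measure lborel {x. 2 * t \<le> \<bar>v x\<bar>} \<le> measure lborel {x. t \<le> \<bar>v x\<bar>}"
    using level_set_mono[of UNIV t "2 * t"] t by simp
  then have "measure lborel {x. 2 * t \<le> \<bar>v x\<bar>} = 0" using True by (simp add: antisym)
  then show ?thesis using True by simp
next
  case False
  define a where "a = measure lborel {x. t \<le> \<bar>v x\<bar>}"
  have a: "0 < a" using False by (simp add: a_def zero_less_measure_iff)
  have w: "0 < unit_ball_vol (real DIM('a))" by simp
  have "2 * a \<le> measure lborel (UNIV \<inter> ball x ((2 * a / unit_ball_vol (real DIM('a))) powr (1 / DIM('a))))" for x :: 'a
  proof -
    have "((2 * a / unit_ball_vol (real DIM('a))) powr (1 / DIM('a))) ^ DIM('a) = 2 * a / unit_ball_vol (real DIM('a))"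
      using a w by (intro powr_inverse_power) auto
    moreover have "measure lborel (ball x ((2 * a / unit_ball_vol (real DIM('a))) powr (1 / DIM('a)))) = unit_ball_vol (real DIM('a)) * ((2 * a / unit_ball_vol (real DIM('a))) powr (1 / DIM('a))) ^ DIM('a)"
      by (simp add: content_ball)
    ultimately show ?thesis using w by simp
  qed
  from level_measure_le[OF _ w t _ _ a this, of "2 * t"] t show ?thesis
    by (simp add: a_def K_def)
qed

text \<open>The weak estimate for \<open>f t = t powr q * a t\<close> comes from a self-improving
  bound: \<open>f (2 t)\<close> is at most a constant times \<open>f t powr (p / n)\<close>, with an
  exponent below one. Inserting the resulting uniform bound on \<open>f\<close> once more, but now
  keeping the strip energy, and integrating over the levels against \<open>dt / t\<close> yields the
  strong estimate, since the strips cover each point boundedly often.\<close>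

theorem sobolev_inequality:
  assumes pn: "p < DIM('a)" and q: "q = DIM('a) * p / (DIM('a) - p)"
  defines "K \<equiv> unit_ball_vol (real DIM('a)) * (2 / unit_ball_vol (real DIM('a))) powr (1 + p / DIM('a))"
  shows "integrable lborel (\<lambda>x. \<bar>v x\<bar> powr q)"
    and "(LINT x|lborel. \<bar>v x\<bar> powr q)
      \<le> q * 2 powr q * K * (2 powr q * K) powr (q / DIM('a)) * energy powr (q / p)"
proof -
  define a where "a t = measure lborel {x. t \<le> \<bar>v x\<bar>}" for t
  define f where "f t = t powr q * a t" for t
  let ?\<beta> = "p / DIM('a)" and ?G = energy
  \<comment> \<open>The fixed point of
    \<open>y \<mapsto> 2 powr q * K * energy * y powr (p / n)\<close>, the map that bounds
    \<open>f (2 t)\<close> in terms of \<open>f t\<close>.\<close>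
  define X where "X = (2 powr q * K * ?G) powr (q / p)"
  have q0: "p < q" "q * ?\<beta> = q - p" "0 < ?\<beta>" "?\<beta> < 1" "0 < q"
    using p pn by (auto simp: q field_simps)
  have "0 < unit_ball_vol (real DIM('a))" by simp
  then have K0: "0 < K" unfolding K_def by (intro mult_pos_pos) (auto simp del: unit_ball_vol_pos)
  have G0: "0 \<le> ?G" by (rule energy_nonneg)
  have a0: "0 \<le> a t" for t by (simp add: a_def)
  have X\<beta>: "X powr ?\<beta> = (2 powr q * K * ?G) powr (q / DIM('a))" using p by (simp add: X_def powr_powr)
  have XX: "2 powr q * K * ?G * X powr ?\<beta> = X"
  proof -
    have "1 + q / DIM('a) = q / p" using p pn by (simp add: q field_simps)
    then show ?thesis unfolding X\<beta> unfolding X_def using K0 G0 by (simp add: powr_mult_base)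
  qed
  have weak: "t powr q * a (2 * t) \<le> K * (f t) powr ?\<beta> * strip_energy t (2 * t)" if t: "0 < t" for t
  proof -
    have "t powr q * a (2 * t) = t powr (q - p) * (t powr p * a (2 * t))"
      by (simp add: powr_add[symmetric] mult.assoc[symmetric])
    also have "\<dots> \<le> t powr (q - p) * (K * a t powr ?\<beta> * strip_energy t (2 * t))"
      unfolding a_def K_def by (intro mult_left_mono weak_sobolev[OF pn t]) auto
    also have "\<dots> = K * (t powr (q - p) * a t powr ?\<beta>) * strip_energy t (2 * t)"
      by (simp add: mult_ac)
    also have "t powr (q - p) * a t powr ?\<beta> = (f t) powr ?\<beta>"
      using a0 q0(2) by (simp add: f_def powr_mult powr_powr)
    finally show ?thesis .
  qed
  have double: "f (2 * t) \<le> X" if t: "0 < t" and f: "f t \<le> X" for t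
  proof -
    have "f (2 * t) = 2 powr q * (t powr q * a (2 * t))" using t by (simp add: f_def powr_mult)
    also have "\<dots> \<le> 2 powr q * (K * (f t) powr ?\<beta> * strip_energy t (2 * t))"
      by (intro mult_left_mono weak t) auto
    also have "\<dots> \<le> 2 powr q * (K * X powr ?\<beta> * ?G)"
      using K0 f q0 a0 G0 by (intro mult_left_mono mult_mono powr_mono2 strip_le_energy)
        (auto simp: f_def strip_energy_def integral_nonneg_AE)
    also have "\<dots> = X" using XX by (simp add: mult_ac)
    finally show ?thesis .
  qed
  have iterate: "f (t * 2 ^ m) \<le> X" if "0 < t" "f t \<le> X" for t m
  proof (induction m)
    case (Suc m)
    have "f (2 * (t * 2 ^ m)) \<le> X" by (rule double[OF _ Suc]) (use that in simp)
    then show ?case by (simp add: mult_ac)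
  qed (use that in simp)
  \<comment> \<open>Because \<open>p < q\<close>, this bound tends to 0 with \<open>t\<close>. Every
    \<open>t\<close> is thus reached by doublings from a point where \<open>f\<close> is below
    \<open>X\<close>.\<close>
  have start: "f t \<le> t powr (q - p) * ?G" if t: "0 < t" for t
  proof -
    have "t powr q = t powr (q - p) * t powr p" by (simp add: powr_add[symmetric])
    then show ?thesis
      using mult_left_mono[OF level_le_energy[of UNIV t], of "t powr (q - p)"] t by (simp add: f_def a_def)
  qed
  have fX: "f t \<le> X" if t: "0 < t" for t
  proof (cases "?G = 0")
    case True
    then show ?thesis using start[OF t] by (simp add: X_def)
  next
    case False
    then have X: "0 < X" "0 < ?G" using K0 G0 by (auto simp: X_def)
    have "(\<lambda>m. t / 2 ^ m) \<longlonglongrightarrow> 0"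
      using LIMSEQ_divide_realpow_zero[of 2 t] by simp
    then have "(\<lambda>m. (t / 2 ^ m) powr (q - p) * ?G) \<longlonglongrightarrow> 0 powr (q - p) * ?G"
      using q0 t by (intro tendsto_mult_right tendsto_powr') auto
    then have "(\<lambda>m. (t / 2 ^ m) powr (q - p) * ?G) \<longlonglongrightarrow> 0" using q0 by simp
    then have "eventually (\<lambda>m. (t / 2 ^ m) powr (q - p) * ?G < X) sequentially"
      using X by (intro order_tendstoD(2)[of _ 0])
    then obtain m where m: "(t / 2 ^ m) powr (q - p) * ?G < X"
      by (auto simp: eventually_sequentially)
    have "f (t / 2 ^ m) \<le> X" using start[of "t / 2 ^ m"] t m by simp
    from iterate[OF _ this, of m] t show ?thesis by simp
  qed
  \<comment> \<open>The strip energy is kept here instead of being estimated by the full energy;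
    this is what makes the integral over all levels converge.\<close>
  have main: "t powr q * a (2 * t) \<le> K * X powr ?\<beta> * strip_energy t (2 * t)" if t: "0 < t" for t
  proof -
    have "K * (f t) powr ?\<beta> * strip_energy t (2 * t) \<le> K * X powr ?\<beta> * strip_energy t (2 * t)"
      using K0 fX[OF t] q0 a0 by (intro mult_right_mono mult_left_mono powr_mono2)
        (auto simp: f_def strip_energy_def integral_nonneg_AE)
    then show ?thesis using weak[OF t] by simp
  qed
  let ?g = "\<lambda>x. norm (gr x) powr p"
  define C where "C = K * X powr ?\<beta>"
  have C0: "0 \<le> C" using K0 by (simp add: C_def)
  have "(\<integral>\<^sup>+x. ennreal (indicator UNIV x * (\<bar>v x / 2\<bar> powr q / q)) \<partial>lborel)
    = (\<integral>\<^sup>+t. indicator {0<..} t * (ennreal (t powr (q - 1)) * emeasure lborel {x \<in> UNIV. t \<le> \<bar>v x / 2\<bar>}) \<partial>lborel)"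
    using q0 by (intro layer_cake[symmetric]) auto
  also have "\<dots> \<le> (\<integral>\<^sup>+t. \<integral>\<^sup>+x. ennreal C * (indicator {0<..} t * (ennreal (1 / t) * (ennreal (?g x) * (if t \<le> \<bar>v x\<bar> \<and> \<bar>v x\<bar> \<le> 2 * t then 1 else 0)))) \<partial>lborel \<partial>lborel)"
  proof (intro nn_integral_mono)
    fix t :: real
    show "indicator {0<..} t * (ennreal (t powr (q - 1)) * emeasure lborel {x \<in> UNIV. t \<le> \<bar>v x / 2\<bar>})
      \<le> (\<integral>\<^sup>+x. ennreal C * (indicator {0<..} t * (ennreal (1 / t) * (ennreal (?g x) * (if t \<le> \<bar>v x\<bar> \<and> \<bar>v x\<bar> \<le> 2 * t then 1 else 0)))) \<partial>lborel)"
    proof (cases "0 < t")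
      case True
      have e: "{x \<in> UNIV. t \<le> \<bar>v x / 2\<bar>} = {x. 2 * t \<le> \<bar>v x\<bar>}" by auto
      have em: "emeasure lborel {x. 2 * t \<le> \<bar>v x\<bar>} = ennreal (a (2 * t))"
        using level_fin[of UNIV "2 * t"] True by (simp add: a_def emeasure_eq_ennreal_measure)
      have "t powr (q - 1) * a (2 * t) = (1 / t) * (t powr q * a (2 * t))"
        using True by (simp add: powr_diff)
      also have "\<dots> \<le> (1 / t) * (C * strip_energy t (2 * t))"
        using main[OF True] True by (intro mult_left_mono) (auto simp: C_def)
      finally have "ennreal (t powr (q - 1) * a (2 * t)) \<le> ennreal (C * ((1 / t) * strip_energy t (2 * t)))"
        by (intro ennreal_leI) (simp add: mult_ac)
      also have "\<dots> = ennreal C * (ennreal (1 / t) * ennreal (strip_energy t (2 * t)))"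
        unfolding ennreal_mult'[OF C0] using True by (subst ennreal_mult') auto
      also have "ennreal (strip_energy t (2 * t)) = (\<integral>\<^sup>+x. ennreal (?g x * indicator {t..2 * t} \<bar>v x\<bar>) \<partial>lborel)"
        unfolding strip_energy_def by (rule nn_integral_eq_integral[OF strip_integrable, symmetric]) auto
      also have "\<dots> = (\<integral>\<^sup>+x. ennreal (?g x) * (if t \<le> \<bar>v x\<bar> \<and> \<bar>v x\<bar> \<le> 2 * t then 1 else 0) \<partial>lborel)"
        by (intro nn_integral_cong) (auto simp: indicator_def)
      finally show ?thesis
        using True unfolding e em by (simp add: ennreal_mult' nn_integral_cmult)
    qed simp
  qed
  also have "\<dots> = (\<integral>\<^sup>+x. \<integral>\<^sup>+t. ennreal C * (indicator {0<..} t * (ennreal (1 / t) * (ennreal (?g x) * (if t \<le> \<bar>v x\<bar> \<and> \<bar>v x\<bar> \<le> 2 * t then 1 else 0)))) \<partial>lborel \<partial>lborel)"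
    by (intro lborel_pair.Fubini') measurable
  also have "\<dots> \<le> (\<integral>\<^sup>+x. ennreal C * ennreal (?g x) \<partial>lborel)"
  proof (intro nn_integral_mono)
    fix x
    have "(\<integral>\<^sup>+t. ennreal C * (indicator {0<..} t * (ennreal (1 / t) * (ennreal (?g x) * (if t \<le> \<bar>v x\<bar> \<and> \<bar>v x\<bar> \<le> 2 * t then 1 else 0)))) \<partial>lborel)
      = (\<integral>\<^sup>+t. (ennreal C * ennreal (?g x)) * (indicator {0<..} t * (ennreal (1 / t) * (if t \<le> \<bar>v x\<bar> \<and> \<bar>v x\<bar> \<le> 2 * t then 1 else 0))) \<partial>lborel)"
      by (intro nn_integral_cong) (simp add: mult_ac)
    also have "\<dots> = (ennreal C * ennreal (?g x)) * (\<integral>\<^sup>+t. indicator {0<..} t * (ennreal (1 / t) * (if t \<le> \<bar>v x\<bar> \<and> \<bar>v x\<bar> \<le> 2 * t then 1 else 0)) \<partial>lborel)"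
      by (rule nn_integral_cmult) measurable
    also have "(\<integral>\<^sup>+t. indicator {0<..} t * (ennreal (1 / t) * (if t \<le> \<bar>v x\<bar> \<and> \<bar>v x\<bar> \<le> 2 * t then 1 else 0)) \<partial>lborel)
        = (\<integral>\<^sup>+t. indicator {0<..} t * (ennreal (1 / t) * indicator {t..2 * t} \<bar>v x\<bar>) \<partial>lborel)"
      by (intro nn_integral_cong) (auto simp: indicator_def)
    also have "(ennreal C * ennreal (?g x)) * \<dots> \<le> (ennreal C * ennreal (?g x)) * 1"
      by (intro mult_left_mono dyadic_strip_integral) auto
    finally show "(\<integral>\<^sup>+t. ennreal C * (indicator {0<..} t * (ennreal (1 / t) * (ennreal (?g x) * (if t \<le> \<bar>v x\<bar> \<and> \<bar>v x\<bar> \<le> 2 * t then 1 else 0)))) \<partial>lborel)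
      \<le> ennreal C * ennreal (?g x)" by simp
  qed
  also have "\<dots> = ennreal C * ennreal (LINT x|lborel. ?g x)"
    by (subst nn_integral_cmult) (auto simp: nn_integral_eq_integral[OF gr_int])
  also have "\<dots> \<le> ennreal C * ennreal ?G"
    by (intro mult_left_mono ennreal_leI gr_le_energy) auto
  also have "\<dots> = ennreal (C * ?G)" using C0 by (simp add: ennreal_mult')
  finally have le: "(\<integral>\<^sup>+x. ennreal (\<bar>v x / 2\<bar> powr q / q) \<partial>lborel) \<le> ennreal (C * ?G)" by simp
  have "(\<integral>\<^sup>+x. ennreal (\<bar>v x\<bar> powr q) \<partial>lborel)
    = (\<integral>\<^sup>+x. ennreal (q * 2 powr q) * ennreal (\<bar>v x / 2\<bar> powr q / q) \<partial>lborel)"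
    using q0 by (intro nn_integral_cong) (simp add: ennreal_mult'[symmetric] powr_divide)
  also have "\<dots> = ennreal (q * 2 powr q) * (\<integral>\<^sup>+x. ennreal (\<bar>v x / 2\<bar> powr q / q) \<partial>lborel)"
    by (rule nn_integral_cmult) measurable
  also have "\<dots> \<le> ennreal (q * 2 powr q) * ennreal (C * ?G)"
    by (intro mult_left_mono le) auto
  also have "\<dots> = ennreal (q * 2 powr q * (C * ?G))"
    using q0 by (simp add: ennreal_mult'[symmetric])
  finally have le': "(\<integral>\<^sup>+x. ennreal (\<bar>v x\<bar> powr q) \<partial>lborel) \<le> ennreal (q * 2 powr q * (C * ?G))" .
  then show I: "integrable lborel (\<lambda>x. \<bar>v x\<bar> powr q)"
    by (intro integrableI_bounded) (auto intro: le_less_trans)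
  have "ennreal (LINT x|lborel. \<bar>v x\<bar> powr q) \<le> ennreal (q * 2 powr q * (C * ?G))"
    using le' nn_integral_eq_integral[OF I] by simp
  then have "(LINT x|lborel. \<bar>v x\<bar> powr q) \<le> q * 2 powr q * (C * ?G)"
    using C0 G0 q0 by (subst (asm) ennreal_le_iff) auto
  also have "C * ?G = K * (2 powr q * K) powr (q / DIM('a)) * ?G powr (q / p)"
  proof -
    have "1 + q / DIM('a) = q / p" using p pn by (simp add: q field_simps)
    then have "?G powr (q / DIM('a)) * ?G = ?G powr (q / p)"
      using G0 by (simp add: powr_mult_base mult.commute)
    moreover have "X powr ?\<beta> = (2 powr q * K) powr (q / DIM('a)) * ?G powr (q / DIM('a))"
      unfolding X\<beta> using K0 G0 by (simp add: powr_mult)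
    ultimately show ?thesis by (simp add: C_def mult_ac)
  qed
  finally show "(LINT x|lborel. \<bar>v x\<bar> powr q)
      \<le> q * 2 powr q * K * (2 powr q * K) powr (q / DIM('a)) * ?G powr (q / p)" by (simp add: mult_ac)
qed

end

subsection \<open>Separated sets in a ball\<close>

lemma nn_integral_lborel_scale:
  fixes f :: "'a::euclidean_space \<Rightarrow> ennreal"
  assumes [measurable]: "f \<in> borel_measurable borel" and c: "0 < c"
  shows "(\<integral>\<^sup>+h. f (x + c *\<^sub>R h) \<partial>lborel) = ennreal (1 / c ^ DIM('a)) * (\<integral>\<^sup>+y. f y \<partial>lborel)"
proof -
  have "(\<integral>\<^sup>+y. f y \<partial>lborel) = (\<integral>\<^sup>+y. f y \<partial>density (distr lborel borel (\<lambda>h. x + c *\<^sub>R h)) (\<lambda>_. ennreal (\<bar>c\<bar> ^ DIM('a))))"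
    using lborel_affine[of c x] c by simp
  also have "\<dots> = ennreal (c ^ DIM('a)) * (\<integral>\<^sup>+h. f (x + c *\<^sub>R h) \<partial>lborel)"
    using c by (subst nn_integral_density, simp_all, subst nn_integral_distr, simp_all add: nn_integral_cmult)
  finally have "ennreal (1 / c ^ DIM('a)) * (\<integral>\<^sup>+y. f y \<partial>lborel)
      = (ennreal (1 / c ^ DIM('a)) * ennreal (c ^ DIM('a))) * (\<integral>\<^sup>+h. f (x + c *\<^sub>R h) \<partial>lborel)"
    by (simp add: mult.assoc)
  also have "ennreal (1 / c ^ DIM('a)) * ennreal (c ^ DIM('a)) = 1"
    using c by (simp add: ennreal_mult'[symmetric])
  finally show ?thesis by simp
qed

lemma le_geometric_mean:
  fixes x a b \<kappa> :: real
  assumes "0 \<le> x" "x \<le> a" "x \<le> b" "0 \<le> \<kappa>" "\<kappa> \<le> 1"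
  shows "x \<le> a powr \<kappa> * b powr (1 - \<kappa>)"
proof (cases "x = 0")
  case False
  then have "x = x powr \<kappa> * x powr (1 - \<kappa>)" using assms by (simp add: powr_add[symmetric])
  also have "\<dots> \<le> a powr \<kappa> * b powr (1 - \<kappa>)"
    using assms by (intro mult_mono powr_mono2) auto
  finally show ?thesis .
qed simp

text \<open>Two ways to integrate out: with \<open>x\<close> fixed, \<open>x + t *\<^sub>R h\<close>
  runs over the space with Jacobian \<open>t ^ n\<close>, leaving the measure of \<open>E\<close>;
  with the intermediate point fixed, the endpoint runs over \<open>B\<close> with Jacobian
  \<open>(1 - t) ^ n\<close>, leaving the measure of \<open>B\<close>. The first degenerates only at
  \<open>t = 0\<close>, the second only at \<open>t = 1\<close>.\<close>

lemma segment_mass_bound: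
  fixes G :: "'a::euclidean_space \<Rightarrow> ennreal"
  assumes [measurable]: "G \<in> borel_measurable borel" and E[measurable]: "E \<in> sets borel" and B[measurable]: "B \<in> sets borel"
    and t: "0 < t" "t < 1"
  shows "(\<integral>\<^sup>+h. \<integral>\<^sup>+x. indicator E x * (indicator B (x + h) * G (x + t *\<^sub>R h)) \<partial>lborel \<partial>lborel)
      \<le> ennreal (1 / t ^ DIM('a)) * emeasure lborel E * (\<integral>\<^sup>+x. G x \<partial>lborel)"
    and "(\<integral>\<^sup>+h. \<integral>\<^sup>+x. indicator E x * (indicator B (x + h) * G (x + t *\<^sub>R h)) \<partial>lborel \<partial>lborel)
      \<le> ennreal (1 / (1 - t) ^ DIM('a)) * emeasure lborel B * (\<integral>\<^sup>+x. G x \<partial>lborel)"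
proof -
  have "(\<integral>\<^sup>+h. \<integral>\<^sup>+x. indicator E x * (indicator B (x + h) * G (x + t *\<^sub>R h)) \<partial>lborel \<partial>lborel)
    = (\<integral>\<^sup>+x. \<integral>\<^sup>+h. indicator E x * (indicator B (x + h) * G (x + t *\<^sub>R h)) \<partial>lborel \<partial>lborel)"
    by (intro lborel_pair.Fubini'[symmetric]) measurable
  also have "\<dots> \<le> (\<integral>\<^sup>+x. \<integral>\<^sup>+h. indicator E x * G (x + t *\<^sub>R h) \<partial>lborel \<partial>lborel)"
    by (intro nn_integral_mono) (auto split: split_indicator)
  also have "\<dots> = (\<integral>\<^sup>+x. (ennreal (1 / t ^ DIM('a)) * (\<integral>\<^sup>+x. G x \<partial>lborel)) * indicator E x \<partial>lborel)"
  proof (intro nn_integral_cong)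
    fix x :: 'a
    have "(\<integral>\<^sup>+h. indicator E x * G (x + t *\<^sub>R h) \<partial>lborel) = indicator E x * (\<integral>\<^sup>+h. G (x + t *\<^sub>R h) \<partial>lborel)"
      by (rule nn_integral_cmult) measurable
    then show "(\<integral>\<^sup>+h. indicator E x * G (x + t *\<^sub>R h) \<partial>lborel)
        = (ennreal (1 / t ^ DIM('a)) * (\<integral>\<^sup>+x. G x \<partial>lborel)) * indicator E x"
      using t by (simp add: nn_integral_lborel_scale mult.commute)
  qed
  also have "\<dots> = ennreal (1 / t ^ DIM('a)) * emeasure lborel E * (\<integral>\<^sup>+x. G x \<partial>lborel)"
    by (subst nn_integral_cmult_indicator) (auto simp: mult_ac)
  finally show "(\<integral>\<^sup>+h. \<integral>\<^sup>+x. indicator E x * (indicator B (x + h) * G (x + t *\<^sub>R h)) \<partial>lborel \<partial>lborel)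
      \<le> ennreal (1 / t ^ DIM('a)) * emeasure lborel E * (\<integral>\<^sup>+x. G x \<partial>lborel)" .
next
  have "(\<integral>\<^sup>+h. \<integral>\<^sup>+x. indicator E x * (indicator B (x + h) * G (x + t *\<^sub>R h)) \<partial>lborel \<partial>lborel)
    \<le> (\<integral>\<^sup>+h. \<integral>\<^sup>+z. indicator B (z + (1 - t) *\<^sub>R h) * G z \<partial>lborel \<partial>lborel)"
  proof (rule nn_integral_mono)
    fix h :: 'a
    have "(\<integral>\<^sup>+x. indicator E x * (indicator B (x + h) * G (x + t *\<^sub>R h)) \<partial>lborel)
      \<le> (\<integral>\<^sup>+x. indicator B (x + t *\<^sub>R h + (1 - t) *\<^sub>R h) * G (x + t *\<^sub>R h) \<partial>lborel)"
      by (intro nn_integral_mono) (auto simp: algebra_simps split: split_indicator)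
    also have "\<dots> = (\<integral>\<^sup>+z. indicator B (z + (1 - t) *\<^sub>R h) * G z \<partial>lborel)"
      by (rule nn_integral_lborel_translate) measurable
    finally show "(\<integral>\<^sup>+x. indicator E x * (indicator B (x + h) * G (x + t *\<^sub>R h)) \<partial>lborel)
      \<le> (\<integral>\<^sup>+z. indicator B (z + (1 - t) *\<^sub>R h) * G z \<partial>lborel)" .
  qed
  also have "\<dots> = (\<integral>\<^sup>+z. \<integral>\<^sup>+h. indicator B (z + (1 - t) *\<^sub>R h) * G z \<partial>lborel \<partial>lborel)"
    by (intro lborel_pair.Fubini') measurable
  also have "\<dots> = (\<integral>\<^sup>+z. (ennreal (1 / (1 - t) ^ DIM('a)) * emeasure lborel B) * G z \<partial>lborel)"
  proof (intro nn_integral_cong)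
    fix z :: 'a
    have "(\<integral>\<^sup>+h. indicator B (z + (1 - t) *\<^sub>R h) * G z \<partial>lborel) = (\<integral>\<^sup>+h. indicator B (z + (1 - t) *\<^sub>R h) \<partial>lborel) * G z"
      by (rule nn_integral_multc) measurable
    also have "(\<integral>\<^sup>+h. indicator B (z + (1 - t) *\<^sub>R h) \<partial>lborel) = ennreal (1 / (1 - t) ^ DIM('a)) * (\<integral>\<^sup>+y. indicator B y \<partial>lborel)"
      using t by (intro nn_integral_lborel_scale) auto
    finally show "(\<integral>\<^sup>+h. indicator B (z + (1 - t) *\<^sub>R h) * G z \<partial>lborel)
      = (ennreal (1 / (1 - t) ^ DIM('a)) * emeasure lborel B) * G z" by simp
  qed
  also have "\<dots> = ennreal (1 / (1 - t) ^ DIM('a)) * emeasure lborel B * (\<integral>\<^sup>+x. G x \<partial>lborel)"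
    by (rule nn_integral_cmult) measurable
  finally show "(\<integral>\<^sup>+h. \<integral>\<^sup>+x. indicator E x * (indicator B (x + h) * G (x + t *\<^sub>R h)) \<partial>lborel \<partial>lborel)
      \<le> ennreal (1 / (1 - t) ^ DIM('a)) * emeasure lborel B * (\<integral>\<^sup>+x. G x \<partial>lborel)" .
qed

context sobolev_function begin

text \<open>Pairs from \<open>E\<close> and \<open>Z\<close> are joined by segments, and the
  gradient on them is bounded through \<open>segment_mass_bound\<close>. The bound by the measure of
  \<open>E\<close> alone is not integrable in \<open>t\<close> near 0 for all dimensions, the bound
  by the measure of the ball alone would lose the smallness of \<open>E\<close>. Their geometric
  mean with weight \<kappa> is integrable and retains the factor \<open>e powr \<kappa>\<close>, so
  that \<open>e powr (1 - \<kappa>)\<close> appears on the left: a power below one, the source of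
  the superlinear recursion for the density.\<close>

lemma half_separation:
  fixes E Z :: "'a set"
  assumes E[measurable]: "E \<in> sets borel" and Z[measurable]: "Z \<in> sets borel" and R: "0 < R"
    and EB: "E \<subseteq> ball x0 R" and ZB: "Z \<subseteq> ball x0 R"
    and half: "measure lborel (ball x0 R) / 2 \<le> measure lborel Z"
    and sep: "\<And>x y. x \<in> E \<Longrightarrow> y \<in> Z \<Longrightarrow> 1 / 2 \<le> \<bar>v y - v x\<bar>"
  shows "measure lborel E powr (1 - 1 / (2 * DIM('a))) * measure lborel (ball x0 R) powr (1 / (2 * DIM('a)))
    \<le> 2 ^ (DIM('a) + 2) * 4 powr p * R powr p * energy"
proof -
  define B where "B = ball x0 R"
  \<comment> \<open>Any weight between 0 and \<open>1 / n\<close> makes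
    \<open>t powr (- n * \<kappa>)\<close> integrable at 0; this one gives
    \<open>t powr (- 1 / 2)\<close>.\<close>
  define \<kappa> where "\<kappa> = 1 / (2 * real DIM('a))"
  define G where "G x = ennreal (norm (gr x) powr p)" for x
  define e b z g where "e = measure lborel E" and "b = measure lborel B" and "z = measure lborel Z"
    and "g = (LINT x|lborel. norm (gr x) powr p)"
  have [measurable]: "G \<in> borel_measurable borel" unfolding G_def by measurable
  have [measurable]: "B \<in> sets borel" by (simp add: B_def)
  have fB: "B \<in> fmeasurable lborel" using R by (auto simp: B_def fmeasurable_def emeasure_ball)
  have fE: "E \<in> fmeasurable lborel" by (rule fmeasurableI2[OF fB]) (use EB in \<open>auto simp: B_def\<close>)
  have fZ: "Z \<in> fmeasurable lborel" by (rule fmeasurableI2[OF fB]) (use ZB in \<open>auto simp: B_def\<close>)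
  have em: "emeasure lborel E = ennreal e" "emeasure lborel B = ennreal b" "emeasure lborel Z = ennreal z"
    using fE fB fZ by (auto simp: e_def b_def z_def emeasure_eq_measure2)
  have eb: "0 \<le> e" "e \<le> b" "0 \<le> g"
    using measure_mono_fmeasurable[of E B lborel] EB fB by (auto simp: e_def b_def B_def g_def integral_nonneg_AE)
  have b0: "0 < b" using R by (simp add: b_def B_def content_ball)
  have \<kappa>: "0 < \<kappa>" "\<kappa> \<le> 1 / 2" by (auto simp: \<kappa>_def field_simps)
  have Gint: "(\<integral>\<^sup>+x. G x \<partial>lborel) = ennreal g"
    unfolding G_def g_def by (rule nn_integral_eq_integral[OF gr_int]) auto
  define J where "J t = (\<integral>\<^sup>+h. \<integral>\<^sup>+x. indicator E x * (indicator B (x + h) * G (x + t *\<^sub>R h)) \<partial>lborel \<partial>lborel)" for t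
  have J_le: "J t \<le> ennreal (2 ^ DIM('a) * e powr \<kappa> * b powr (1 - \<kappa>) * g) * ennreal (t powr (1 / 2 - 1))"
    if t: "0 < t" "t < 1" for t
  proof -
    let ?n = "DIM('a)"
    have 1: "J t \<le> ennreal (1 / t ^ ?n * e * g)"
      using segment_mass_bound(1)[OF _ E _ t, of G B] t eb
      by (simp add: J_def em Gint ennreal_mult'[symmetric])
    have 2: "J t \<le> ennreal (1 / (1 - t) ^ ?n * b * g)"
      using segment_mass_bound(2)[OF _ E _ t, of G B] t b0 eb
      by (simp add: J_def em Gint ennreal_mult'[symmetric])
    have Jfin: "J t < \<infinity>" using 1 by (rule le_less_trans) simp
    then obtain j where j: "J t = ennreal j" "0 \<le> j" by (cases "J t") auto
    have j1: "j \<le> 1 / t ^ ?n * (e * g)" using 1 t eb j by (auto simp: ennreal_le_iff2)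
    \<comment> \<open>In each half of the unit interval one of the two Jacobian factors is at most
      \<open>2 ^ n\<close>, and \<open>e \<le> b\<close> allows the larger measure in both.\<close>
    have j2: "j \<le> 2 ^ ?n * (b * g)"
    proof (cases "t \<le> 1 / 2")
      case True
      have "1 / (1 - t) ^ ?n \<le> 2 ^ ?n"
      proof -
        have "(1 / (1 - t)) ^ ?n \<le> 2 ^ ?n" using True by (intro power_mono) (auto simp: field_simps)
        then show ?thesis by (simp add: power_one_over)
      qed
      then have "1 / (1 - t) ^ ?n * (b * g) \<le> 2 ^ ?n * (b * g)"
        using b0 eb by (intro mult_right_mono) auto
      moreover have "j \<le> 1 / (1 - t) ^ ?n * (b * g)" using 2 t b0 eb j by (auto simp: ennreal_le_iff2)
      ultimately show ?thesis by simp
    next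
      case False
      have "1 / t ^ ?n \<le> 2 ^ ?n"
      proof -
        have "(1 / t) ^ ?n \<le> 2 ^ ?n" using False by (intro power_mono) (auto simp: field_simps)
        then show ?thesis by (simp add: power_one_over)
      qed
      then have "1 / t ^ ?n * (e * g) \<le> 2 ^ ?n * (b * g)"
        using eb t by (intro mult_mono) auto
      then show ?thesis using j1 by simp
    qed
    have "j \<le> (1 / t ^ ?n * (e * g)) powr \<kappa> * (2 ^ ?n * (b * g)) powr (1 - \<kappa>)"
      using j j1 j2 \<kappa> by (intro le_geometric_mean) auto
    also have "(1 / t ^ ?n * (e * g)) powr \<kappa> = t powr (1 / 2 - 1) * (e powr \<kappa> * g powr \<kappa>)"
    proof -
      have "(1 / t ^ ?n) powr \<kappa> = t powr (1 / 2 - 1)"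
        using t by (simp add: \<kappa>_def powr_divide powr_realpow[symmetric] powr_powr powr_minus_divide)
      moreover have "(1 / t ^ ?n * (e * g)) powr \<kappa> = (1 / t ^ ?n) powr \<kappa> * (e powr \<kappa> * g powr \<kappa>)"
        using eb t by (simp only: powr_mult)
      ultimately show ?thesis by simp
    qed
    also have "(2 ^ ?n * (b * g)) powr (1 - \<kappa>) = (2 ^ ?n) powr (1 - \<kappa>) * (b powr (1 - \<kappa>) * g powr (1 - \<kappa>))"
      using b0 eb by (simp add: powr_mult)
    also have "t powr (1 / 2 - 1) * (e powr \<kappa> * g powr \<kappa>) * ((2 ^ ?n) powr (1 - \<kappa>) * (b powr (1 - \<kappa>) * g powr (1 - \<kappa>)))
        = (2 ^ ?n) powr (1 - \<kappa>) * (e powr \<kappa> * b powr (1 - \<kappa>) * g * t powr (1 / 2 - 1))"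
    proof -
      have "g powr \<kappa> * g powr (1 - \<kappa>) = g" using eb by (simp add: powr_add[symmetric])
      then show ?thesis by (simp add: mult_ac)
    qed
    also have "\<dots> \<le> 2 ^ ?n * (e powr \<kappa> * b powr (1 - \<kappa>) * g * t powr (1 / 2 - 1))"
    proof (intro mult_right_mono)
      have "(2 ^ ?n :: real) powr (1 - \<kappa>) \<le> (2 ^ ?n) powr 1" using \<kappa> by (intro powr_mono) auto
      then show "(2 ^ ?n :: real) powr (1 - \<kappa>) \<le> 2 ^ ?n" by simp
    qed (use eb in auto)
    finally show ?thesis using j eb by (simp add: ennreal_mult'[symmetric] mult_ac ennreal_leI)
  qed
  have "ennreal ((1 / 2) powr p * (e * z)) = (\<integral>\<^sup>+x. (ennreal ((1 / 2) powr p) * emeasure lborel Z) * indicator E x \<partial>lborel)"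
    by (subst nn_integral_cmult_indicator) (auto simp: em ennreal_mult'[symmetric] z_def e_def mult_ac)
  also have "\<dots> = (\<integral>\<^sup>+x. \<integral>\<^sup>+h. ennreal ((1 / 2) powr p) * (indicator E x * indicator Z (h + x)) \<partial>lborel \<partial>lborel)"
  proof (intro nn_integral_cong)
    fix x :: 'a
    have "(\<integral>\<^sup>+h. ennreal ((1 / 2) powr p) * (indicator E x * indicator Z (h + x)) \<partial>lborel)
      = ennreal ((1 / 2) powr p) * (indicator E x * (\<integral>\<^sup>+h. indicator Z (h + x) \<partial>lborel))"
      by (simp add: nn_integral_cmult)
    also have "(\<integral>\<^sup>+h. indicator Z (h + x) \<partial>lborel) = (\<integral>\<^sup>+y. indicator Z y \<partial>lborel)"
      by (rule nn_integral_lborel_translate) measurable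
    finally show "(ennreal ((1 / 2) powr p) * emeasure lborel Z) * indicator E x
      = (\<integral>\<^sup>+h. ennreal ((1 / 2) powr p) * (indicator E x * indicator Z (h + x)) \<partial>lborel)"
      by (simp add: mult_ac)
  qed
  also have "\<dots> = (\<integral>\<^sup>+h. \<integral>\<^sup>+x. ennreal ((1 / 2) powr p) * (indicator E x * indicator Z (h + x)) \<partial>lborel \<partial>lborel)"
    by (intro lborel_pair.Fubini') measurable
  also have "\<dots> \<le> (\<integral>\<^sup>+h. \<integral>\<^sup>+x. \<integral>\<^sup>+t. ennreal ((2 * R) powr p) * (indicator {0..1} t *
      (indicator E x * (indicator B (x + h) * G (x + t *\<^sub>R h)))) \<partial>lborel \<partial>lborel \<partial>lborel)"
  proof (rule nn_integral_mono)
    fix h :: 'a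
    show "(\<integral>\<^sup>+x. ennreal ((1 / 2) powr p) * (indicator E x * indicator Z (h + x)) \<partial>lborel)
      \<le> (\<integral>\<^sup>+x. \<integral>\<^sup>+t. ennreal ((2 * R) powr p) * (indicator {0..1} t *
      (indicator E x * (indicator B (x + h) * G (x + t *\<^sub>R h)))) \<partial>lborel \<partial>lborel)"
    proof (rule nn_integral_mono_AE)
      show "AE x in lborel. ennreal ((1 / 2) powr p) * (indicator E x * indicator Z (h + x))
        \<le> (\<integral>\<^sup>+t. ennreal ((2 * R) powr p) * (indicator {0..1} t *
            (indicator E x * (indicator B (x + h) * G (x + t *\<^sub>R h)))) \<partial>lborel)"
        using AE_difference_powr_le[OF p, of h]
      proof eventually_elim
        case (elim x)
        show ?case
        proof (cases "x \<in> E \<and> h + x \<in> Z")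
          case True
          then have xh: "x \<in> B" "x + h \<in> B" using EB ZB by (auto simp: B_def add.commute)
          have "norm h = dist x (x + h)" by (simp add: dist_norm)
          also have "\<dots> \<le> dist x0 x + dist x0 (x + h)" by (metis dist_commute dist_triangle)
          also have "\<dots> \<le> 2 * R" using xh by (simp add: B_def)
          finally have h: "norm h powr p \<le> (2 * R) powr p" using p by (intro powr_mono2) auto
          have "(1 / 2) powr p \<le> \<bar>v (x + h) - v x\<bar> powr p"
            using sep[of x "x + h"] True p by (intro powr_mono2) (auto simp: add.commute)
          then have "ennreal ((1 / 2) powr p) \<le> ennreal (\<bar>v (x + h) - v x\<bar> powr p)" by (rule ennreal_leI)
          also have "\<dots> \<le> (\<integral>\<^sup>+t\<in>{0..1}. ennreal (norm h powr p * norm (gr (x + t *\<^sub>R h)) powr p) \<partial>lborel)"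
            by (rule elim)
          also have "\<dots> \<le> (\<integral>\<^sup>+t. ennreal ((2 * R) powr p) * (indicator {0..1} t *
            (indicator E x * (indicator B (x + h) * G (x + t *\<^sub>R h)))) \<partial>lborel)"
            using True xh h
            by (intro nn_integral_mono)
              (auto simp: G_def ennreal_mult'[symmetric] intro!: ennreal_leI mult_right_mono split: split_indicator)
          finally show ?thesis using True by simp
        qed (auto simp: indicator_def)
      qed
    qed
  qed
  also have "\<dots> = (\<integral>\<^sup>+h. \<integral>\<^sup>+t. \<integral>\<^sup>+x. ennreal ((2 * R) powr p) * (indicator {0..1} t *
      (indicator E x * (indicator B (x + h) * G (x + t *\<^sub>R h)))) \<partial>lborel \<partial>lborel \<partial>lborel)"
    by (intro nn_integral_cong lborel_pair.Fubini') measurable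
  also have "\<dots> = (\<integral>\<^sup>+t. \<integral>\<^sup>+h. \<integral>\<^sup>+x. ennreal ((2 * R) powr p) * (indicator {0..1} t *
      (indicator E x * (indicator B (x + h) * G (x + t *\<^sub>R h)))) \<partial>lborel \<partial>lborel \<partial>lborel)"
    by (intro lborel_pair.Fubini') measurable
  also have "\<dots> = (\<integral>\<^sup>+t. ennreal ((2 * R) powr p) * (indicator {0..1} t * J t) \<partial>lborel)"
    unfolding J_def by (intro nn_integral_cong) (simp add: nn_integral_cmult)
  also have "\<dots> \<le> (\<integral>\<^sup>+t. ennreal ((2 * R) powr p * (2 ^ DIM('a) * e powr \<kappa> * b powr (1 - \<kappa>) * g))
      * (indicator {0<..} t * (ennreal (t powr (1 / 2 - 1)) * indicator {..1} t)) \<partial>lborel)"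
  proof (rule nn_integral_mono_AE)
    show "AE t in lborel. ennreal ((2 * R) powr p) * (indicator {0..1} t * J t)
      \<le> ennreal ((2 * R) powr p * (2 ^ DIM('a) * e powr \<kappa> * b powr (1 - \<kappa>) * g))
        * (indicator {0<..} t * (ennreal (t powr (1 / 2 - 1)) * indicator {..1} t))"
      using AE_lborel_singleton[of 0] AE_lborel_singleton[of 1]
    proof eventually_elim
      case (elim t)
      show ?case
      proof (cases "0 < t \<and> t < 1")
        case True
        then show ?thesis using mult_left_mono[OF J_le[of t], of "ennreal ((2 * R) powr p)"]
          by (simp add: ennreal_mult' mult.assoc)
      next
        case False
        then show ?thesis using elim by (auto simp: indicator_def)
      qed
    qed
  qed
  also have "\<dots> = ennreal ((2 * R) powr p * (2 ^ DIM('a) * e powr \<kappa> * b powr (1 - \<kappa>) * g))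
      * ennreal (1 powr (1 / 2) / (1 / 2))"
    by (subst nn_integral_cmult) (auto simp: set_nn_integral_powr[of "1 / 2" 1, simplified])
  also have "\<dots> = ennreal (2 * (2 * R) powr p * (2 ^ DIM('a) * e powr \<kappa> * b powr (1 - \<kappa>) * g))"
    by (subst ennreal_mult'[symmetric]) (use eb in \<open>auto simp: mult_ac\<close>)
  finally have le: "(1 / 2) powr p * (e * z) \<le> 2 * (2 * R) powr p * (2 ^ DIM('a) * e powr \<kappa> * b powr (1 - \<kappa>) * g)"
    using eb by (subst (asm) ennreal_le_iff) auto
  show ?thesis
  proof (cases "e = 0")
    case True
    then show ?thesis using \<kappa> energy_nonneg by (simp add: e_def \<kappa>_def)
  next
    case False
    then have e0: "0 < e" using eb by simp
    have z: "b / 2 \<le> z" using half by (simp add: b_def z_def B_def)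
    have "(1 / 2) powr p * (e * (b / 2)) \<le> (1 / 2) powr p * (e * z)"
      using z eb by (intro mult_left_mono) auto
    also note le
    also have "2 * (2 * R) powr p * (2 ^ DIM('a) * e powr \<kappa> * b powr (1 - \<kappa>) * g)
        \<le> 2 * (2 * R) powr p * (2 ^ DIM('a) * e powr \<kappa> * b powr (1 - \<kappa>) * energy)"
      using gr_le_energy eb by (intro mult_left_mono) (auto simp: g_def)
    finally have *: "(1 / 2) powr p * (e * (b / 2)) \<le> 2 * (2 * R) powr p * (2 ^ DIM('a) * e powr \<kappa> * b powr (1 - \<kappa>) * energy)" .
    have ee: "e = e powr (1 - \<kappa>) * e powr \<kappa>" "b = b powr \<kappa> * b powr (1 - \<kappa>)"
      using e0 b0 by (simp_all add: powr_add[symmetric])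
    have pp: "(1 / 2) powr p * 2 powr p = (1::real)" "(2 * R) powr p = 2 powr p * R powr p" "4 powr p = 2 powr p * (2 powr p :: real)"
      using R powr_mult[of 2 2 p] by (simp_all add: powr_mult powr_divide)
    let ?c = "e powr \<kappa> * b powr (1 - \<kappa>)"
    have "e * b = (1 / 2) powr p * (e * (b / 2)) * (2 * 2 powr p)"
      using pp(1) by (simp add: mult_ac)
    also have "\<dots> \<le> 2 * (2 * R) powr p * (2 ^ DIM('a) * e powr \<kappa> * b powr (1 - \<kappa>) * energy) * (2 * 2 powr p)"
      by (intro mult_right_mono *) auto
    also have "\<dots> = 2 ^ (DIM('a) + 2) * 4 powr p * R powr p * energy * ?c"
      unfolding pp by (simp add: mult_ac power_add)
    finally have "e powr (1 - \<kappa>) * b powr \<kappa> * ?c \<le> 2 ^ (DIM('a) + 2) * 4 powr p * R powr p * energy * ?c"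
      using ee by (metis (no_types, lifting) mult.assoc mult.left_commute)
    moreover have "0 < ?c" using e0 b0 by simp
    ultimately show ?thesis
      by (simp only: mult_le_cancel_right_pos) (simp add: e_def b_def \<kappa>_def B_def)
  qed
qed

text \<open>One of the sets \<open>{v \<le> 1/2}\<close> and \<open>{v > 1/2}\<close> fills at least
  half of the ball. It is paired with whichever of \<open>E1\<close> and \<open>E0\<close> lies on
  the other side, from which its values differ by at least 1/2.\<close>

lemma separation:
  fixes E0 E1 :: "'a set"
  assumes E[measurable]: "E0 \<in> sets borel" "E1 \<in> sets borel" and R: "0 < R"
    and EB: "E0 \<subseteq> ball x0 R" "E1 \<subseteq> ball x0 R"
    and v0: "\<And>x. x \<in> E0 \<Longrightarrow> v x \<le> 0" and v1: "\<And>x. x \<in> E1 \<Longrightarrow> 1 \<le> v x"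
    and m: "0 \<le> m" "m \<le> measure lborel E0" "m \<le> measure lborel E1"
  shows "m powr (1 - 1 / (2 * DIM('a))) * measure lborel (ball x0 R) powr (1 / (2 * DIM('a)))
    \<le> 2 ^ (DIM('a) + 2) * 4 powr p * R powr p * energy"
proof -
  let ?B = "ball x0 R"
  define Z0 Z1 where "Z0 = {y \<in> ?B. v y \<le> 1 / 2}" and "Z1 = {y \<in> ?B. 1 / 2 < v y}"
  have [measurable]: "?B \<in> sets borel" by simp
  have [measurable]: "Z0 \<in> sets borel" "Z1 \<in> sets borel" unfolding Z0_def Z1_def by measurable
  have "1 \<le> real DIM('a)" using DIM_positive[where 'a='a] by linarith
  then have "1 / (2 * real DIM('a)) \<le> 1" by (subst divide_le_eq_1_pos) linarith+
  then have e1: "0 \<le> 1 - 1 / (2 * real DIM('a))" by simp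
  have Un: "Z0 \<union> Z1 = ?B" by (auto simp: Z0_def Z1_def)
  have "measure lborel ?B \<le> measure lborel Z0 + measure lborel Z1"
    unfolding Un[symmetric] by (rule measure_Un_le) auto
  then consider "measure lborel ?B / 2 \<le> measure lborel Z0" | "measure lborel ?B / 2 \<le> measure lborel Z1"
    by linarith
  then show ?thesis
  proof cases
    case 1
    have s: "1 / 2 \<le> \<bar>v y - v x\<bar>" if "x \<in> E1" "y \<in> Z0" for x y
      using v1[OF that(1)] that(2) by (auto simp: Z0_def)
    have "m powr (1 - 1 / (2 * DIM('a))) * measure lborel ?B powr (1 / (2 * DIM('a)))
      \<le> measure lborel E1 powr (1 - 1 / (2 * DIM('a))) * measure lborel ?B powr (1 / (2 * DIM('a)))"
      using m e1 by (intro mult_right_mono powr_mono2) auto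
    also have "\<dots> \<le> 2 ^ (DIM('a) + 2) * 4 powr p * R powr p * energy"
      by (rule half_separation[of E1 Z0 R x0]) (use R EB 1 s in \<open>auto simp: Z0_def\<close>)
    finally show ?thesis .
  next
    case 2
    have s: "1 / 2 \<le> \<bar>v y - v x\<bar>" if "x \<in> E0" "y \<in> Z1" for x y
      using v0[OF that(1)] that(2) by (auto simp: Z1_def)
    have "m powr (1 - 1 / (2 * DIM('a))) * measure lborel ?B powr (1 / (2 * DIM('a)))
      \<le> measure lborel E0 powr (1 - 1 / (2 * DIM('a))) * measure lborel ?B powr (1 / (2 * DIM('a)))"
      using m e1 by (intro mult_right_mono powr_mono2) auto
    also have "\<dots> \<le> 2 ^ (DIM('a) + 2) * 4 powr p * R powr p * energy"
      by (rule half_separation[of E0 Z1 R x0]) (use R EB 2 s in \<open>auto simp: Z1_def\<close>)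
    finally show ?thesis .
  qed
qed

end

subsection \<open>Cutoff functions and representatives\<close>

lemma integrable_compact_support:
  fixes f :: "'a::euclidean_space \<Rightarrow> real"
  assumes "continuous_on UNIV f" "\<And>x. x \<notin> cball 0 R \<Longrightarrow> f x = 0"
  shows "integrable lborel f"
proof -
  have "integrable lborel (\<lambda>x. indicator (cball 0 R) x *\<^sub>R f x)"
    by (intro borel_integrable_compact continuous_on_subset[OF assms(1)]) auto
  also have "(\<lambda>x. indicator (cball 0 R) x *\<^sub>R f x) = f"
    using assms(2) by (auto simp: indicator_def fun_eq_iff)
  finally show ?thesis .
qed

text \<open>Averaging \<open>g\<close> along the unit segment in direction \<open>i\<close> gives
  \<open>f (x + i) - f x\<close>, whose integral vanishes by translation invariance; the averaging
  itself does not change the integral of \<open>g\<close>.\<close>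

lemma integral_directional_derivative_eq_0:
  fixes f g :: "'a::euclidean_space \<Rightarrow> real"
  assumes d: "\<And>x t. ((\<lambda>t. f (x + t *\<^sub>R i)) has_real_derivative g (x + t *\<^sub>R i)) (at t)"
    and cf: "continuous_on UNIV f" and cg: "continuous_on UNIV g"
    and 0: "\<And>x. x \<notin> cball 0 R \<Longrightarrow> f x = 0" "\<And>x. x \<notin> cball 0 R \<Longrightarrow> g x = 0"
  shows "(LINT x|lborel. g x) = 0"
proof -
  have [measurable]: "f \<in> borel_measurable borel" "g \<in> borel_measurable borel"
    using cf cg by (auto intro: borel_measurable_continuous_onI)
  have fi: "integrable lborel f" and gi: "integrable lborel g"
    using integrable_compact_support[OF cf 0(1)] integrable_compact_support[OF cg 0(2)] by auto
  have FTC: "(LINT t|lborel. indicator {0..1} t * g (x + t *\<^sub>R i)) = f (x + i) - f x" for x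
  proof -
    have c: "isCont (\<lambda>t. g (x + t *\<^sub>R i)) t" for t
    proof -
      have "continuous_on UNIV (\<lambda>t. x + t *\<^sub>R i)" by (intro continuous_intros)
      with cg have "continuous_on UNIV (\<lambda>t. g (x + t *\<^sub>R i))" by (rule continuous_on_compose2) simp
      then show ?thesis by (simp add: continuous_on_eq_continuous_at)
    qed
    have "(LINT t|lborel. g (x + t *\<^sub>R i) * indicator {0..1} t) = f (x + 1 *\<^sub>R i) - f (x + 0 *\<^sub>R i)"
      by (intro integral_FTC_Icc_real d c) simp
    then show ?thesis by (simp add: mult.commute)
  qed
  have "(\<integral>\<^sup>+x. ennreal \<bar>g x\<bar> \<partial>lborel) = ennreal (LINT x|lborel. \<bar>g x\<bar>)"
    using gi by (intro nn_integral_eq_integral integrable_abs) auto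
  then have I: "integrable (lborel \<Otimes>\<^sub>M lborel) (\<lambda>(t, x). indicator {0..1} t * g (x + t *\<^sub>R i))"
    using nn_integral_lborel_translate[of "\<lambda>x. ennreal \<bar>g x\<bar>"]
    by (intro line_product_integrable[where K="LINT x|lborel. \<bar>g x\<bar>"]) auto
  have "(LINT x|lborel. f (x + i) - f x) = (LINT t|lborel. LINT x|lborel. indicator {0..1} t * g (x + t *\<^sub>R i))"
    using lborel_pair.Fubini_integral[OF I] by (simp add: FTC)
  also have "\<dots> = (LINT t|lborel. indicator {0..1::real} t * (LINT x|lborel. g x))"
    by (simp add: lborel_integral_translate)
  also have "\<dots> = (LINT x|lborel. g x)" by simp
  also have "(LINT x|lborel. f (x + i) - f x) = 0"
    using integrable_lborel_translate[OF fi, of i] fi by (simp add: lborel_integral_translate)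
  finally show ?thesis by simp
qed

lemma continuous_locally_integrable:
  fixes f :: "'a::euclidean_space \<Rightarrow> real"
  assumes "continuous_on UNIV f"
  shows "locally_integrable \<Omega> f"
  unfolding locally_integrable_def
proof safe
  fix K :: "'a set" assume K: "compact K"
  then have [measurable]: "K \<in> sets borel" by (rule borel_compact)
  have [measurable]: "f \<in> borel_measurable borel" using assms by (rule borel_measurable_continuous_onI)
  have "integrable lborel (\<lambda>x. indicator K x *\<^sub>R f x)"
    using K assms by (intro borel_integrable_compact) (auto intro: continuous_on_subset)
  then show "set_integrable lebesgue K f"
    unfolding set_integrable_def by (subst integrable_completion) auto
qed

text \<open>The product of \<open>w\<close> with a test function has compact support, so its
  derivative integrates to zero. As the test function vanishes off \<Omega>, the integrals over
  \<Omega> are integrals over the whole space.\<close>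

lemma C1_is_weak_partial:
  fixes w :: "'a::euclidean_space \<Rightarrow> real" and w' :: "'a \<Rightarrow> 'a"
  assumes \<Omega>: "open \<Omega>" and i: "i \<in> Basis"
    and d: "\<And>x. (w has_derivative (\<lambda>h. w' x \<bullet> h)) (at x)" and c: "continuous_on UNIV w'"
  shows "is_weak_partial \<Omega> i w (\<lambda>x. w' x \<bullet> i)"
  unfolding is_weak_partial_def
proof (intro conjI allI impI)
  have cw: "continuous_on UNIV w"
    using d by (meson continuous_at_imp_continuous_on has_derivative_continuous)
  have cw': "continuous_on UNIV (\<lambda>x. w' x \<bullet> i)" using c by (intro continuous_intros)
  show "locally_integrable \<Omega> w" "locally_integrable \<Omega> (\<lambda>x. w' x \<bullet> i)"
    using cw cw' by (auto intro: continuous_locally_integrable)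
  fix \<phi> assume t: "test_function \<Omega> \<phi>"
  have tU: "test_function UNIV \<phi>" using t by (simp add: test_function_def)
  let ?\<phi>' = "partial_deriv i \<phi>"
  have tU': "test_function UNIV ?\<phi>'" using test_function_directional(3)[OF tU i] .
  have c\<phi>: "continuous_on UNIV \<phi>" "continuous_on UNIV ?\<phi>'"
    using tU tU' by (auto intro: test_function_continuous)
  obtain B R where "\<And>x. \<bar>\<phi> x\<bar> \<le> B" and R: "\<And>x. x \<notin> cball 0 R \<Longrightarrow> \<phi> x = 0"
    by (rule test_function_cball[OF tU]) (rule that)
  obtain B' R' where "\<And>x. \<bar>?\<phi>' x\<bar> \<le> B'" and R': "\<And>x. x \<notin> cball 0 R' \<Longrightarrow> ?\<phi>' x = 0"
    by (rule test_function_cball[OF tU']) (rule that)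
  have d\<phi>: "(\<phi> has_derivative frechet_derivative \<phi> (at x)) (at x)" for x
    using t unfolding test_function_def by (metis Ck.simps(2) frechet_derivative_works)
  have out: "\<phi> x = 0" "?\<phi>' x = 0" if x: "x \<notin> \<Omega>" for x
  proof -
    have "x \<notin> closure {x. \<phi> x \<noteq> 0}" using t x unfolding test_function_def by blast
    then show "\<phi> x = 0" "?\<phi>' x = 0" by (rule test_function_outside_support)+
  qed
  have "(LINT x|lborel. w x * ?\<phi>' x + (w' x \<bullet> i) * \<phi> x) = 0"
  proof (rule integral_directional_derivative_eq_0[where f="\<lambda>x. w x * \<phi> x" and R="max R R'" and i=i])
    fix x t
    let ?y = "x + t *\<^sub>R i"
    have l: "((\<lambda>t. x + t *\<^sub>R i) has_derivative (\<lambda>s. s *\<^sub>R i)) (at t)"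
      by (auto intro!: derivative_eq_intros)
    have 1: "((\<lambda>t. w (x + t *\<^sub>R i)) has_derivative (\<lambda>s. w' ?y \<bullet> (s *\<^sub>R i))) (at t)"
      using has_derivative_compose[OF l d] .
    have 2: "((\<lambda>t. \<phi> (x + t *\<^sub>R i)) has_derivative (\<lambda>s. frechet_derivative \<phi> (at ?y) (s *\<^sub>R i))) (at t)"
      using has_derivative_compose[OF l d\<phi>] .
    have sc: "frechet_derivative \<phi> (at ?y) (s *\<^sub>R i) = s * ?\<phi>' ?y" for s
      using linear_scale[OF has_derivative_linear[OF d\<phi>]] by simp
    have "((\<lambda>t. w (x + t *\<^sub>R i)) has_real_derivative w' ?y \<bullet> i) (at t)"
      using 1 by (simp add: has_field_derivative_def mult.commute[of _ "w' ?y \<bullet> i"])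
    moreover have "((\<lambda>t. \<phi> (x + t *\<^sub>R i)) has_real_derivative ?\<phi>' ?y) (at t)"
      using 2 unfolding sc by (simp add: has_field_derivative_def mult.commute[of _ "?\<phi>' ?y"])
    ultimately have "((\<lambda>t. w (x + t *\<^sub>R i) * \<phi> (x + t *\<^sub>R i)) has_real_derivative
        w' ?y \<bullet> i * \<phi> ?y + ?\<phi>' ?y * w ?y) (at t)"
      by (rule DERIV_mult)
    then show "((\<lambda>t. w (x + t *\<^sub>R i) * \<phi> (x + t *\<^sub>R i)) has_real_derivative
        w ?y * ?\<phi>' ?y + (w' ?y \<bullet> i) * \<phi> ?y) (at t)"
      by (simp add: algebra_simps)
  next
    show "continuous_on UNIV (\<lambda>x. w x * \<phi> x)" by (intro continuous_on_mult cw c\<phi>)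
    show "continuous_on UNIV (\<lambda>x. w x * ?\<phi>' x + w' x \<bullet> i * \<phi> x)"
      by (intro continuous_on_add continuous_on_mult cw cw' c\<phi>)
  qed (use R R' in auto)
  moreover have i1: "integrable lborel (\<lambda>x. w x * ?\<phi>' x)"
    by (rule integrable_compact_support[where R=R']) (use R' in \<open>auto intro: continuous_on_mult cw c\<phi>\<close>)
  moreover have i2: "integrable lborel (\<lambda>x. (w' x \<bullet> i) * \<phi> x)"
    by (rule integrable_compact_support[where R=R]) (use R in \<open>auto intro: continuous_on_mult cw' c\<phi>\<close>)
  ultimately have z: "(LINT x|lborel. w x * ?\<phi>' x) = - (LINT x|lborel. (w' x \<bullet> i) * \<phi> x)" by simp
  have conv: "(LINT x|lebesgue_on \<Omega>. f x) = (LINT x|lborel. f x)"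
    if "\<And>x. x \<notin> \<Omega> \<Longrightarrow> f x = 0" "integrable lborel f" for f :: "'a \<Rightarrow> real"
  proof -
    have "(LINT x|lebesgue_on \<Omega>. f x) = (LINT x|lebesgue. indicator \<Omega> x *\<^sub>R f x)"
      using \<Omega> by (simp add: integral_restrict_space)
    also have "(\<lambda>x. indicator \<Omega> x *\<^sub>R f x) = f" using that(1) by (auto simp: indicator_def fun_eq_iff)
    finally show ?thesis using that(2) by (simp add: integral_completion)
  qed
  show "(LINT x|lebesgue_on \<Omega>. w x * ?\<phi>' x) = - (LINT x|lebesgue_on \<Omega>. w' x \<bullet> i * \<phi> x)"
    using z i1 i2 out by (simp add: conv)
qed

text \<open>A weak partial derivative is only required to be locally integrable. Its measurability
  on \<Omega>, required for the function picked in \<open>weak_grad\<close>, follows by exhausting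
  \<Omega> with finite unions of closed boxes.\<close>

lemma locally_integrable_measurable:
  fixes f :: "'a::euclidean_space \<Rightarrow> real"
  assumes \<Omega>: "open \<Omega>" and f: "locally_integrable \<Omega> f"
  shows "f \<in> borel_measurable (lebesgue_on \<Omega>)"
proof -
  obtain D where D: "countable D" "D \<subseteq> Pow \<Omega>" "\<And>X. X \<in> D \<Longrightarrow> \<exists>a b. X = cbox a b" "\<Union>D = \<Omega>"
    using open_countable_Union_open_cbox[OF \<Omega>] by metis
  show ?thesis
  proof (cases "D = {}")
    case True
    then have "\<Omega> = {}" using D by simp
    then show ?thesis by (simp add: measurable_def space_restrict_space)
  next
    case False
    define K where "K n = (\<Union>k\<le>n. from_nat_into D k)" for n
    have K: "compact (K n)" "K n \<subseteq> \<Omega>" for n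
    proof -
      have "compact (from_nat_into D k)" for k
        using D(3)[OF from_nat_into[OF False]] by (metis compact_cbox)
      then show "compact (K n)" unfolding K_def by (intro compact_UN) auto
      show "K n \<subseteq> \<Omega>" unfolding K_def using from_nat_into[OF False] D(2) by blast
    qed
    have m: "(\<lambda>x. indicator (K n) x *\<^sub>R f x) \<in> borel_measurable lebesgue" for n
      using f K[of n] unfolding locally_integrable_def set_integrable_def
      by (intro borel_measurable_integrable) auto
    have "(\<lambda>n. indicator (K n) x *\<^sub>R f x) \<longlonglongrightarrow> indicator \<Omega> x *\<^sub>R f x" for x
    proof (cases "x \<in> \<Omega>")
      case True
      then obtain X where "X \<in> D" "x \<in> X" using D(4) by blast
      then obtain k where "x \<in> from_nat_into D k"
        using from_nat_into_surj[OF D(1)] by metis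
      then have "x \<in> K n" if "k \<le> n" for n using that by (auto simp: K_def)
      then have "eventually (\<lambda>n. indicator (K n) x *\<^sub>R f x = indicator \<Omega> x *\<^sub>R f x) sequentially"
        using True by (auto simp: eventually_sequentially intro!: exI[of _ k])
      then show ?thesis by (rule tendsto_eventually)
    next
      case False
      then have "x \<notin> K n" for n using K(2) by blast
      then show ?thesis using False by simp
    qed
    then have "(\<lambda>x. indicator \<Omega> x *\<^sub>R f x) \<in> borel_measurable lebesgue"
      by (intro borel_measurable_LIMSEQ_real[OF _ m])
    then show ?thesis using \<Omega> by (subst borel_measurable_restrict_space_iff) auto
  qed
qed

text \<open>Every function picked in \<open>weak_grad\<close> is itself a weak partial derivative:
  it is measurable because it is locally integrable, and it agrees with the given one by
  uniqueness.\<close>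

lemma weak_grad_AE_eq:
  fixes u :: "'a::euclidean_space \<Rightarrow> real"
  assumes \<Omega>: "open \<Omega>" and g: "\<And>i. i \<in> Basis \<Longrightarrow> is_weak_partial \<Omega> i u (\<lambda>x. g x \<bullet> i)"
  shows "weak_grad \<Omega> u \<in> borel_measurable (lebesgue_on \<Omega>)"
    and "AE x in lebesgue_on \<Omega>. weak_grad \<Omega> u x = g x"
proof -
  define G where "G i = (SOME g. is_weak_partial \<Omega> i u g)" for i
  have G: "is_weak_partial \<Omega> i u (G i)" if "i \<in> Basis" for i
    unfolding G_def using g[OF that] by (rule someI[of "is_weak_partial \<Omega> i u"])
  have "G i \<in> borel_measurable (lebesgue_on \<Omega>)" if "i \<in> Basis" for i
    using G[OF that] by (intro locally_integrable_measurable \<Omega>) (simp add: is_weak_partial_def)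
  then show "weak_grad \<Omega> u \<in> borel_measurable (lebesgue_on \<Omega>)"
    unfolding weak_grad_def G_def[symmetric]
    by (intro borel_measurable_sum borel_measurable_scaleR) auto
  have "AE x in lebesgue_on \<Omega>. \<forall>i\<in>Basis. G i x = g x \<bullet> i"
    by (subst AE_finite_all) (auto intro: weak_partial_unique[OF \<Omega> G g])
  then show "AE x in lebesgue_on \<Omega>. weak_grad \<Omega> u x = g x"
    by eventually_elim (simp add: weak_grad_def G_def[symmetric] euclidean_representation)
qed

section \<open>Cutoff functions and their Sobolev norms\<close>

lemma fmeasurable_Int_ball:
  assumes "\<Omega> \<in> sets borel"
  shows "\<Omega> \<inter> ball (x::'a::euclidean_space) s \<in> fmeasurable lborel"
  using assms emeasure_bounded_finite[of "\<Omega> \<inter> ball x s"] bounded_subset[OF bounded_ball, of "\<Omega> \<inter> ball x s" x s]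
  by (auto simp: fmeasurable_def)

text \<open>The norm bound sees only the part of \<Omega> inside the supporting ball. This is what
  relates the masses of \<Omega> in two concentric balls once a cutoff is extended.\<close>

lemma W1p_C1_compact_support:
  fixes w :: "'a::euclidean_space \<Rightarrow> real" and w' :: "'a \<Rightarrow> 'a"
  assumes \<Omega>: "open \<Omega>" and p: "1 < p"
    and d: "\<And>x. (w has_derivative (\<lambda>h. w' x \<bullet> h)) (at x)" and c: "continuous_on UNIV w'"
    and w: "\<And>x. \<bar>w x\<bar> \<le> 1" and w': "\<And>x. norm (w' x) \<le> L"
    and 0: "\<And>x. x \<notin> ball z T \<Longrightarrow> w x = 0" "\<And>x. x \<notin> ball z T \<Longrightarrow> w' x = 0"
  shows "w \<in> W1p \<Omega> p"
    and "W1p_norm \<Omega> p w powr p \<le> (L powr p + 1) * measure lborel (\<Omega> \<inter> ball z T)"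
proof -
  have cw: "continuous_on UNIV w"
    using d by (meson continuous_at_imp_continuous_on has_derivative_continuous)
  have [measurable]: "w \<in> borel_measurable borel" "w' \<in> borel_measurable borel"
    using cw c by (auto intro: borel_measurable_continuous_onI)
  have L0: "0 \<le> L" using w'[of z] norm_ge_zero[of "w' z"] by linarith
  have \<Omega>m: "\<Omega> \<in> sets lebesgue" using \<Omega> by simp
  have m: "f \<in> borel_measurable (lebesgue_on \<Omega>)" if "f \<in> borel_measurable borel" for f :: "'a \<Rightarrow> real"
    using that by (intro measurable_restrict_space1 measurable_completion) auto
  have fb: "\<Omega> \<inter> ball z T \<in> fmeasurable lborel"
    using \<Omega> by (simp add: fmeasurable_Int_ball)
  have int: "integrable (lebesgue_on \<Omega>) f"
    and le: "(LINT x|lebesgue_on \<Omega>. f x) \<le> B * measure lborel (\<Omega> \<inter> ball z T)"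
    if f[measurable]: "f \<in> borel_measurable borel" and B: "\<And>x. \<bar>f x\<bar> \<le> B" and z: "\<And>x. x \<notin> ball z T \<Longrightarrow> f x = 0"
    for f :: "'a \<Rightarrow> real" and B
  proof -
    have [measurable]: "\<Omega> \<in> sets borel" using \<Omega> by simp
    have ib: "integrable lborel (\<lambda>x. B * indicator (\<Omega> \<inter> ball z T) x)"
      using fb by (intro integrable_mult_right integrable_real_indicator) (auto simp: fmeasurable_def)
    have bd: "\<bar>indicator \<Omega> x * f x\<bar> \<le> B * indicator (\<Omega> \<inter> ball z T) x" for x
      using B[of x] z[of x] by (auto simp: indicator_def)
    have i: "integrable lborel (\<lambda>x. indicator \<Omega> x * f x)"
      by (rule Bochner_Integration.integrable_bound[OF ib]) (use bd in \<open>auto intro!: AE_I2 intro: order_trans[OF _ abs_ge_self]\<close>)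
    then show "integrable (lebesgue_on \<Omega>) f"
      using \<Omega>m by (simp add: integrable_restrict_space integrable_completion)
    have "(LINT x|lebesgue_on \<Omega>. f x) = (LINT x|lborel. indicator \<Omega> x * f x)"
      using \<Omega>m by (simp add: integral_restrict_space integral_completion)
    also have "\<dots> \<le> (LINT x|lborel. B * indicator (\<Omega> \<inter> ball z T) x)"
      using i ib bd by (intro integral_mono) (auto intro: order_trans[OF abs_ge_self])
    also have "\<dots> = B * measure lborel (\<Omega> \<inter> ball z T)" by simp
    finally show "(LINT x|lebesgue_on \<Omega>. f x) \<le> B * measure lborel (\<Omega> \<inter> ball z T)" .
  qed
  have wp: "is_weak_partial \<Omega> i w (\<lambda>x. w' x \<bullet> i)" if "i \<in> Basis" for i
    by (rule C1_is_weak_partial[OF \<Omega> that d c])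
  have pw: "\<bar>w x\<bar> powr p \<le> 1" for x using w[of x] p by (simp add: powr_le1)
  have pw': "norm (w' x) powr p \<le> L powr p" for x using w'[of x] p by (intro powr_mono2) auto
  show "w \<in> W1p \<Omega> p"
    unfolding W1p_def
  proof (intro CollectI conjI ballI)
    show "w \<in> Lp_space \<Omega> (ereal p)"
      unfolding Lp_space_def using pw 0(1) p by (auto intro!: m int[where B=1])
    fix i :: 'a assume i: "i \<in> Basis"
    have "\<bar>w' x \<bullet> i\<bar> powr p \<le> L powr p" for x
      using Basis_le_norm[OF i, of "w' x"] w'[of x] p by (intro powr_mono2) auto
    then have "(\<lambda>x. w' x \<bullet> i) \<in> Lp_space \<Omega> (ereal p)"
      unfolding Lp_space_def using 0(2) p by (auto intro!: m int[where B="L powr p"])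
    then show "\<exists>g\<in>Lp_space \<Omega> (ereal p). is_weak_partial \<Omega> i w g" using wp[OF i] by blast
  qed
  have "W1p_norm \<Omega> p w powr p = (LINT x|lebesgue_on \<Omega>. norm (weak_grad \<Omega> w x) powr p + \<bar>w x\<bar> powr p)"
    using p by (simp add: W1p_norm_def powr_powr integral_nonneg_AE)
  also have "\<dots> = (LINT x|lebesgue_on \<Omega>. norm (w' x) powr p + \<bar>w x\<bar> powr p)"
  proof (rule integral_cong_AE)
    have [measurable]: "weak_grad \<Omega> w \<in> borel_measurable (lebesgue_on \<Omega>)"
      using weak_grad_AE_eq(1)[OF \<Omega>, of w w'] wp by simp
    have [measurable]: "w \<in> borel_measurable (lebesgue_on \<Omega>)" by (rule m) simp
    show "(\<lambda>x. norm (weak_grad \<Omega> w x) powr p + \<bar>w x\<bar> powr p) \<in> borel_measurable (lebesgue_on \<Omega>)"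
      by measurable
    show "(\<lambda>x. norm (w' x) powr p + \<bar>w x\<bar> powr p) \<in> borel_measurable (lebesgue_on \<Omega>)"
      by (rule m) measurable
    show "AE x in lebesgue_on \<Omega>. norm (weak_grad \<Omega> w x) powr p + \<bar>w x\<bar> powr p = norm (w' x) powr p + \<bar>w x\<bar> powr p"
    proof -
      have "AE x in lebesgue_on \<Omega>. weak_grad \<Omega> w x = w' x" by (rule weak_grad_AE_eq(2)[OF \<Omega> wp])
      then show ?thesis by eventually_elim simp
    qed
  qed
  also have "\<dots> \<le> (L powr p + 1) * measure lborel (\<Omega> \<inter> ball z T)"
    using pw pw' 0 p by (intro le) (auto intro!: add_mono)
  finally show "W1p_norm \<Omega> p w powr p \<le> (L powr p + 1) * measure lborel (\<Omega> \<inter> ball z T)" .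
qed

lemma DERIV_max_0_power2: "((\<lambda>t. (max 0 t)\<^sup>2) has_real_derivative 2 * max 0 t) (at t)" for t :: real
proof -
  consider "t > 0" | "t < 0" | "t = 0" by linarith
  then show ?thesis
  proof cases
    case 1
    have "((\<lambda>t. t\<^sup>2) has_real_derivative 2 * max 0 t) (at t)"
      using 1 by (auto intro!: derivative_eq_intros)
    from has_field_derivative_transform_within_open[OF this, of "{0<..}"] 1 show ?thesis by auto
  next
    case 2
    have "((\<lambda>t. 0) has_real_derivative 2 * max 0 t) (at t)" using 2 by auto
    from has_field_derivative_transform_within_open[OF this, of "{..<0}"] 2 show ?thesis by auto
  next
    case 3
    have "((\<lambda>h. (max 0 h)\<^sup>2 / h) \<longlongrightarrow> 0) (at (0::real))"
    proof (rule tendsto_0_le[where f="\<lambda>h. h" and K=1])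
      show "((\<lambda>h. h) \<longlongrightarrow> 0) (at (0::real))" by (rule tendsto_ident_at)
      show "eventually (\<lambda>h. norm ((max 0 h)\<^sup>2 / h) \<le> norm h * 1) (at (0::real))"
        by (rule always_eventually) (auto simp: max_def power2_eq_square)
    qed
    then show ?thesis using 3 by (simp add: DERIV_def)
  qed
qed

text \<open>With \<open>q t = (max 0 t)\<^sup>2\<close>, the function \<open>q (1 - q (1 - t))\<close> is a \<open>C\<^sup>1\<close> step from 0 to 1.\<close>

lemma cutoff_exists:
  fixes z :: "'a::euclidean_space"
  assumes t: "0 < t" "t < T"
  obtains w :: "'a \<Rightarrow> real" and w' :: "'a \<Rightarrow> 'a"
  where "\<And>x. (w has_derivative (\<lambda>h. w' x \<bullet> h)) (at x)" "continuous_on UNIV w'"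
    "\<And>x. \<bar>w x\<bar> \<le> 1" "\<And>x. norm (w' x) \<le> 8 / (T - t)"
    "\<And>x. x \<notin> ball z T \<Longrightarrow> w x = 0" "\<And>x. x \<notin> ball z T \<Longrightarrow> w' x = 0" "\<And>x. x \<in> ball z t \<Longrightarrow> w x = 1"
proof
  \<comment> \<open>A quadratic function of \<open>x\<close>, hence smooth also at \<open>z\<close>,
    with value 1 at distance \<open>t\<close> from the centre and 0 at distance
    \<open>T\<close>.\<close>
  define \<tau> where "\<tau> x = (T\<^sup>2 - (x - z) \<bullet> (x - z)) / (T\<^sup>2 - t\<^sup>2)" for x
  define q where "q s = (max 0 s)\<^sup>2" for s :: real
  define w where "w x = q (1 - q (1 - \<tau> x))" for x
  define k where "k x = 2 * max 0 (1 - q (1 - \<tau> x)) * (2 * max 0 (1 - \<tau> x)) * (- 2 / (T\<^sup>2 - t\<^sup>2))" for x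
  let ?w' = "\<lambda>x. k x *\<^sub>R (x - z)"
  have Tt: "0 < T\<^sup>2 - t\<^sup>2" using t by (simp add: power_strict_mono)
  have dq: "(q has_real_derivative 2 * max 0 s) (at s)" for s
    unfolding q_def[abs_def] by (rule DERIV_max_0_power2)
  have d\<tau>: "(\<tau> has_derivative (\<lambda>h. (- 2 / (T\<^sup>2 - t\<^sup>2)) * ((x - z) \<bullet> h))) (at x)" for x
  proof -
    have "((\<lambda>x. (T\<^sup>2 - (x - z) \<bullet> (x - z)) / D) has_derivative (\<lambda>h. (- 2 / D) * ((x - z) \<bullet> h))) (at x)" if "D \<noteq> 0" for D :: real
      using that by (auto intro!: derivative_eq_intros simp: inner_commute add_divide_distrib[symmetric])
    then show ?thesis unfolding \<tau>_def[abs_def] using Tt by simp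
  qed
  show "(w has_derivative (\<lambda>h. ?w' x \<bullet> h)) (at x)" for x
  proof -
    have "((\<lambda>x. 1 - \<tau> x) has_derivative (\<lambda>h. - ((- 2 / (T\<^sup>2 - t\<^sup>2)) * ((x - z) \<bullet> h)))) (at x)"
      using d\<tau>[of x] by (auto intro!: derivative_eq_intros)
    from has_derivative_compose[OF this dq[unfolded has_field_derivative_def]]
    have "((\<lambda>x. q (1 - \<tau> x)) has_derivative
      (\<lambda>h. 2 * max 0 (1 - \<tau> x) * - ((- 2 / (T\<^sup>2 - t\<^sup>2)) * ((x - z) \<bullet> h)))) (at x)" .
    then have "((\<lambda>x. 1 - q (1 - \<tau> x)) has_derivative
      (\<lambda>h. - (2 * max 0 (1 - \<tau> x) * - ((- 2 / (T\<^sup>2 - t\<^sup>2)) * ((x - z) \<bullet> h))))) (at x)"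
      by (auto intro!: derivative_eq_intros)
    from has_derivative_compose[OF this dq[unfolded has_field_derivative_def]]
    have "((\<lambda>x. q (1 - q (1 - \<tau> x))) has_derivative (\<lambda>h. 2 * max 0 (1 - q (1 - \<tau> x)) *
      - (2 * max 0 (1 - \<tau> x) * - ((- 2 / (T\<^sup>2 - t\<^sup>2)) * ((x - z) \<bullet> h))))) (at x)" .
    then show ?thesis unfolding w_def[abs_def] k_def by (simp add: mult_ac)
  qed
  have c\<tau>: "continuous_on UNIV \<tau>"
    using d\<tau> by (meson continuous_at_imp_continuous_on has_derivative_continuous)
  have "continuous_on UNIV k"
    unfolding k_def[abs_def] q_def by (intro continuous_intros c\<tau>)
  then show "continuous_on UNIV ?w'" by (intro continuous_intros)
  have q: "0 \<le> q s" for s by (simp add: q_def)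
  have q1: "q s \<le> 1" if "s \<le> 1" for s
  proof -
    have "\<bar>max 0 s\<bar> \<le> 1" using that by auto
    then show ?thesis by (simp add: q_def abs_square_le_1)
  qed
  have w0: "0 \<le> w x" "w x \<le> 1" for x
    using q[of "1 - \<tau> x"] q[of "1 - q (1 - \<tau> x)"] q1[of "1 - q (1 - \<tau> x)"] by (auto simp: w_def)
  show "\<bar>w x\<bar> \<le> 1" for x using w0[of x] by simp
  have nsq: "(x - z) \<bullet> (x - z) = (dist z x)\<^sup>2" for x
    by (simp add: dist_norm power2_norm_eq_inner norm_minus_commute)
  have neg: "1 - q (1 - \<tau> x) \<le> 0" if "x \<notin> ball z T" for x
  proof -
    have "T\<^sup>2 \<le> (dist z x)\<^sup>2" using that t by (intro power_mono) auto
    then have "\<tau> x \<le> 0" using Tt by (simp add: \<tau>_def nsq divide_nonpos_pos)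
    then have "1 \<le> max 0 (1 - \<tau> x)" by simp
    then have "1 \<le> q (1 - \<tau> x)" by (simp add: q_def one_le_power)
    then show ?thesis by simp
  qed
  show "w x = 0" if "x \<notin> ball z T" for x using neg[OF that] by (simp add: w_def q_def)
  show w'0: "?w' x = 0" if "x \<notin> ball z T" for x using neg[OF that] by (simp add: k_def)
  show "w x = 1" if "x \<in> ball z t" for x
  proof -
    have "(dist z x)\<^sup>2 \<le> t\<^sup>2" using that by (intro power_mono) auto
    then have "1 \<le> \<tau> x" using Tt by (simp add: \<tau>_def nsq)
    then show ?thesis by (simp add: w_def q_def)
  qed
  show "norm (?w' x) \<le> 8 / (T - t)" for x
  proof (cases "x \<in> ball z T")
    case True
    then have dx: "dist z x < T" by simp
    have "(dist z x)\<^sup>2 \<le> T\<^sup>2" using dx by (intro power_mono) auto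
    then have \<tau>0: "0 \<le> \<tau> x" using Tt by (simp add: \<tau>_def nsq)
    have m1: "0 \<le> max 0 (1 - q (1 - \<tau> x))" "max 0 (1 - q (1 - \<tau> x)) \<le> 1" using q[of "1 - \<tau> x"] by auto
    have m2: "0 \<le> max 0 (1 - \<tau> x)" "max 0 (1 - \<tau> x) \<le> 1" using \<tau>0 by auto
    have "max 0 (1 - q (1 - \<tau> x)) * max 0 (1 - \<tau> x) \<le> 1 * 1"
      using m1 m2 by (intro mult_mono) auto
    then have "8 / (T\<^sup>2 - t\<^sup>2) * (max 0 (1 - q (1 - \<tau> x)) * max 0 (1 - \<tau> x)) \<le> 8 / (T\<^sup>2 - t\<^sup>2) * 1"
      using Tt by (intro mult_left_mono) auto
    moreover have "\<bar>k x\<bar> = 8 / (T\<^sup>2 - t\<^sup>2) * (max 0 (1 - q (1 - \<tau> x)) * max 0 (1 - \<tau> x))"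
      using m1 m2 Tt by (simp add: k_def abs_mult)
    ultimately have "\<bar>k x\<bar> \<le> 8 / (T\<^sup>2 - t\<^sup>2)" by simp
    then have "\<bar>k x\<bar> * norm (x - z) \<le> 8 / (T\<^sup>2 - t\<^sup>2) * T"
      using dx Tt by (intro mult_mono) (auto simp: dist_norm norm_minus_commute)
    also have "\<dots> = 8 / (T - t) * (T / (T + t))"
      using t by (simp add: power2_eq_square square_diff_square_factored mult_ac)
    also have "\<dots> \<le> 8 / (T - t) * 1" using t by (intro mult_left_mono) auto
    finally show ?thesis by simp
  next
    case False
    then show ?thesis using w'0 t by (metis less_eq_real_def norm_zero diff_gt_0_iff_gt divide_nonneg_pos zero_le_numeral)
  qed
qed

text \<open>Translations and Fubini's theorem are used for Borel functions on \<open>lborel\<close>,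
  whereas the Sobolev space is defined over the completed measure. Borel versions of the function
  and of each partial derivative connect the two, and the energy equals the \<open>p\<close>-th
  power of the norm exactly.\<close>

lemma W1p_UNIV_representative:
  fixes u :: "'a::euclidean_space \<Rightarrow> real"
  assumes p: "1 < p" and u: "u \<in> W1p UNIV p"
  obtains v gr where "sobolev_function v gr p" "AE x in lborel. u x = v x"
    "sobolev_function.energy v gr p = W1p_norm UNIV p u powr p"
proof -
  have um: "u \<in> borel_measurable lebesgue" and ui: "integrable lebesgue (\<lambda>x. \<bar>u x\<bar> powr p)"
    using u p by (auto simp: W1p_def Lp_space_def lebesgue_on_UNIV_eq)
  have "\<forall>i\<in>Basis. \<exists>g. g \<in> Lp_space UNIV (ereal p) \<and> is_weak_partial UNIV i u g"
    using u by (auto simp: W1p_def)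
  then obtain g where g: "\<And>i. i \<in> Basis \<Longrightarrow> g i \<in> Lp_space UNIV (ereal p)"
      "\<And>i. i \<in> Basis \<Longrightarrow> is_weak_partial UNIV i u (g i)"
    by metis
  have gm: "g i \<in> borel_measurable lebesgue" and gi: "integrable lebesgue (\<lambda>x. \<bar>g i x\<bar> powr p)" if "i \<in> Basis" for i
    using g(1)[OF that] p by (auto simp: Lp_space_def lebesgue_on_UNIV_eq)
  obtain v where v[measurable]: "v \<in> borel_measurable borel" and uv: "AE x in lborel. u x = v x"
    using completion_ex_borel_measurable_real[OF um] by auto
  have "\<forall>i\<in>Basis. \<exists>\<gamma>. \<gamma> \<in> borel_measurable borel \<and> (AE x in lborel. g i x = \<gamma> x)"
    using completion_ex_borel_measurable_real[OF gm] by fastforce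
  then obtain \<gamma> where \<gamma>: "\<And>i. i \<in> Basis \<Longrightarrow> \<gamma> i \<in> borel_measurable borel"
      "\<And>i. i \<in> Basis \<Longrightarrow> AE x in lborel. g i x = \<gamma> i x"
    by metis
  define gr where "gr x = (\<Sum>i\<in>Basis. \<gamma> i x *\<^sub>R i)" for x
  have gri: "gr x \<bullet> i = \<gamma> i x" if "i \<in> Basis" for x i
    using that by (simp add: gr_def inner_sum_left_Basis)
  have gr[measurable]: "gr \<in> borel_measurable borel"
    unfolding gr_def[abs_def] using \<gamma>(1) by (intro borel_measurable_sum borel_measurable_scaleR) auto
  have AE_g: "AE x in lebesgue. g i x = gr x \<bullet> i" if "i \<in> Basis" for i
    using AE_completion[OF \<gamma>(2)[OF that]] that by (simp add: gri)
  have AE_u: "AE x in lebesgue. u x = v x" using uv by (rule AE_completion)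
  have transfer: "integrable lborel F" "(LINT x|lborel. F x) = (LINT x|lebesgue. f x)"
    if "integrable lebesgue f" "F \<in> borel_measurable borel" "AE x in lebesgue. f x = F x" for f F :: "'a \<Rightarrow> real"
  proof -
    have Fm: "F \<in> borel_measurable lebesgue" using that(2) by (simp add: measurable_completion)
    have "integrable lebesgue F"
      using that Fm by (intro integrable_cong_AE_imp[OF that(1)]) auto
    then show "integrable lborel F" using that(2) by (simp add: integrable_completion)
    have "(LINT x|lebesgue. f x) = (LINT x|lebesgue. F x)"
      using that Fm by (intro integral_cong_AE) auto
    then show "(LINT x|lborel. F x) = (LINT x|lebesgue. f x)" using that(2) by (simp add: integral_completion)
  qed
  have v_int: "integrable lborel (\<lambda>x. \<bar>v x\<bar> powr p)"
    by (rule transfer(1)[OF ui]) (use AE_u in \<open>auto elim: eventually_mono\<close>)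
  have \<gamma>_int: "integrable lborel (\<lambda>x. \<bar>gr x \<bullet> i\<bar> powr p)" if "i \<in> Basis" for i
    by (rule transfer(1)[OF gi[OF that]]) (use AE_g[OF that] in \<open>auto elim: eventually_mono\<close>)
  have gr_int: "integrable lborel (\<lambda>x. norm (gr x) powr p)"
  proof (rule Bochner_Integration.integrable_bound)
    show "integrable lborel (\<lambda>x. real DIM('a) powr p * (\<Sum>i\<in>Basis. \<bar>gr x \<bullet> i\<bar> powr p))"
      using \<gamma>_int by (intro integrable_mult_right Bochner_Integration.integrable_sum)
    show "AE x in lborel. norm (norm (gr x) powr p) \<le> norm (real DIM('a) powr p * (\<Sum>i\<in>Basis. \<bar>gr x \<bullet> i\<bar> powr p))"
    proof (rule AE_I2)
      fix x
      \<comment> \<open>The largest component in absolute value: the norm is at most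
        \<open>DIM('a)\<close> times it, and its \<open>p\<close>-th power is one of the
        summands.\<close>
      obtain j where j: "j \<in> Basis" "\<And>i. i \<in> Basis \<Longrightarrow> \<bar>gr x \<bullet> i\<bar> \<le> \<bar>gr x \<bullet> j\<bar>"
        using finite_has_maximal[of "(\<lambda>i. \<bar>gr x \<bullet> i\<bar>) ` Basis"]
        by (auto simp: image_iff) (metis linorder_le_cases)
      have "norm (gr x) \<le> (\<Sum>i\<in>Basis. \<bar>gr x \<bullet> i\<bar>)" by (rule norm_le_l1)
      also have "\<dots> \<le> (\<Sum>i\<in>(Basis::'a set). \<bar>gr x \<bullet> j\<bar>)" using j by (intro sum_mono) auto
      finally have "norm (gr x) \<le> real DIM('a) * \<bar>gr x \<bullet> j\<bar>" by simp
      then have "norm (gr x) powr p \<le> (real DIM('a) * \<bar>gr x \<bullet> j\<bar>) powr p" using p by (intro powr_mono2) auto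
      also have "\<dots> = real DIM('a) powr p * \<bar>gr x \<bullet> j\<bar> powr p" by (rule powr_mult)
      also have "\<dots> \<le> real DIM('a) powr p * (\<Sum>i\<in>Basis. \<bar>gr x \<bullet> i\<bar> powr p)"
        using j by (intro mult_left_mono member_le_sum) auto
      finally show "norm (norm (gr x) powr p) \<le> norm (real DIM('a) powr p * (\<Sum>i\<in>Basis. \<bar>gr x \<bullet> i\<bar> powr p))"
        by (simp add: sum_nonneg)
    qed
  qed measurable
  have loc: "set_integrable lborel (cball 0 R) F"
    if "locally_integrable UNIV f" "F \<in> borel_measurable borel" "AE x in lebesgue. f x = F x" for f F :: "'a \<Rightarrow> real" and R
  proof -
    have "integrable lebesgue (\<lambda>x. indicator (cball 0 R) x *\<^sub>R f x)"
      using that(1) by (auto simp: locally_integrable_def set_integrable_def)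
    then show ?thesis unfolding set_integrable_def
      by (rule transfer(1))
        (use that in \<open>auto elim: eventually_mono intro!: borel_measurable_times borel_measurable_indicator\<close>)
  qed
  have u_loc: "locally_integrable UNIV u" and g_loc: "\<And>i. i \<in> Basis \<Longrightarrow> locally_integrable UNIV (g i)"
    using g(2) SOME_Basis by (auto simp: is_weak_partial_def)
  have wk: "is_weak_partial UNIV i u (\<lambda>x. gr x \<bullet> i)" if i: "i \<in> Basis" for i
    unfolding is_weak_partial_def
  proof (intro conjI allI impI u_loc)
    show "locally_integrable UNIV (\<lambda>x. gr x \<bullet> i)"
      unfolding locally_integrable_def
    proof safe
      fix K :: "'a set" assume K: "compact K"
      then have Km: "K \<in> sets borel" by (rule borel_compact)
      have "integrable lebesgue (\<lambda>x. indicator K x *\<^sub>R g i x)"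
        using g_loc[OF i] K by (auto simp: locally_integrable_def set_integrable_def)
      then have "integrable lborel (\<lambda>x. indicator K x *\<^sub>R (gr x \<bullet> i))"
        by (rule transfer(1)) (use AE_g[OF i] Km in \<open>auto elim: eventually_mono\<close>)
      then show "set_integrable lebesgue K (\<lambda>x. gr x \<bullet> i)"
        unfolding set_integrable_def using Km by (subst integrable_completion) auto
    qed
    fix \<phi> :: "'a \<Rightarrow> real" assume t: "test_function UNIV \<phi>"
    have [measurable]: "\<phi> \<in> borel_measurable lebesgue"
      using test_function_measurable[OF t] by (simp add: measurable_completion)
    have [measurable]: "(\<lambda>x. gr x \<bullet> i) \<in> borel_measurable lebesgue"
    proof -
      have "(\<lambda>x. gr x \<bullet> i) \<in> borel_measurable lborel" by measurable
      then show ?thesis by (rule measurable_completion)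
    qed
    have "(LINT x|lebesgue. g i x * \<phi> x) = (LINT x|lebesgue. (gr x \<bullet> i) * \<phi> x)"
      using gm[OF i] AE_g[OF i] by (intro integral_cong_AE borel_measurable_times) (auto elim: eventually_mono)
    then show "(LINT x|lebesgue_on UNIV. u x * partial_deriv i \<phi> x) = - (LINT x|lebesgue_on UNIV. gr x \<bullet> i * \<phi> x)"
      using g(2)[OF i] t by (simp add: is_weak_partial_def lebesgue_on_UNIV_eq)
  qed
  have S: "sobolev_function v gr p"
  proof
    show "set_integrable lborel (cball 0 R) v" for R by (rule loc[OF u_loc v AE_u])
    show "set_integrable lborel (cball 0 R) gr" for R
    proof -
      have "set_integrable lborel (cball 0 R) (\<lambda>x. gr x \<bullet> i)" if "i \<in> Basis" for i
        by (rule loc[OF g_loc[OF that] _ AE_g[OF that]]) measurable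
      then have "integrable lborel (\<lambda>x. \<Sum>i\<in>Basis. (indicator (cball 0 R) x *\<^sub>R (gr x \<bullet> i)) *\<^sub>R i)"
        by (intro Bochner_Integration.integrable_sum integrable_scaleR_left) (auto simp: set_integrable_def)
      also have "(\<lambda>x. \<Sum>i\<in>Basis. (indicator (cball 0 R) x *\<^sub>R (gr x \<bullet> i)) *\<^sub>R i) = (\<lambda>x. indicator (cball 0 R) x *\<^sub>R gr x)"
      proof
        fix x
        have "(\<Sum>i\<in>Basis. (indicator (cball 0 R) x *\<^sub>R (gr x \<bullet> i)) *\<^sub>R i)
          = indicator (cball 0 R) x *\<^sub>R (\<Sum>i\<in>Basis. (gr x \<bullet> i) *\<^sub>R i)" by (simp add: scaleR_sum_right)
        then show "(\<Sum>i\<in>Basis. (indicator (cball 0 R) x *\<^sub>R (gr x \<bullet> i)) *\<^sub>R i) = indicator (cball 0 R) x *\<^sub>R gr x"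
          by (simp only: euclidean_representation)
      qed
      finally show ?thesis by (simp add: set_integrable_def)
    qed
    fix i :: 'a and \<phi> :: "'a \<Rightarrow> real" assume i: "i \<in> Basis" and t: "test_function UNIV \<phi>"
    note [measurable] = test_function_measurable[OF t] test_function_measurable[OF test_function_directional(3)[OF t i]]
    have m': "partial_deriv i \<phi> \<in> borel_measurable lebesgue"
      using test_function_measurable[OF test_function_directional(3)[OF t i]] by (simp add: measurable_completion)
    have "(LINT x|lborel. v x * partial_deriv i \<phi> x) = (LINT x|lebesgue. v x * partial_deriv i \<phi> x)"
      by (rule integral_completion[symmetric]) measurable
    also have "\<dots> = (LINT x|lebesgue. u x * partial_deriv i \<phi> x)"
      using AE_u um v m' by (intro integral_cong_AE borel_measurable_times)
        (auto simp: measurable_completion elim: eventually_mono)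
    also have "\<dots> = - (LINT x|lebesgue. (gr x \<bullet> i) * \<phi> x)"
      using wk[OF i] t by (simp add: is_weak_partial_def lebesgue_on_UNIV_eq)
    also have "(LINT x|lebesgue. (gr x \<bullet> i) * \<phi> x) = (LINT x|lborel. (gr x \<bullet> i) * \<phi> x)"
      by (rule integral_completion) measurable
    finally show "(LINT x|lborel. v x * partial_deriv i \<phi> x) = - (LINT x|lborel. (gr x \<bullet> i) * \<phi> x)" .
  qed (use p v_int gr_int in auto)
  have "W1p_norm UNIV p u powr p = (LINT x|lebesgue. norm (weak_grad UNIV u x) powr p + \<bar>u x\<bar> powr p)"
    using p by (simp add: W1p_norm_def powr_powr integral_nonneg_AE lebesgue_on_UNIV_eq)
  also have "\<dots> = (LINT x|lebesgue. norm (gr x) powr p + \<bar>v x\<bar> powr p)"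
  proof (rule integral_cong_AE)
    have [measurable]: "weak_grad UNIV u \<in> borel_measurable lebesgue"
      using weak_grad_AE_eq(1)[OF open_UNIV wk] by (simp add: lebesgue_on_UNIV_eq)
    note [measurable] = um
    show "(\<lambda>x. norm (weak_grad UNIV u x) powr p + \<bar>u x\<bar> powr p) \<in> borel_measurable lebesgue" by measurable
    show "(\<lambda>x. norm (gr x) powr p + \<bar>v x\<bar> powr p) \<in> borel_measurable lebesgue"
      by (rule measurable_completion) measurable
    show "AE x in lebesgue. norm (weak_grad UNIV u x) powr p + \<bar>u x\<bar> powr p = norm (gr x) powr p + \<bar>v x\<bar> powr p"
    proof -
      have "AE x in lebesgue_on UNIV. weak_grad UNIV u x = gr x" by (rule weak_grad_AE_eq(2)[OF open_UNIV wk])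
      then show ?thesis using AE_u unfolding lebesgue_on_UNIV_eq by eventually_elim simp
    qed
  qed
  also have "\<dots> = (LINT x|lborel. norm (gr x) powr p + \<bar>v x\<bar> powr p)"
    by (rule integral_completion) measurable
  also have "\<dots> = sobolev_function.energy v gr p"
    using gr_int v_int by (simp add: sobolev_function.energy_def[OF S])
  finally show thesis using that[OF S uv] by simp
qed

subsection \<open>Measure density of extension domains\<close>

text \<open>The cutoff is 1 on \<open>ball z t\<close> and 0 off \<open>ball z T\<close>, and its
  extension has the same values almost everywhere in \<Omega>. By \<open>half\<close>, the part of
  \<Omega> in the large ball on which the value is 0 has at least the mass of \<Omega> in
  \<open>ball z T\<close>, hence at least that in \<open>ball z t\<close>. The separation estimate
  then bounds the mass at radius \<open>t\<close> by the energy, and the extension bounds the energy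
  by the mass at radius \<open>T\<close>.\<close>

lemma extension_separation:
  fixes \<Omega> :: "'a::euclidean_space set"
  assumes p: "1 < p" and \<Omega>: "open \<Omega>" and E: "W1p_extension_operator \<Omega> p E" and C: "1 \<le> C"
    and bd: "\<And>u. u \<in> W1p \<Omega> p \<Longrightarrow> W1p_norm UNIV p (E u) \<le> C * W1p_norm \<Omega> p u"
    and t: "0 < t" "t < T" "T - t \<le> 1" and R: "0 < R" and sub: "ball z T \<subseteq> ball x0 R"
    and half: "2 * measure lborel (\<Omega> \<inter> ball z T) \<le> measure lborel (\<Omega> \<inter> ball x0 R)"
  shows "measure lborel (\<Omega> \<inter> ball z t) powr (1 - 1 / (2 * DIM('a))) * measure lborel (ball x0 R) powr (1 / (2 * DIM('a)))
    \<le> 2 ^ (DIM('a) + 2) * 4 powr p * C powr p * (8 powr p + 1) * (R / (T - t)) powr p * measure lborel (\<Omega> \<inter> ball z T)"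
proof -
  obtain w w' where w: "\<And>x. (w has_derivative (\<lambda>h. w' x \<bullet> h)) (at x)" "continuous_on UNIV w'"
    "\<And>x. \<bar>w x\<bar> \<le> 1" "\<And>x. norm (w' x) \<le> 8 / (T - t)"
    "\<And>x. x \<notin> ball z T \<Longrightarrow> w x = 0" "\<And>x. x \<notin> ball z T \<Longrightarrow> w' x = 0" "\<And>x. x \<in> ball z t \<Longrightarrow> w x = 1"
    by (rule cutoff_exists[OF t(1,2), of z]) (rule that)
  define m where "m s = measure lborel (\<Omega> \<inter> ball z s)" for s
  have wW: "w \<in> W1p \<Omega> p" by (rule W1p_C1_compact_support(1)[OF \<Omega> p w(1-6)])
  have wN: "W1p_norm \<Omega> p w powr p \<le> ((8 / (T - t)) powr p + 1) * m T"
    unfolding m_def by (rule W1p_C1_compact_support(2)[OF \<Omega> p w(1-6)])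
  have Ew: "E w \<in> W1p UNIV p" and Ew': "AE x in lebesgue_on \<Omega>. E w x = w x"
    using E wW by (auto simp: W1p_extension_operator_def)
  obtain v gr where S: "sobolev_function v gr p" and ae: "AE x in lborel. E w x = v x"
    and en: "sobolev_function.energy v gr p = W1p_norm UNIV p (E w) powr p"
    by (rule W1p_UNIV_representative[OF p Ew]) (rule that)
  interpret sobolev_function v gr p by (rule S)
  have [measurable]: "\<Omega> \<in> sets borel" using \<Omega> by simp
  have bm[measurable]: "ball x s \<in> sets borel" for x :: 'a and s by simp
  have fm: "\<Omega> \<inter> ball x s \<in> fmeasurable lborel" for x :: 'a and s
    by (simp add: fmeasurable_Int_ball)
  have "AE x in lebesgue. x \<in> \<Omega> \<longrightarrow> E w x = w x"
    using Ew' \<Omega> by (simp add: AE_restrict_space_iff)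
  then have "AE x in lborel. x \<in> \<Omega> \<longrightarrow> E w x = w x" by (simp only: AE_completion_iff)
  with ae have vw: "AE x in lborel. x \<in> \<Omega> \<longrightarrow> v x = w x" by eventually_elim auto
  define E1 E0 where "E1 = {x \<in> \<Omega> \<inter> ball z t. 1 \<le> v x}" and "E0 = {x \<in> \<Omega> \<inter> ball x0 R - ball z T. v x \<le> 0}"
  have Em[measurable]: "E1 \<in> sets borel" "E0 \<in> sets borel" unfolding E1_def E0_def by measurable
  have m1: "measure lborel E1 = m t"
    unfolding m_def
  proof (rule measure_eq_AE)
    show "AE x in lborel. (x \<in> E1) = (x \<in> \<Omega> \<inter> ball z t)"
      using vw by eventually_elim (use w(7) in \<open>auto simp: E1_def\<close>)
  qed auto
  have "measure lborel E0 = measure lborel (\<Omega> \<inter> ball x0 R - ball z T)"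
  proof (rule measure_eq_AE)
    show "AE x in lborel. (x \<in> E0) = (x \<in> \<Omega> \<inter> ball x0 R - ball z T)"
      using vw by eventually_elim (use w(5) in \<open>auto simp: E0_def\<close>)
  qed auto
  also have "\<Omega> \<inter> ball x0 R - ball z T = \<Omega> \<inter> ball x0 R - \<Omega> \<inter> ball z T" by auto
  also have "measure lborel \<dots> = measure lborel (\<Omega> \<inter> ball x0 R) - m T"
    unfolding m_def using fm[of x0 R] fm[of z T] sub
    by (intro measure_Diff) (auto simp: fmeasurable_def)
  finally have m0: "m T \<le> measure lborel E0" using half by (simp add: m_def)
  have mtT: "m t \<le> m T"
    unfolding m_def using t fm[of z T] by (intro measure_mono_fmeasurable) auto
  have "m t powr (1 - 1 / (2 * DIM('a))) * measure lborel (ball x0 R) powr (1 / (2 * DIM('a)))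
    \<le> 2 ^ (DIM('a) + 2) * 4 powr p * R powr p * energy"
  proof (rule separation[OF Em(2,1) R])
    show "E0 \<subseteq> ball x0 R" by (auto simp: E0_def)
    show "E1 \<subseteq> ball x0 R" using sub t by (force simp: E1_def)
    show "0 \<le> m t" by (simp add: m_def)
    show "m t \<le> measure lborel E0" using m0 mtT by simp
    show "m t \<le> measure lborel E1" using m1 by simp
  qed (auto simp: E0_def E1_def)
  also have "\<dots> \<le> 2 ^ (DIM('a) + 2) * 4 powr p * R powr p * (C powr p * ((8 powr p + 1) * (1 / (T - t)) powr p * m T))"
  proof (intro mult_left_mono)
    have N0: "0 \<le> W1p_norm UNIV p (E w)" by (simp add: W1p_norm_def)
    have "energy \<le> (C * W1p_norm \<Omega> p w) powr p"
      unfolding en using bd[OF wW] p N0 by (intro powr_mono2) auto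
    also have "\<dots> = C powr p * W1p_norm \<Omega> p w powr p" by (rule powr_mult)
    also have "\<dots> \<le> C powr p * (((8 / (T - t)) powr p + 1) * m T)"
      using wN by (intro mult_left_mono) auto
    also have "\<dots> \<le> C powr p * ((8 powr p + 1) * (1 / (T - t)) powr p * m T)"
    proof (intro mult_left_mono mult_right_mono)
      \<comment> \<open>Since \<open>T - t \<le> 1\<close>, the contribution of \<open>|w|^p\<close>
        is absorbed into that of the gradient.\<close>
      have "1 \<le> 1 / (T - t)" using t by simp
      then have "1 powr p \<le> (1 / (T - t)) powr p" using p by (intro powr_mono2) auto
      moreover have "(8 / (T - t)) powr p = 8 powr p * (1 / (T - t)) powr p"
        by (simp add: powr_mult[symmetric])
      ultimately show "(8 / (T - t)) powr p + 1 \<le> (8 powr p + 1) * (1 / (T - t)) powr p"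
        by (simp add: algebra_simps)
    qed (auto simp: m_def)
    finally show "energy \<le> C powr p * ((8 powr p + 1) * (1 / (T - t)) powr p * m T)" .
  qed auto
  also have "\<dots> = 2 ^ (DIM('a) + 2) * 4 powr p * C powr p * (8 powr p + 1) * (R / (T - t)) powr p * m T"
  proof -
    have "(R / (T - t)) powr p = R powr p * (1 / (T - t)) powr p" by (simp add: powr_mult[symmetric])
    then show ?thesis by (simp add: mult_ac)
  qed
  finally show ?thesis by (simp add: m_def)
qed

text \<open>By connectedness the distance from \<open>x0\<close> takes the value
  \<open>R / 2\<close> at some point \<open>y\<close> of \<Omega>. The balls of radius
  \<open>R / 4\<close> around \<open>x0\<close> and \<open>y\<close> are disjoint and lie in the
  large ball, so one of them carries at most half of its mass. Its centre lies in \<Omega>, so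
  smaller concentric balls still have positive mass.\<close>

lemma half_ball_exists:
  fixes \<Omega> :: "'a::euclidean_space set"
  assumes \<Omega>: "open \<Omega>" "connected \<Omega>" and x0: "x0 \<in> \<Omega>" and R: "0 < R" and far: "b \<in> \<Omega>" "R \<le> dist x0 b"
  obtains z where "z \<in> \<Omega>" "ball z (R / 4) \<subseteq> ball x0 R"
    "2 * measure lborel (\<Omega> \<inter> ball z (R / 4)) \<le> measure lborel (\<Omega> \<inter> ball x0 R)"
proof -
  have "connected (dist x0 ` \<Omega>)"
    by (intro connected_continuous_image \<Omega> continuous_intros)
  then have "{dist x0 x0..dist x0 b} \<subseteq> dist x0 ` \<Omega>"
    using x0 far by (intro connected_contains_Icc) auto
  moreover have "R / 2 \<in> {dist x0 x0..dist x0 b}" using R far by simp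
  ultimately have "R / 2 \<in> dist x0 ` \<Omega>" by blast
  then obtain y where y: "y \<in> \<Omega>" "dist x0 y = R / 2" by (metis imageE)
  let ?A = "\<Omega> \<inter> ball x0 (R / 4)" and ?B = "\<Omega> \<inter> ball y (R / 4)" and ?D = "\<Omega> \<inter> ball x0 R"
  have sub: "ball x0 (R / 4) \<subseteq> ball x0 R" "ball y (R / 4) \<subseteq> ball x0 R"
  proof -
    show "ball x0 (R / 4) \<subseteq> ball x0 R" using R by auto
    show "ball y (R / 4) \<subseteq> ball x0 R"
    proof
      fix x assume "x \<in> ball y (R / 4)"
      then show "x \<in> ball x0 R" using dist_triangle[of x0 x y] y R by simp
    qed
  qed
  have disj: "?A \<inter> ?B = {}"
  proof -
    have False if "x \<in> ball x0 (R / 4)" "x \<in> ball y (R / 4)" for x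
      using that dist_triangle[of x0 y x] y R by (simp add: dist_commute)
    then show ?thesis by auto
  qed
  have \<Omega>b[measurable]: "\<Omega> \<in> sets borel" using \<Omega> by simp
  have fm: "\<Omega> \<inter> ball x s \<in> fmeasurable lborel" for x :: 'a and s
    by (simp add: fmeasurable_Int_ball)
  have "measure lborel ?A + measure lborel ?B = measure lborel (?A \<union> ?B)"
    using disj fm[of x0 "R / 4"] fm[of y "R / 4"] by (intro measure_Union[symmetric]) (auto simp: fmeasurable_def)
  also have "\<dots> \<le> measure lborel ?D"
    using sub fm[of x0 R] fm[of x0 "R / 4"] fm[of y "R / 4"] by (intro measure_mono_fmeasurable) auto
  finally have "2 * measure lborel ?A \<le> measure lborel ?D \<or> 2 * measure lborel ?B \<le> measure lborel ?D"
    by linarith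
  then show thesis using that x0 y sub by blast
qed

text \<open>
  Cutting off at radii \<open>t\<^sub>j = (R / 8) (1 + 2\<^sup>-\<^sup>j)\<close> in a ball carrying at most half of the mass
  gives a superlinear recursion for the masses.  Since they stay above the mass of the ball of
  radius \<open>R / 8\<close>, the first of them cannot be small.
\<close>

theorem extension_domain_measure_density:
  fixes \<Omega> :: "'a::euclidean_space set"
  assumes p: "1 < p" and ext: "W1p_extension_domain \<Omega> p"
  obtains c R0 where "0 < c" "0 < R0"
    "\<And>x \<rho>. x \<in> \<Omega> \<Longrightarrow> 0 < \<rho> \<Longrightarrow> \<rho> \<le> R0 \<Longrightarrow> c * \<rho> ^ DIM('a) \<le> measure lborel (\<Omega> \<inter> ball x \<rho>)"
proof -
  from ext obtain E C where \<Omega>: "\<Omega> \<noteq> {}" "open \<Omega>" "connected \<Omega>" and E: "W1p_extension_operator \<Omega> p E"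
    and C: "1 \<le> C" and bd: "\<And>u. u \<in> W1p \<Omega> p \<Longrightarrow> W1p_norm UNIV p (E u) \<le> C * W1p_norm \<Omega> p u"
    unfolding W1p_extension_domain_def domain_def bounded_extension_operator_def by blast
  obtain a where a: "a \<in> \<Omega>" using \<Omega> by blast
  then obtain e where e: "0 < e" "ball a e \<subseteq> \<Omega>" using \<Omega> open_contains_ball by blast
  obtain i :: 'a where i: "i \<in> Basis" using nonempty_Basis by blast
  define b where "b = a + (e / 2) *\<^sub>R i"
  have dab: "dist a b = e / 2" using e i by (simp add: b_def dist_norm)
  have b: "b \<in> \<Omega>" using e dab by auto
  \<comment> \<open>The points \<open>a\<close> and \<open>b\<close> of \<Omega> have distance
    \<open>e / 2\<close>. For \<open>R \<le> e / 4\<close> at least one of them is therefore at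
    distance \<open>R\<close> or more from any given \<open>x0\<close>; the bound 1 keeps the
    differences of the cutoff radii below 1.\<close>
  define R0 where "R0 = min 1 (e / 4)"
  have R0: "0 < R0" using e by (simp add: R0_def)
  define \<kappa> where "\<kappa> = 1 / (2 * real DIM('a))"
  have dim1: "1 \<le> real DIM('a)" using DIM_positive[where 'a='a] by linarith
  have \<kappa>: "0 < \<kappa>" "\<kappa> \<le> 1 / 2" using dim1 by (auto simp: \<kappa>_def field_simps)
  \<comment> \<open>Raising to the power \<open>1 + \<alpha> = 1 / (1 - \<kappa>)\<close> solves the
    estimate \<open>y (Suc j) powr (1 - \<kappa>) \<le> ... * y j\<close> for
    \<open>y (Suc j)\<close>.\<close>
  define \<alpha> where "\<alpha> = \<kappa> / (1 - \<kappa>)"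
  have \<alpha>: "0 < \<alpha>" "1 + \<alpha> = 1 / (1 - \<kappa>)" "\<kappa> * (1 + \<alpha>) = \<alpha>" using \<kappa> by (auto simp: \<alpha>_def field_simps)
  define K where "K = 2 ^ (DIM('a) + 2) * 4 powr p * C powr p * (8 powr p + 1) * 16 powr p"
  have K0: "0 < K" using C by (auto simp: K_def intro!: mult_pos_pos add_pos_pos)
  define \<omega> where "\<omega> = unit_ball_vol (real DIM('a))"
  have \<omega>: "0 < \<omega>" by (simp add: \<omega>_def)
  define \<beta> where "\<beta> = (2 powr p) powr (1 + \<alpha>)"
  have \<beta>: "1 < \<beta>"
  proof -
    have "2 powr 0 < (2::real) powr (p * (1 + \<alpha>))" using p \<alpha>(1) by (intro powr_less_mono) auto
    then show ?thesis by (simp add: \<beta>_def powr_powr)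
  qed
  define Q where "Q = K powr (1 + \<alpha>) * \<beta> powr (1 / \<alpha>)"
  have Q: "0 < Q" using K0 \<beta> by (simp add: Q_def)
  \<comment> \<open>Obtained from the failure of the smallness condition:
    \<open>B powr \<alpha> < Q * y 0 powr \<alpha>\<close> with \<open>B = \<omega> * R ^ n\<close>,
    solved for \<open>y 0\<close>.\<close>
  define c where "c = \<omega> / Q powr (1 / \<alpha>)"
  have "0 < c" using \<omega> Q by (simp add: c_def)
  moreover have "c * R ^ DIM('a) \<le> measure lborel (\<Omega> \<inter> ball x0 R)" if x0: "x0 \<in> \<Omega>" and R: "0 < R" "R \<le> R0" for x0 R
  proof -
    have R1: "R \<le> 1" "2 * R \<le> dist a b" using R dab by (auto simp: R0_def)
    have "R \<le> dist x0 a \<or> R \<le> dist x0 b"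
      using dist_triangle[of a b x0] R1 by (simp add: dist_commute) linarith
    then obtain b' where b': "b' \<in> \<Omega>" "R \<le> dist x0 b'" using a b by blast
    obtain z where z: "z \<in> \<Omega>" "ball z (R / 4) \<subseteq> ball x0 R"
      "2 * measure lborel (\<Omega> \<inter> ball z (R / 4)) \<le> measure lborel (\<Omega> \<inter> ball x0 R)"
      by (rule half_ball_exists[OF \<Omega>(2,3) x0 R(1) b']) (rule that)
    define m where "m s = measure lborel (\<Omega> \<inter> ball z s)" for s
    have fm: "\<Omega> \<inter> ball x s \<in> fmeasurable lborel" for x :: 'a and s
      using \<Omega>(2) by (simp add: fmeasurable_Int_ball)
    have m_mono: "m s \<le> m s'" if "s \<le> s'" for s s'
      unfolding m_def using that fm by (intro measure_mono_fmeasurable fmeasurableD) auto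
    have m0: "0 \<le> m s" for s by (simp add: m_def)
    have mpos: "0 < m (R / 8)"
    proof -
      have "open (\<Omega> \<inter> ball z (R / 8))" "\<Omega> \<inter> ball z (R / 8) \<noteq> {}" using \<Omega> z R by auto
      then obtain y d where "0 < d" "ball y d \<subseteq> \<Omega> \<inter> ball z (R / 8)"
        by (meson ex_in_conv open_contains_ball)
      moreover from this have "measure lborel (ball y d) \<le> m (R / 8)"
        unfolding m_def using fm[of z "R / 8"] by (intro measure_mono_fmeasurable) auto
      moreover have "0 < measure lborel (ball y d)" using \<open>0 < d\<close> by (simp add: content_ball)
      ultimately show ?thesis by linarith
    qed
    define t where "t j = R / 8 * (1 + (1 / 2) ^ j)" for j :: nat
    have t: "R / 8 < t j" "t j \<le> R / 4" "t (Suc j) < t j" "t j - t (Suc j) = R / 16 * (1 / 2) ^ j" for j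
      using R power_le_one[of "1 / 2 :: real" j] by (auto simp: t_def field_simps)
    define y where "y j = m (t j)" for j
    define B where "B = \<omega> * R ^ DIM('a)"
    have B: "0 < B" "measure lborel (ball x0 R) = B" using \<omega> R by (auto simp: B_def \<omega>_def content_ball)
    define A where "A = (K * B powr (- \<kappa>)) powr (1 + \<alpha>)"
    have step: "y (Suc j) \<le> A * \<beta> ^ j * y j powr (1 + \<alpha>)" for j
    proof -
      have "t j - t (Suc j) \<le> 1" using t(2)[of j] t(1)[of "Suc j"] R R1 by linarith
      moreover have "ball z (t j) \<subseteq> ball x0 R" using z(2) t(2)[of j] by (meson order_trans subset_ball)
      moreover have "2 * measure lborel (\<Omega> \<inter> ball z (t j)) \<le> measure lborel (\<Omega> \<inter> ball x0 R)"
        using z(3) m_mono[OF t(2)[of j]] by (simp add: m_def)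
      moreover have "0 < t (Suc j)" using t(1)[of "Suc j"] R by linarith
      ultimately have "y (Suc j) powr (1 - \<kappa>) * B powr \<kappa>
        \<le> 2 ^ (DIM('a) + 2) * 4 powr p * C powr p * (8 powr p + 1) * (R / (t j - t (Suc j))) powr p * y j"
        using extension_separation[OF p \<Omega>(2) E C bd _ t(3)[of j], where R=R and ?x0.0=x0 and z=z] R(1) B
        by (simp add: y_def m_def \<kappa>_def)
      \<comment> \<open>The radii \<open>t j\<close> are proportional to \<open>R\<close>, so
        \<open>R\<close> cancels here; in the recursion it survives only through the volume
        \<open>B\<close>.\<close>
      also have "(R / (t j - t (Suc j))) powr p = 16 powr p * (2 powr p) ^ j"
      proof -
        have "R / (t j - t (Suc j)) = 16 * 2 ^ j" unfolding t(4) using R by (simp add: power_one_over field_simps)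
        moreover have "(2 ^ j) powr p = (2 powr p) ^ (j::nat)"
          by (simp add: powr_realpow[symmetric] powr_powr mult.commute)
        ultimately show ?thesis by (simp add: powr_mult)
      qed
      finally have "y (Suc j) powr (1 - \<kappa>) * B powr \<kappa> \<le> K * (2 powr p) ^ j * y j"
        by (simp add: K_def mult_ac)
      then have le: "y (Suc j) powr (1 - \<kappa>) * B powr \<kappa> * B powr (- \<kappa>) \<le> K * (2 powr p) ^ j * y j * B powr (- \<kappa>)"
        by (intro mult_right_mono) auto
      have "Y * B powr \<kappa> * B powr (- \<kappa>) = Y" for Y
        using B by (simp add: mult.assoc powr_add[symmetric])
      from le[unfolded this] have "y (Suc j) powr (1 - \<kappa>) \<le> (K * B powr (- \<kappa>)) * ((2 powr p) ^ j * y j)"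
        by (simp only: mult_ac)
      then have "(y (Suc j) powr (1 - \<kappa>)) powr (1 + \<alpha>) \<le> ((K * B powr (- \<kappa>)) * ((2 powr p) ^ j * y j)) powr (1 + \<alpha>)"
        by (intro powr_mono2) (use \<alpha>(1) in auto)
      moreover have "(y (Suc j) powr (1 - \<kappa>)) powr (1 + \<alpha>) = y (Suc j)"
        using \<kappa> m0 by (simp add: powr_powr \<alpha>(2) y_def)
      moreover have "((2 powr p) ^ j) powr (1 + \<alpha>) = \<beta> ^ j"
        by (simp add: \<beta>_def powr_realpow[symmetric] powr_powr mult_ac)
      ultimately show ?thesis by (simp add: A_def powr_mult mult_ac)
    qed
    \<comment> \<open>Were the first mass small, the iteration would drive the masses to 0, although
      all of them are at least \<open>m (R / 8) > 0\<close>.\<close>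
    have "\<not> A * \<beta> powr (1 / \<alpha>) * y 0 powr \<alpha> \<le> 1"
    proof
      assume "A * \<beta> powr (1 / \<alpha>) * y 0 powr \<alpha> \<le> 1"
      then have "y \<longlonglongrightarrow> 0"
        by (intro De_Giorgi_iteration[OF _ \<beta> \<alpha>(1) _ step]) (auto simp: A_def y_def m0)
      moreover have "m (R / 8) \<le> y j" for j unfolding y_def using t(1)[of j] by (intro m_mono) simp
      ultimately have "m (R / 8) \<le> 0" by (intro LIMSEQ_le_const) auto
      then show False using mpos by simp
    qed
    then have "1 < A * \<beta> powr (1 / \<alpha>) * y 0 powr \<alpha>" by simp
    also have "A = K powr (1 + \<alpha>) * B powr (- \<alpha>)"
      using \<alpha>(3) by (simp add: A_def powr_mult powr_powr)
    finally have "1 < B powr (- \<alpha>) * (Q * y 0 powr \<alpha>)" by (simp add: Q_def mult_ac)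
    then have "B powr \<alpha> * 1 < B powr \<alpha> * (B powr (- \<alpha>) * (Q * y 0 powr \<alpha>))"
      using B by (intro mult_strict_left_mono) auto
    moreover have "B powr \<alpha> * B powr (- \<alpha>) = 1" using B by (simp add: powr_add[symmetric])
    ultimately have "B powr \<alpha> < Q * y 0 powr \<alpha>" by (simp add: mult.assoc[symmetric])
    then have "(B powr \<alpha>) powr (1 / \<alpha>) \<le> (Q * y 0 powr \<alpha>) powr (1 / \<alpha>)"
      using \<alpha> by (intro powr_mono2) auto
    then have "B \<le> Q powr (1 / \<alpha>) * y 0"
      using \<alpha> B m0 by (simp add: powr_powr powr_mult y_def)
    then have "c * R ^ DIM('a) \<le> y 0"
      using Q by (simp add: c_def B_def field_simps)
    also have "y 0 = m (R / 4)" by (simp add: y_def t_def)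
    also have "\<dots> \<le> measure lborel (\<Omega> \<inter> ball x0 R)"
      using z(3) m0[of "R / 4"] unfolding m_def by linarith
    finally show ?thesis .
  qed
  ultimately show thesis using that R0 by blast
qed

subsection \<open>Interpolation of moments\<close>

lemma Lp_transfer:
  fixes u v :: "'a::euclidean_space \<Rightarrow> real"
  assumes \<Omega>: "open \<Omega>" and u: "u \<in> borel_measurable (lebesgue_on \<Omega>)" and [measurable]: "v \<in> borel_measurable borel"
    and ae: "AE x in lebesgue_on \<Omega>. u x = v x"
  shows "integrable (lebesgue_on \<Omega>) (\<lambda>x. \<bar>u x\<bar> powr r) \<longleftrightarrow> integrable lborel (\<lambda>x. indicator \<Omega> x * \<bar>v x\<bar> powr r)"
    and "(LINT x|lebesgue_on \<Omega>. \<bar>u x\<bar> powr r) = (LINT x|lborel. indicator \<Omega> x * \<bar>v x\<bar> powr r)"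
proof -
  have [measurable]: "\<Omega> \<in> sets borel" using \<Omega> by simp
  have \<Omega>m: "\<Omega> \<in> sets lebesgue" using \<Omega> by simp
  note [measurable] = u
  have vm: "(\<lambda>x. \<bar>v x\<bar> powr r) \<in> borel_measurable (lebesgue_on \<Omega>)"
    by (intro measurable_restrict_space1 measurable_completion) measurable
  have um: "(\<lambda>x. \<bar>u x\<bar> powr r) \<in> borel_measurable (lebesgue_on \<Omega>)" by measurable
  have ae': "AE x in lebesgue_on \<Omega>. \<bar>u x\<bar> powr r = \<bar>v x\<bar> powr r" using ae by eventually_elim simp
  have "integrable (lebesgue_on \<Omega>) (\<lambda>x. \<bar>u x\<bar> powr r) \<longleftrightarrow> integrable (lebesgue_on \<Omega>) (\<lambda>x. \<bar>v x\<bar> powr r)"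
    by (rule integrable_cong_AE[OF um vm ae'])
  also have "\<dots> \<longleftrightarrow> integrable lborel (\<lambda>x. indicator \<Omega> x * \<bar>v x\<bar> powr r)"
    using \<Omega>m by (simp add: integrable_restrict_space integrable_completion)
  finally show "integrable (lebesgue_on \<Omega>) (\<lambda>x. \<bar>u x\<bar> powr r) \<longleftrightarrow> integrable lborel (\<lambda>x. indicator \<Omega> x * \<bar>v x\<bar> powr r)" .
  have "(LINT x|lebesgue_on \<Omega>. \<bar>u x\<bar> powr r) = (LINT x|lebesgue_on \<Omega>. \<bar>v x\<bar> powr r)"
    by (rule integral_cong_AE[OF um vm ae'])
  also have "\<dots> = (LINT x|lborel. indicator \<Omega> x * \<bar>v x\<bar> powr r)"
    using \<Omega>m by (simp add: integral_restrict_space integral_completion)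
  finally show "(LINT x|lebesgue_on \<Omega>. \<bar>u x\<bar> powr r) = (LINT x|lborel. indicator \<Omega> x * \<bar>v x\<bar> powr r)" .
qed

text \<open>Logarithmic convexity of moments. Normalising the two moments to 1 reduces it to the
  pointwise weighted inequality between geometric and arithmetic mean. In terms of integrals rather
  than norms it has the same form for exponents below one.\<close>

lemma moment_interpolation:
  fixes v :: "'a::euclidean_space \<Rightarrow> real"
  assumes [measurable]: "v \<in> borel_measurable borel" "D \<in> sets borel"
    and s: "0 < s" and q: "0 < q" and l: "0 \<le> l" "l \<le> 1" and r: "r = l * q + (1 - l) * s"
    and Is: "integrable lborel (\<lambda>x. indicator D x * \<bar>v x\<bar> powr s)"
    and Iq: "integrable lborel (\<lambda>x. indicator D x * \<bar>v x\<bar> powr q)"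
  shows "integrable lborel (\<lambda>x. indicator D x * \<bar>v x\<bar> powr r)"
    and "(LINT x|lborel. indicator D x * \<bar>v x\<bar> powr r)
      \<le> (LINT x|lborel. indicator D x * \<bar>v x\<bar> powr q) powr l * (LINT x|lborel. indicator D x * \<bar>v x\<bar> powr s) powr (1 - l)"
proof -
  define A B where "A = (LINT x|lborel. indicator D x * \<bar>v x\<bar> powr q)" and "B = (LINT x|lborel. indicator D x * \<bar>v x\<bar> powr s)"
  have AB: "0 \<le> A" "0 \<le> B" by (auto simp: A_def B_def integral_nonneg_AE)
  have r0: "0 < r"
  proof (cases "l = 0")
    case False
    then have "0 < l * q" using l q by simp
    moreover have "0 \<le> (1 - l) * s" using l s by simp
    ultimately show ?thesis unfolding r by linarith
  qed (use s r in simp)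
  have "integrable lborel (\<lambda>x. indicator D x * \<bar>v x\<bar> powr r) \<and>
    (LINT x|lborel. indicator D x * \<bar>v x\<bar> powr r) \<le> A powr l * B powr (1 - l)"
  proof (cases "A = 0 \<or> B = 0")
    \<comment> \<open>Here \<open>v\<close> vanishes almost everywhere on \<open>D\<close>. This
      also settles the endpoints of \<open>l\<close>: since \<open>0 powr 0 = 0\<close>, the right
      side can be zero even there.\<close>
    case True
    have z: "AE x in lborel. indicator D x * \<bar>v x\<bar> powr r = 0"
    proof -
      have "(AE x in lborel. indicator D x * \<bar>v x\<bar> powr q = 0) \<or> (AE x in lborel. indicator D x * \<bar>v x\<bar> powr s = 0)"
        using True Iq Is unfolding A_def B_def by (auto simp: integral_nonneg_eq_0_iff_AE)
      then show ?thesis by (elim disjE) (auto elim!: eventually_mono simp: indicator_def split: if_splits)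
    qed
    have "(\<lambda>x. indicator D x * \<bar>v x\<bar> powr r) \<in> borel_measurable lborel" by measurable
    from integrable_cong_AE[OF this _ z] have "integrable lborel (\<lambda>x. indicator D x * \<bar>v x\<bar> powr r)" by simp
    moreover have "(LINT x|lborel. indicator D x * \<bar>v x\<bar> powr r) = 0"
      using z by (rule integral_eq_zero_AE)
    ultimately show ?thesis by simp
  next
    case False
    with AB have AB0: "0 < A" "0 < B" by auto
    let ?g = "\<lambda>x. A powr l * B powr (1 - l) * (l * (indicator D x * \<bar>v x\<bar> powr q / A) + (1 - l) * (indicator D x * \<bar>v x\<bar> powr s / B))"
    have gi: "integrable lborel ?g"
      by (intro integrable_mult_right Bochner_Integration.integrable_add integrable_divide Iq Is)
    have le: "indicator D x * \<bar>v x\<bar> powr r \<le> ?g x" for x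
    proof (cases "x \<in> D \<and> v x \<noteq> 0")
      case True
      then have v0: "0 < \<bar>v x\<bar>" by simp
      have "\<bar>v x\<bar> powr r = (\<bar>v x\<bar> powr q) powr l * (\<bar>v x\<bar> powr s) powr (1 - l)"
        by (simp add: r powr_powr powr_add mult.commute)
      also have "\<dots> = A powr l * B powr (1 - l) * ((\<bar>v x\<bar> powr q / A) powr l * (\<bar>v x\<bar> powr s / B) powr (1 - l))"
        using AB0 by (simp add: powr_divide)
      also have "\<dots> \<le> A powr l * B powr (1 - l) * (l * (\<bar>v x\<bar> powr q / A) + (1 - l) * (\<bar>v x\<bar> powr s / B))"
        using l AB0 v0 by (intro mult_left_mono Youngs_inequality_0) auto
      finally show ?thesis using True by simp
    next
      case False
      then show ?thesis using l AB0 by (auto intro!: mult_nonneg_nonneg add_nonneg_nonneg)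
    qed
    have i: "integrable lborel (\<lambda>x. indicator D x * \<bar>v x\<bar> powr r)"
      by (rule Bochner_Integration.integrable_bound[OF gi]) (use le in \<open>auto intro!: AE_I2 intro: order_trans[OF _ abs_ge_self]\<close>)
    have "(LINT x|lborel. indicator D x * \<bar>v x\<bar> powr r) \<le> (LINT x|lborel. ?g x)"
      using i gi le by (intro integral_mono) auto
    also have "\<dots> = A powr l * B powr (1 - l) * (l * (A / A) + (1 - l) * (B / B))"
      using Iq Is by (simp add: A_def B_def)
    also have "\<dots> = A powr l * B powr (1 - l)" using AB0 by simp
    finally show ?thesis using i by simp
  qed
  then show "integrable lborel (\<lambda>x. indicator D x * \<bar>v x\<bar> powr r)"
    "(LINT x|lborel. indicator D x * \<bar>v x\<bar> powr r)
      \<le> (LINT x|lborel. indicator D x * \<bar>v x\<bar> powr q) powr l * (LINT x|lborel. indicator D x * \<bar>v x\<bar> powr s) powr (1 - l)"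
    by (auto simp: A_def B_def)
qed

text \<open>The constant is obtained before \<open>v\<close>, \<open>D\<close> and \<open>H\<close>
  are given, so each step of the induction multiplies it by a number depending on \<open>p\<close>,
  \<open>s\<close> and \<open>j\<close> only.\<close>

lemma level_decay_moment_iterate:
  assumes p: "0 < p" and s: "0 < s"
  obtains c where "0 < c"
    "\<And>(v::'a::euclidean_space \<Rightarrow> real) D H. v \<in> borel_measurable borel \<Longrightarrow> D \<in> sets borel \<Longrightarrow> 0 \<le> H \<Longrightarrow> level_decay v D p 1 H
      \<Longrightarrow> integrable lborel (\<lambda>x. indicator D x * \<bar>v x\<bar> powr s)
      \<Longrightarrow> integrable lborel (\<lambda>x. indicator D x * \<bar>v x\<bar> powr (s + real j * p)) \<and>
        (LINT x|lborel. indicator D x * \<bar>v x\<bar> powr (s + real j * p))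
          \<le> c * H ^ j * (LINT x|lborel. indicator D x * \<bar>v x\<bar> powr s)"
proof (induction j arbitrary: thesis)
  case 0
  show ?case by (rule 0[of 1]) auto
next
  case (Suc j)
  obtain c where c: "0 < c" and IH: "\<And>(v::'a \<Rightarrow> real) D H. v \<in> borel_measurable borel \<Longrightarrow> D \<in> sets borel \<Longrightarrow> 0 \<le> H \<Longrightarrow> level_decay v D p 1 H
      \<Longrightarrow> integrable lborel (\<lambda>x. indicator D x * \<bar>v x\<bar> powr s)
      \<Longrightarrow> integrable lborel (\<lambda>x. indicator D x * \<bar>v x\<bar> powr (s + real j * p)) \<and>
        (LINT x|lborel. indicator D x * \<bar>v x\<bar> powr (s + real j * p))
          \<le> c * H ^ j * (LINT x|lborel. indicator D x * \<bar>v x\<bar> powr s)"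
    by (rule Suc.IH) (rule that)
  let ?s = "s + real j * p"
  have s': "0 < ?s" using p s by (simp add: add_pos_nonneg)
  have e: "?s + p = s + real (Suc j) * p" by (simp add: algebra_simps)
  define d where "d = 2 powr (?s + p) * (?s + p) / ?s"
  have d: "0 < d" using s' p by (simp add: d_def)
  show ?case
  proof (rule Suc.prems[of "d * c"])
    fix v :: "'a \<Rightarrow> real" and D H
    assume a: "v \<in> borel_measurable borel" "D \<in> sets borel" "0 \<le> H" "level_decay v D p 1 H"
      "integrable lborel (\<lambda>x. indicator D x * \<bar>v x\<bar> powr s)"
    note I = IH[OF a]
    note st = level_decay_moment_step[OF a(1,2) p s' a(3,4) conjunct1[OF I], unfolded e]
    have "(LINT x|lborel. indicator D x * \<bar>v x\<bar> powr (s + real (Suc j) * p))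
        \<le> d * H * (LINT x|lborel. indicator D x * \<bar>v x\<bar> powr ?s)"
      using st(2) by (simp add: d_def e)
    also have "\<dots> \<le> d * H * (c * H ^ j * (LINT x|lborel. indicator D x * \<bar>v x\<bar> powr s))"
      using conjunct2[OF I] d a(3) by (intro mult_left_mono) auto
    finally show "integrable lborel (\<lambda>x. indicator D x * \<bar>v x\<bar> powr (s + real (Suc j) * p)) \<and>
        (LINT x|lborel. indicator D x * \<bar>v x\<bar> powr (s + real (Suc j) * p))
          \<le> d * c * H ^ Suc j * (LINT x|lborel. indicator D x * \<bar>v x\<bar> powr s)"
      using st(1) by (simp add: mult_ac)
  qed (use c d in simp)
qed

text \<open>Steps of length \<open>p\<close> carry the exponent from \<open>s\<close> beyond
  \<open>r\<close>, and interpolation returns to \<open>r\<close>. The weight \<open>l\<close>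
  satisfies \<open>j * l = (r - s) / p\<close>, which produces the power of
  \<open>H\<close>.\<close>

lemma level_decay_critical_moment:
  assumes p: "0 < p" and s: "0 < s" and r: "s \<le> r"
  obtains c where "0 < c"
    "\<And>(v::'a::euclidean_space \<Rightarrow> real) D H. v \<in> borel_measurable borel \<Longrightarrow> D \<in> sets borel \<Longrightarrow> 0 \<le> H \<Longrightarrow> level_decay v D p 1 H
      \<Longrightarrow> integrable lborel (\<lambda>x. indicator D x * \<bar>v x\<bar> powr s)
      \<Longrightarrow> integrable lborel (\<lambda>x. indicator D x * \<bar>v x\<bar> powr r) \<and>
        (LINT x|lborel. indicator D x * \<bar>v x\<bar> powr r)
          \<le> c * H powr ((r - s) / p) * (LINT x|lborel. indicator D x * \<bar>v x\<bar> powr s)"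
proof -
  obtain k :: nat where k: "(r - s) / p \<le> real k" using real_arch_simple by blast
  \<comment> \<open>The successor keeps \<open>j\<close> positive even for \<open>r = s\<close>.
    Then \<open>H ^ j\<close> vanishes for \<open>H = 0\<close>, in accordance with
    \<open>0 powr x = 0\<close> for every \<open>x\<close>, including 0.\<close>
  define j where "j = Suc k"
  have j: "r - s \<le> real j * p" "0 < real j"
  proof -
    have "r - s \<le> real k * p" using k p by (simp add: pos_divide_le_eq)
    also have "\<dots> \<le> real j * p" using p by (simp add: j_def algebra_simps)
    finally show "r - s \<le> real j * p" .
  qed (simp add: j_def)
  obtain c where c: "0 < c" and it: "\<And>(v::'a \<Rightarrow> real) D H. v \<in> borel_measurable borel \<Longrightarrow> D \<in> sets borel \<Longrightarrow> 0 \<le> H \<Longrightarrow> level_decay v D p 1 H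
      \<Longrightarrow> integrable lborel (\<lambda>x. indicator D x * \<bar>v x\<bar> powr s)
      \<Longrightarrow> integrable lborel (\<lambda>x. indicator D x * \<bar>v x\<bar> powr (s + real j * p)) \<and>
        (LINT x|lborel. indicator D x * \<bar>v x\<bar> powr (s + real j * p))
          \<le> c * H ^ j * (LINT x|lborel. indicator D x * \<bar>v x\<bar> powr s)"
    by (rule level_decay_moment_iterate[OF p s, of j]) (rule that)
  define l where "l = (r - s) / (real j * p)"
  have l: "0 \<le> l" "l \<le> 1" "real j * l = (r - s) / p" using j p r by (auto simp: l_def field_simps)
  have rl: "r = l * (s + real j * p) + (1 - l) * s" using j p by (simp add: l_def field_simps)
  have q: "0 < s + real j * p" using s p by (simp add: add_pos_nonneg)
  show thesis
  proof (rule that[of "c powr l"])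
    show "0 < c powr l" using c by simp
    fix v :: "'a \<Rightarrow> real" and D H
    assume a: "v \<in> borel_measurable borel" "D \<in> sets borel" "0 \<le> H" "level_decay v D p 1 H"
      "integrable lborel (\<lambda>x. indicator D x * \<bar>v x\<bar> powr s)"
    note I = it[OF a]
    note mi = moment_interpolation[OF a(1,2) s q l(1,2) rl a(5) conjunct1[OF I]]
    define S where "S = (LINT x|lborel. indicator D x * \<bar>v x\<bar> powr s)"
    have S: "0 \<le> S" by (simp add: S_def integral_nonneg_AE)
    have "(LINT x|lborel. indicator D x * \<bar>v x\<bar> powr r) \<le> (c * H ^ j * S) powr l * S powr (1 - l)"
      using mi(2) conjunct2[OF I] l unfolding S_def
      by (elim order_trans, intro mult_right_mono powr_mono2) (auto simp: integral_nonneg_AE)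
    also have "(c * H ^ j * S) powr l * S powr (1 - l) = c powr l * (H ^ j) powr l * (S powr l * S powr (1 - l))"
      by (simp add: powr_mult mult_ac)
    also have "(H ^ j) powr l = H powr ((r - s) / p)"
    proof (cases "H = 0")
      case True
      then show ?thesis using j by simp
    next
      case False
      then have "H ^ j = H powr real j" using a(3) by (simp add: powr_realpow)
      then show ?thesis using l(3) by (simp add: powr_powr)
    qed
    also have "S powr l * S powr (1 - l) = S" using S by (simp add: powr_add[symmetric])
    finally show "integrable lborel (\<lambda>x. indicator D x * \<bar>v x\<bar> powr r) \<and>
        (LINT x|lborel. indicator D x * \<bar>v x\<bar> powr r)
          \<le> c powr l * H powr ((r - s) / p) * (LINT x|lborel. indicator D x * \<bar>v x\<bar> powr s)"
      using mi(1) by (simp add: S_def)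
  qed
qed

text \<open>The optimal \<open>M\<close> solves the smallness condition with equality but may be 0,
  while the iteration asks for a positive level. It is therefore applied to
  \<open>M + 1 / (k + 1)\<close> for all \<open>k\<close>, followed by a limit.\<close>

lemma level_decay_sup_bound_explicit:
  fixes v :: "'a::euclidean_space \<Rightarrow> real"
  assumes [measurable]: "v \<in> borel_measurable borel" "D \<in> sets borel"
    and p: "0 < p" and \<alpha>: "0 < \<alpha>" and s: "0 < s" and H: "0 \<le> H"
    and decay: "level_decay v D p (1 + \<alpha>) H"
    and int: "integrable lborel (\<lambda>x. indicator D x * \<bar>v x\<bar> powr s)"
  shows "AE x in lborel. x \<in> D \<longrightarrow> \<bar>v x\<bar> \<le>
    2 * (H * 2 powr p * (2 powr p) powr (1 / \<alpha>) * (LINT x|lborel. indicator D x * \<bar>v x\<bar> powr s) powr \<alpha>) powr (1 / (p + s * \<alpha>))"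
proof -
  define Y where "Y = H * 2 powr p * (2 powr p) powr (1 / \<alpha>) * (LINT x|lborel. indicator D x * \<bar>v x\<bar> powr s) powr \<alpha>"
  define M where "M = Y powr (1 / (p + s * \<alpha>))"
  have e: "0 < p + s * \<alpha>" using p s \<alpha> by (simp add: add_pos_pos)
  have Y: "0 \<le> Y" using H by (simp add: Y_def)
  have M: "0 \<le> M" "M powr (p + s * \<alpha>) = Y" using e Y by (simp_all add: M_def powr_powr)
  have "AE x in lborel. x \<in> D \<longrightarrow> \<bar>v x\<bar> \<le> 2 * (M + 1 / real (Suc k))" for k
  proof (rule level_decay_sup_bound[OF assms(1,2) p \<alpha> s H _ decay int])
    show "0 < M + 1 / real (Suc k)" using M by (simp add: add_nonneg_pos)
    have "M powr (p + s * \<alpha>) \<le> (M + 1 / real (Suc k)) powr (p + s * \<alpha>)"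
      using M e by (intro powr_mono2) auto
    then show "H * 2 powr p * (2 powr p) powr (1 / \<alpha>) * (LINT x|lborel. indicator D x * \<bar>v x\<bar> powr s) powr \<alpha>
      \<le> (M + 1 / real (Suc k)) powr (p + s * \<alpha>)" unfolding M(2) by (simp add: Y_def)
  qed
  then have "AE x in lborel. \<forall>k. x \<in> D \<longrightarrow> \<bar>v x\<bar> \<le> 2 * (M + 1 / real (Suc k))"
    unfolding AE_all_countable by blast
  then have "AE x in lborel. x \<in> D \<longrightarrow> \<bar>v x\<bar> \<le> 2 * M"
  proof eventually_elim
    case (elim x)
    show ?case
    proof
      assume "x \<in> D"
      then have b: "\<bar>v x\<bar> \<le> 2 * (M + inverse (real (Suc k)))" for k
        using elim by (simp add: inverse_eq_divide)
      have "(\<lambda>k. 2 * (M + inverse (real (Suc k)))) \<longlonglongrightarrow> 2 * (M + 0)"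
        by (intro tendsto_intros LIMSEQ_inverse_real_of_nat)
      then show "\<bar>v x\<bar> \<le> 2 * M" using b by (intro LIMSEQ_le_const[of _ "2 * M"]) auto
    qed
  qed
  then show ?thesis by (simp add: M_def Y_def)
qed

section \<open>Level decay on an extension domain\<close>

lemma level_decay_mono: "level_decay v D p \<beta> H \<Longrightarrow> H \<le> H' \<Longrightarrow> level_decay v D p \<beta> H'"
  unfolding level_decay_def by (meson mult_right_mono order_trans powr_ge_zero)

lemma extension_representative:
  fixes \<Omega> :: "'a::euclidean_space set"
  assumes p: "1 < p" and ext: "W1p_extension_domain \<Omega> p"
  obtains C where "1 \<le> C"
    "\<And>u. u \<in> W1p \<Omega> p \<Longrightarrow> \<exists>v gr. sobolev_function v gr p \<and> (AE x in lebesgue_on \<Omega>. u x = v x) \<and>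
      sobolev_function.energy v gr p \<le> (C * W1p_norm \<Omega> p u) powr p"
proof -
  from ext obtain E C where \<Omega>: "open \<Omega>" and E: "W1p_extension_operator \<Omega> p E"
    and C: "1 \<le> C" and bd: "\<And>u. u \<in> W1p \<Omega> p \<Longrightarrow> W1p_norm UNIV p (E u) \<le> C * W1p_norm \<Omega> p u"
    unfolding W1p_extension_domain_def domain_def bounded_extension_operator_def by blast
  show thesis
  proof (rule that[OF C])
    fix u assume u: "u \<in> W1p \<Omega> p"
    have Eu: "E u \<in> W1p UNIV p" "AE x in lebesgue_on \<Omega>. E u x = u x"
      using E u by (auto simp: W1p_extension_operator_def)
    obtain v gr where S: "sobolev_function v gr p" and ae: "AE x in lborel. E u x = v x"
      and en: "sobolev_function.energy v gr p = W1p_norm UNIV p (E u) powr p"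
      by (rule W1p_UNIV_representative[OF p Eu(1)]) (rule that)
    have "AE x in lebesgue_on \<Omega>. E u x = v x"
      using AE_completion[OF ae] \<Omega> by (simp add: AE_restrict_space_iff) (auto elim: eventually_mono)
    with Eu(2) have "AE x in lebesgue_on \<Omega>. u x = v x" by eventually_elim simp
    moreover have "sobolev_function.energy v gr p \<le> (C * W1p_norm \<Omega> p u) powr p"
      unfolding en using bd[OF u] p by (intro powr_mono2) (auto simp: W1p_norm_def)
    ultimately show "\<exists>v gr. sobolev_function v gr p \<and> (AE x in lebesgue_on \<Omega>. u x = v x) \<and>
      sobolev_function.energy v gr p \<le> (C * W1p_norm \<Omega> p u) powr p" using S by blast
  qed
qed

text \<open>The level sets are taken in \<Omega>, where \<open>v\<close> agrees with
  \<open>u\<close>; the extension contributes only its energy, which the norm of \<open>u\<close>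
  controls. \<open>K\<close> depends on the domain and on \<open>p\<close> through the density
  constants and the bound of the extension operator.\<close>

lemma extension_domain_level_decay:
  fixes \<Omega> :: "'a::euclidean_space set"
  assumes p: "1 < p" and ext: "W1p_extension_domain \<Omega> p"
  obtains K where "0 < K"
    "\<And>u. u \<in> W1p \<Omega> p \<Longrightarrow> \<exists>v. v \<in> borel_measurable borel \<and> (AE x in lebesgue_on \<Omega>. u x = v x) \<and>
      level_decay v \<Omega> p (p / DIM('a)) (K * W1p_norm \<Omega> p u powr p)"
proof -
  obtain c R0 where c: "0 < c" "0 < R0"
    "\<And>x \<rho>. x \<in> \<Omega> \<Longrightarrow> 0 < \<rho> \<Longrightarrow> \<rho> \<le> R0 \<Longrightarrow> c * \<rho> ^ DIM('a) \<le> measure lborel (\<Omega> \<inter> ball x \<rho>)"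
    by (rule extension_domain_measure_density[OF p ext]) (rule that)
  obtain C where C: "1 \<le> C" and rep: "\<And>u. u \<in> W1p \<Omega> p \<Longrightarrow> \<exists>v gr. sobolev_function v gr p \<and> (AE x in lebesgue_on \<Omega>. u x = v x) \<and>
      sobolev_function.energy v gr p \<le> (C * W1p_norm \<Omega> p u) powr p"
    by (rule extension_representative[OF p ext]) (rule that)
  have \<Omega>: "\<Omega> \<in> sets borel" using ext by (simp add: W1p_extension_domain_def domain_def)
  define k where "k = unit_ball_vol (real DIM('a)) * (2 / c) powr (1 + p / DIM('a)) + (c * R0 ^ DIM('a) / 2) powr (- (p / DIM('a)))"
  have k: "0 < k" using c by (auto simp: k_def intro!: add_pos_pos mult_pos_pos)
  show thesis
  proof (rule that[of "k * C powr p"])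
    show "0 < k * C powr p" using k C by simp
    fix u assume u: "u \<in> W1p \<Omega> p"
    obtain v gr where S: "sobolev_function v gr p" and ae: "AE x in lebesgue_on \<Omega>. u x = v x"
      and en: "sobolev_function.energy v gr p \<le> (C * W1p_norm \<Omega> p u) powr p"
      using rep[OF u] by blast
    interpret sobolev_function v gr p by (rule S)
    have "level_decay v \<Omega> p (p / DIM('a)) (k * energy)"
      unfolding k_def by (rule level_decay_of_density[OF \<Omega> c])
    moreover have "k * energy \<le> k * C powr p * W1p_norm \<Omega> p u powr p"
      using mult_left_mono[OF en, of k] k by (simp add: powr_mult mult.assoc)
    ultimately have "level_decay v \<Omega> p (p / DIM('a)) (k * C powr p * W1p_norm \<Omega> p u powr p)"
      by (rule level_decay_mono)
    then show "\<exists>v. v \<in> borel_measurable borel \<and> (AE x in lebesgue_on \<Omega>. u x = v x) \<and>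
      level_decay v \<Omega> p (p / DIM('a)) (k * C powr p * W1p_norm \<Omega> p u powr p)"
      using ae v_meas by blast
  qed
qed

subsection \<open>Interpolation on extension domains\<close>

lemma Lp_norm_nonneg: "0 < r \<Longrightarrow> 0 \<le> Lp_norm \<Omega> (ereal r) u"
  by (simp add: Lp_norm_def)

lemma Lp_representative:
  fixes \<Omega> :: "'a::euclidean_space set"
  assumes \<Omega>: "open \<Omega>" and r: "0 < r" and u: "u \<in> borel_measurable (lebesgue_on \<Omega>)"
    and v: "v \<in> borel_measurable borel" and ae: "AE x in lebesgue_on \<Omega>. u x = v x"
  shows "u \<in> Lp_space \<Omega> (ereal r) \<longleftrightarrow> integrable lborel (\<lambda>x. indicator \<Omega> x * \<bar>v x\<bar> powr r)"
    and "Lp_norm \<Omega> (ereal r) u = (LINT x|lborel. indicator \<Omega> x * \<bar>v x\<bar> powr r) powr (1 / r)"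
    and "Lp_norm \<Omega> (ereal r) u powr r = (LINT x|lborel. indicator \<Omega> x * \<bar>v x\<bar> powr r)"
  using Lp_transfer[OF \<Omega> u v ae, of r] u r
  by (simp_all add: Lp_space_def Lp_norm_def powr_powr integral_nonneg_AE)

text \<open>Converts the weight \<theta>, which refers to norms, into the weight \<open>l\<close>,
  which refers to moments: \<open>l\<close> is the exponent of the \<open>q\<close>-th moment in the
  bound for the \<open>r\<close>-th one, and taking \<open>r\<close>-th roots gives \<theta>
  back.\<close>

lemma interpolation_exponents:
  fixes s q r \<theta> :: real
  assumes "0 < s" "0 < q" "0 < r" "0 \<le> \<theta>" "\<theta> \<le> 1" and e: "\<theta> / q + (1 - \<theta>) / s = 1 / r"
  defines "l \<equiv> \<theta> * r / q"
  shows "0 \<le> l" "l \<le> 1" "r = l * q + (1 - l) * s" "l / r = \<theta> / q" "s * (1 - l) / r = 1 - \<theta>"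
proof -
  have "r * (\<theta> / q + (1 - \<theta>) / s) = 1" using e assms by simp
  then have 1: "l + r * (1 - \<theta>) / s = 1" by (simp add: l_def algebra_simps)
  then have 2: "(1 - l) * s = r * (1 - \<theta>)" using assms(1) by (simp add: field_simps)
  show "0 \<le> l" using assms by (simp add: l_def)
  have "0 \<le> r * (1 - \<theta>) / s" using assms by simp
  then show "l \<le> 1" using 1 by linarith
  have "l * q = \<theta> * r" using assms by (simp add: l_def)
  with 2 show "r = l * q + (1 - l) * s" by (simp add: algebra_simps)
  show "l / r = \<theta> / q" using assms by (simp add: l_def)
  show "s * (1 - l) / r = 1 - \<theta>" using 2 assms by (simp add: mult.commute)
qed

text \<open>The Sobolev inequality for the extension bounds the moment of order \<open>q\<close>
  with \<open>1 / q = 1 / p - 1 / n\<close> by the Sobolev norm alone. Restricted to \<Omega>, it is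
  interpolated with the moment of order \<open>s\<close> of \<open>u\<close>.\<close>

lemma interpolation_subcritical:
  fixes \<Omega> :: "'a::euclidean_space set" and p :: real
  assumes p: "1 < p" and ext: "W1p_extension_domain \<Omega> p" and s: "0 < s" and r: "0 < r" and pn: "p < DIM('a)"
  shows "\<exists>C::real. \<forall>\<theta>\<in>{0..1}. \<theta> * (1 / p - 1 / DIM('a)) + (1 - \<theta>) * (1 / s) = 1 / r \<longrightarrow>
    W1p \<Omega> p \<inter> Lp_space \<Omega> (ereal s) \<subseteq> Lp_space \<Omega> (ereal r) \<and>
    (\<forall>u \<in> W1p \<Omega> p \<inter> Lp_space \<Omega> (ereal s).
      Lp_norm \<Omega> (ereal r) u \<le> C * W1p_norm \<Omega> p u powr \<theta> * Lp_norm \<Omega> (ereal s) u powr (1 - \<theta>))"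
proof -
  have \<Omega>: "open \<Omega>" "\<Omega> \<in> sets borel" using ext by (auto simp: W1p_extension_domain_def domain_def)
  obtain C where C: "1 \<le> C" and rep: "\<And>u. u \<in> W1p \<Omega> p \<Longrightarrow> \<exists>v gr. sobolev_function v gr p \<and> (AE x in lebesgue_on \<Omega>. u x = v x) \<and>
      sobolev_function.energy v gr p \<le> (C * W1p_norm \<Omega> p u) powr p"
    by (rule extension_representative[OF p ext]) (rule that)
  define q where "q = DIM('a) * p / (DIM('a) - p)"
  have q: "0 < q" "1 / q = 1 / p - 1 / DIM('a)" using p pn by (auto simp: q_def field_simps)
  define K where "K = unit_ball_vol (real DIM('a)) * (2 / unit_ball_vol (real DIM('a))) powr (1 + p / DIM('a))"
  define K1 where "K1 = q * 2 powr q * K * (2 powr q * K) powr (q / DIM('a))"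
  have K1: "0 \<le> K1" using q by (simp add: K1_def K_def)
  define B where "B = K1 * C powr q"
  have B: "0 \<le> B" using K1 by (simp add: B_def)
  show ?thesis
  proof (rule exI[of _ "(1 + B) powr (1 / q)"], intro ballI impI)
    fix \<theta> :: real assume \<theta>: "\<theta> \<in> {0..1}" and e: "\<theta> * (1 / p - 1 / DIM('a)) + (1 - \<theta>) * (1 / s) = 1 / r"
    define l where "l = \<theta> * r / q"
    have e': "\<theta> / q + (1 - \<theta>) / s = 1 / r" using e unfolding q(2)[symmetric] by simp
    have \<theta>01: "0 \<le> \<theta>" "\<theta> \<le> 1" using \<theta> by auto
    note l = interpolation_exponents[OF s q(1) r \<theta>01 e', folded l_def]
    have "u \<in> Lp_space \<Omega> (ereal r) \<and>
      Lp_norm \<Omega> (ereal r) u \<le> (1 + B) powr (1 / q) * W1p_norm \<Omega> p u powr \<theta> * Lp_norm \<Omega> (ereal s) u powr (1 - \<theta>)"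
      if u: "u \<in> W1p \<Omega> p" "u \<in> Lp_space \<Omega> (ereal s)" for u
    proof -
      define W S where "W = W1p_norm \<Omega> p u" and "S = Lp_norm \<Omega> (ereal s) u"
      have WS: "0 \<le> W" "0 \<le> S" using s by (auto simp: W_def S_def W1p_norm_def Lp_norm_nonneg)
      have um: "u \<in> borel_measurable (lebesgue_on \<Omega>)" using u(2) by (simp add: Lp_space_def)
      obtain v gr where S': "sobolev_function v gr p" and ae: "AE x in lebesgue_on \<Omega>. u x = v x"
        and en: "sobolev_function.energy v gr p \<le> (C * W) powr p"
        using rep[OF u(1)] unfolding W_def by blast
      interpret sobolev_function v gr p by (rule S')
      note repr = Lp_representative[OF \<Omega>(1) _ um v_meas ae]
      define Iq where "Iq = (LINT x|lborel. indicator \<Omega> x * \<bar>v x\<bar> powr q)"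
      have Iqi: "integrable lborel (\<lambda>x. indicator \<Omega> x * \<bar>v x\<bar> powr q)"
        using integrable_mult_indicator[OF _ sobolev_inequality(1)[OF pn q_def], of \<Omega>] \<Omega> by simp
      have Iq: "0 \<le> Iq" "Iq \<le> B * W powr q"
      proof -
        have "Iq \<le> (LINT x|lborel. \<bar>v x\<bar> powr q)"
          unfolding Iq_def using Iqi sobolev_inequality(1)[OF pn q_def]
          by (intro integral_mono) (auto split: split_indicator)
        also have "\<dots> \<le> K1 * energy powr (q / p)"
          using sobolev_inequality(2)[OF pn q_def] by (simp add: K1_def K_def)
        also have "\<dots> \<le> K1 * ((C * W) powr p) powr (q / p)"
          using K1 en energy_nonneg p q by (intro mult_left_mono powr_mono2) auto
        also have "\<dots> = B * W powr q" using p by (simp add: powr_powr B_def powr_mult)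
        finally show "Iq \<le> B * W powr q" .
      qed (simp add: Iq_def integral_nonneg_AE)
      have Is: "integrable lborel (\<lambda>x. indicator \<Omega> x * \<bar>v x\<bar> powr s)" "(LINT x|lborel. indicator \<Omega> x * \<bar>v x\<bar> powr s) = S powr s"
        using repr(1,3)[OF s] u(2) by (simp_all add: S_def)
      note mi = moment_interpolation[OF v_meas \<Omega>(2) s q(1) l(1,2,3) Is(1) Iqi, folded Iq_def, unfolded Is(2)]
      have "Lp_norm \<Omega> (ereal r) u \<le> (Iq powr l * (S powr s) powr (1 - l)) powr (1 / r)"
        unfolding repr(2)[OF r] using mi(2) r by (intro powr_mono2) (auto simp: integral_nonneg_AE)
      also have "\<dots> \<le> ((B * W powr q) powr l * (S powr s) powr (1 - l)) powr (1 / r)"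
        using Iq l(1) r by (intro powr_mono2 mult_right_mono) auto
      also have "\<dots> = B powr (l / r) * W powr (q * (l / r)) * S powr (s * (1 - l) / r)"
        by (simp add: powr_mult powr_powr)
      also have "\<dots> = B powr (\<theta> / q) * W powr \<theta> * S powr (1 - \<theta>)"
        unfolding l(4,5) using q by simp
      \<comment> \<open>Increasing the base to at least 1 allows the exponent
        \<open>\<theta> / q\<close> to be replaced by \<open>1 / q\<close>, which frees the constant
        from \<theta>.\<close>
      also have "\<dots> \<le> (1 + B) powr (1 / q) * W powr \<theta> * S powr (1 - \<theta>)"
      proof (intro mult_right_mono)
        have "B powr (\<theta> / q) \<le> (1 + B) powr (\<theta> / q)" using B q \<theta>01 by (intro powr_mono2) auto
        also have "\<dots> \<le> (1 + B) powr (1 / q)" using B q \<theta>01 by (intro powr_mono divide_right_mono) auto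
        finally show "B powr (\<theta> / q) \<le> (1 + B) powr (1 / q)" .
      qed auto
      finally show ?thesis using repr(1)[OF r] mi(1) by (simp add: W_def S_def)
    qed
    then show "W1p \<Omega> p \<inter> Lp_space \<Omega> (ereal s) \<subseteq> Lp_space \<Omega> (ereal r) \<and>
      (\<forall>u \<in> W1p \<Omega> p \<inter> Lp_space \<Omega> (ereal s).
        Lp_norm \<Omega> (ereal r) u \<le> (1 + B) powr (1 / q) * W1p_norm \<Omega> p u powr \<theta> * Lp_norm \<Omega> (ereal s) u powr (1 - \<theta>))"
      by blast
  qed
qed

text \<open>For \<open>p = n\<close> the relation reads \<open>1 - \<theta> = s / r\<close>. The
  critical moment bound contains the powers \<open>r - s\<close> of the Sobolev norm and
  \<open>s\<close> of the \<open>L^s\<close> norm, and \<open>r\<close>-th roots give the weights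
  \<theta> and \<open>1 - \<theta>\<close>.\<close>

lemma interpolation_critical:
  fixes \<Omega> :: "'a::euclidean_space set" and p :: real
  assumes p: "1 < p" and ext: "W1p_extension_domain \<Omega> p" and s: "0 < s" and r: "s \<le> r" and pn: "p = DIM('a)"
  shows "\<exists>C::real. \<forall>\<theta>\<in>{0..1}. \<theta> * (1 / p - 1 / DIM('a)) + (1 - \<theta>) * (1 / s) = 1 / r \<longrightarrow>
    W1p \<Omega> p \<inter> Lp_space \<Omega> (ereal s) \<subseteq> Lp_space \<Omega> (ereal r) \<and>
    (\<forall>u \<in> W1p \<Omega> p \<inter> Lp_space \<Omega> (ereal s).
      Lp_norm \<Omega> (ereal r) u \<le> C * W1p_norm \<Omega> p u powr \<theta> * Lp_norm \<Omega> (ereal s) u powr (1 - \<theta>))"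
proof -
  have \<Omega>: "open \<Omega>" "\<Omega> \<in> sets borel" using ext by (auto simp: W1p_extension_domain_def domain_def)
  have r0: "0 < r" and p0: "0 < p" using r s p by simp_all
  obtain K where K: "0 < K" and rep: "\<And>u. u \<in> W1p \<Omega> p \<Longrightarrow> \<exists>v. v \<in> borel_measurable borel \<and> (AE x in lebesgue_on \<Omega>. u x = v x) \<and>
      level_decay v \<Omega> p (p / DIM('a)) (K * W1p_norm \<Omega> p u powr p)"
    by (rule extension_domain_level_decay[OF p ext]) (rule that)
  obtain c where c: "0 < c" and mom: "\<And>(v::'a \<Rightarrow> real) D H. v \<in> borel_measurable borel \<Longrightarrow> D \<in> sets borel \<Longrightarrow> 0 \<le> H \<Longrightarrow> level_decay v D p 1 H
      \<Longrightarrow> integrable lborel (\<lambda>x. indicator D x * \<bar>v x\<bar> powr s)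
      \<Longrightarrow> integrable lborel (\<lambda>x. indicator D x * \<bar>v x\<bar> powr r) \<and>
        (LINT x|lborel. indicator D x * \<bar>v x\<bar> powr r)
          \<le> c * H powr ((r - s) / p) * (LINT x|lborel. indicator D x * \<bar>v x\<bar> powr s)"
    by (rule level_decay_critical_moment[OF p0 s r]) (rule that)
  define C where "C = (c * K powr ((r - s) / p)) powr (1 / r)"
  show ?thesis
  proof (rule exI[of _ C], intro ballI impI)
    fix \<theta> :: real assume \<theta>: "\<theta> \<in> {0..1}" and e: "\<theta> * (1 / p - 1 / DIM('a)) + (1 - \<theta>) * (1 / s) = 1 / r"
    have \<theta>1: "1 - \<theta> = s / r" using e s r0 by (simp add: pn field_simps)
    then have \<theta>2: "(r - s) / r = \<theta>" using r0 by (simp add: diff_divide_distrib)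
    have "u \<in> Lp_space \<Omega> (ereal r) \<and>
      Lp_norm \<Omega> (ereal r) u \<le> C * W1p_norm \<Omega> p u powr \<theta> * Lp_norm \<Omega> (ereal s) u powr (1 - \<theta>)"
      if u: "u \<in> W1p \<Omega> p" "u \<in> Lp_space \<Omega> (ereal s)" for u
    proof -
      define W S where "W = W1p_norm \<Omega> p u" and "S = Lp_norm \<Omega> (ereal s) u"
      have WS: "0 \<le> W" "0 \<le> S" using s by (auto simp: W_def S_def W1p_norm_def Lp_norm_nonneg)
      have um: "u \<in> borel_measurable (lebesgue_on \<Omega>)" using u(2) by (simp add: Lp_space_def)
      obtain v where v: "v \<in> borel_measurable borel" and ae: "AE x in lebesgue_on \<Omega>. u x = v x"
        and dec: "level_decay v \<Omega> p 1 (K * W powr p)"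
        using rep[OF u(1)] p unfolding W_def by (auto simp: pn[symmetric])
      note repr = Lp_representative[OF \<Omega>(1) _ um v ae]
      have Is: "integrable lborel (\<lambda>x. indicator \<Omega> x * \<bar>v x\<bar> powr s)" "(LINT x|lborel. indicator \<Omega> x * \<bar>v x\<bar> powr s) = S powr s"
        using repr(1,3)[OF s] u(2) by (simp_all add: S_def)
      have H0: "0 \<le> K * W powr p" using K by simp
      note M = mom[OF v \<Omega>(2) H0 dec Is(1), unfolded Is(2)]
      have "Lp_norm \<Omega> (ereal r) u \<le> (c * (K * W powr p) powr ((r - s) / p) * S powr s) powr (1 / r)"
        unfolding repr(2)[OF r0] using conjunct2[OF M] r0 by (intro powr_mono2) (auto simp: integral_nonneg_AE)
      also have "\<dots> = C * W powr ((r - s) / r) * S powr (s / r)"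
        using p by (simp add: powr_mult powr_powr C_def)
      also have "\<dots> = C * W powr \<theta> * S powr (1 - \<theta>)" unfolding \<theta>2 \<theta>1 ..
      finally show ?thesis using repr(1)[OF r0] conjunct1[OF M] by (simp add: W_def S_def)
    qed
    then show "W1p \<Omega> p \<inter> Lp_space \<Omega> (ereal s) \<subseteq> Lp_space \<Omega> (ereal r) \<and>
      (\<forall>u \<in> W1p \<Omega> p \<inter> Lp_space \<Omega> (ereal s).
        Lp_norm \<Omega> (ereal r) u \<le> C * W1p_norm \<Omega> p u powr \<theta> * Lp_norm \<Omega> (ereal s) u powr (1 - \<theta>))"
      by blast
  qed
qed

text \<open>With \<open>\<alpha> = p / n - 1\<close>, De Giorgi's bound for the supremum is the
  power \<open>1 / (p + s * \<alpha>)\<close> of a constant times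
  \<open>W powr p * S powr (s * \<alpha>)\<close>, where \<open>W\<close> and \<open>S\<close> are
  the Sobolev and the \<open>L^s\<close> norm. The two exponents add up to 1, and \<tau> is the
  first of them.\<close>

lemma supercritical_sup_bound:
  fixes \<Omega> :: "'a::euclidean_space set" and p :: real
  assumes p: "1 < p" and ext: "W1p_extension_domain \<Omega> p" and s: "0 < s" and pn: "DIM('a) < p"
  defines "\<tau> \<equiv> p / (p + s * (p / DIM('a) - 1))"
  obtains B where "0 < B"
    "\<And>u. u \<in> W1p \<Omega> p \<Longrightarrow> u \<in> Lp_space \<Omega> (ereal s) \<Longrightarrow>
      AE x in lebesgue_on \<Omega>. \<bar>u x\<bar> \<le> B * W1p_norm \<Omega> p u powr \<tau> * Lp_norm \<Omega> (ereal s) u powr (1 - \<tau>)"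
proof -
  have \<Omega>: "open \<Omega>" "\<Omega> \<in> sets borel" using ext by (auto simp: W1p_extension_domain_def domain_def)
  obtain K where K: "0 < K" and rep: "\<And>u. u \<in> W1p \<Omega> p \<Longrightarrow> \<exists>v. v \<in> borel_measurable borel \<and> (AE x in lebesgue_on \<Omega>. u x = v x) \<and>
      level_decay v \<Omega> p (p / DIM('a)) (K * W1p_norm \<Omega> p u powr p)"
    by (rule extension_domain_level_decay[OF p ext]) (rule that)
  define \<alpha> where "\<alpha> = p / DIM('a) - 1"
  have \<alpha>: "0 < \<alpha>" "1 + \<alpha> = p / DIM('a)" using pn by (auto simp: \<alpha>_def)
  have p0: "0 < p" using p by simp
  define e where "e = 1 / (p + s * \<alpha>)"
  have pos: "0 < p + s * \<alpha>" using p s \<alpha> by (simp add: add_pos_pos)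
  have \<tau>e: "p * e = \<tau>" "s * \<alpha> * e = 1 - \<tau>" using pos by (simp_all add: \<tau>_def e_def \<alpha>_def[symmetric] field_simps)
  define k where "k = 2 powr p * (2 powr p) powr (1 / \<alpha>)"
  show thesis
  proof (rule that[of "2 * (K * k) powr e"])
    show "0 < 2 * (K * k) powr e" using K by (simp add: k_def)
    fix u assume u: "u \<in> W1p \<Omega> p" "u \<in> Lp_space \<Omega> (ereal s)"
    define W S where "W = W1p_norm \<Omega> p u" and "S = Lp_norm \<Omega> (ereal s) u"
    have um: "u \<in> borel_measurable (lebesgue_on \<Omega>)" using u(2) by (simp add: Lp_space_def)
    obtain v where v: "v \<in> borel_measurable borel" and ae: "AE x in lebesgue_on \<Omega>. u x = v x"
      and dec: "level_decay v \<Omega> p (1 + \<alpha>) (K * W powr p)"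
      using rep[OF u(1)] unfolding W_def \<alpha>(2) by blast
    note repr = Lp_representative[OF \<Omega>(1) s um v ae]
    have Is: "integrable lborel (\<lambda>x. indicator \<Omega> x * \<bar>v x\<bar> powr s)" "(LINT x|lborel. indicator \<Omega> x * \<bar>v x\<bar> powr s) = S powr s"
      using repr(1,3) u(2) by (simp_all add: S_def)
    have H0: "0 \<le> K * W powr p" using K by simp
    have "AE x in lborel. x \<in> \<Omega> \<longrightarrow> \<bar>v x\<bar> \<le> 2 * (K * W powr p * 2 powr p * (2 powr p) powr (1 / \<alpha>) * (S powr s) powr \<alpha>) powr e"
      using level_decay_sup_bound_explicit[OF v \<Omega>(2) p0 \<alpha>(1) s H0 dec Is(1)] unfolding Is(2) e_def .
    also have "2 * (K * W powr p * 2 powr p * (2 powr p) powr (1 / \<alpha>) * (S powr s) powr \<alpha>) powr e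
      = 2 * (K * k) powr e * W powr (p * e) * S powr (s * \<alpha> * e)"
      by (simp add: powr_mult powr_powr k_def mult_ac)
    finally have "AE x in lborel. x \<in> \<Omega> \<longrightarrow> \<bar>v x\<bar> \<le> 2 * (K * k) powr e * W powr \<tau> * S powr (1 - \<tau>)"
      unfolding \<tau>e .
    then have "AE x in lebesgue_on \<Omega>. \<bar>v x\<bar> \<le> 2 * (K * k) powr e * W powr \<tau> * S powr (1 - \<tau>)"
      using \<Omega>(1) by (subst AE_restrict_space_iff) (auto dest: AE_completion)
    with ae show "AE x in lebesgue_on \<Omega>. \<bar>u x\<bar> \<le> 2 * (K * k) powr e * W1p_norm \<Omega> p u powr \<tau> * Lp_norm \<Omega> (ereal s) u powr (1 - \<tau>)"
      unfolding W_def S_def by eventually_elim simp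
  qed
qed

text \<open>Here \<open>x\<close> stands for \<open>1 / r\<close>. The value \<open>x = 0\<close>
  gives the weight \<tau> of the sup bound; the factor \<open>1 - s * x\<close> is the share
  \<open>(r - s) / r\<close> in which that bound enters for finite \<open>r\<close>.\<close>

lemma supercritical_exponent:
  fixes p s n \<theta> x :: real
  assumes "0 < n" "n < p" "0 < s" and e: "\<theta> * (1 / p - 1 / n) + (1 - \<theta>) * (1 / s) = x"
  shows "\<theta> = p / (p + s * (p / n - 1)) * (1 - s * x)"
proof -
  have "0 < s * (p / n - 1)" using assms by simp
  then have pos: "0 < p + s * (p / n - 1)" using assms by linarith
  have "s * p * (\<theta> * (1 / p - 1 / n) + (1 - \<theta>) * (1 / s)) = p - \<theta> * (p + s * (p / n - 1))"
    using assms(1-3) by (simp add: field_simps)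
  then have "\<theta> * (p + s * (p / n - 1)) = p * (1 - s * x)" unfolding e by (simp add: algebra_simps)
  then show ?thesis using pos by (simp add: field_simps)
qed

text \<open>If \<open>M\<close> bounds \<open>|u|\<close> almost everywhere, then
  \<open>|u|^r \<le> M^(r-s) |u|^s\<close>. Integrating and inserting the value of \<open>M\<close>
  gives the claim.\<close>

lemma interpolation_supercritical:
  fixes \<Omega> :: "'a::euclidean_space set" and p :: real
  assumes p: "1 < p" and ext: "W1p_extension_domain \<Omega> p" and s: "0 < s" and r: "s \<le> r" and pn: "DIM('a) < p"
  shows "\<exists>C::real. \<forall>\<theta>\<in>{0..1}. \<theta> * (1 / p - 1 / DIM('a)) + (1 - \<theta>) * (1 / s) = 1 / r \<longrightarrow>
    W1p \<Omega> p \<inter> Lp_space \<Omega> (ereal s) \<subseteq> Lp_space \<Omega> (ereal r) \<and>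
    (\<forall>u \<in> W1p \<Omega> p \<inter> Lp_space \<Omega> (ereal s).
      Lp_norm \<Omega> (ereal r) u \<le> C * W1p_norm \<Omega> p u powr \<theta> * Lp_norm \<Omega> (ereal s) u powr (1 - \<theta>))"
proof -
  have r0: "0 < r" using r s by simp
  define \<tau> where "\<tau> = p / (p + s * (p / DIM('a) - 1))"
  obtain B where B: "0 < B" and sup: "\<And>u. u \<in> W1p \<Omega> p \<Longrightarrow> u \<in> Lp_space \<Omega> (ereal s) \<Longrightarrow>
      AE x in lebesgue_on \<Omega>. \<bar>u x\<bar> \<le> B * W1p_norm \<Omega> p u powr \<tau> * Lp_norm \<Omega> (ereal s) u powr (1 - \<tau>)"
    by (rule supercritical_sup_bound[OF p ext s pn, folded \<tau>_def]) (rule that)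
  show ?thesis
  proof (rule exI[of _ "B powr ((r - s) / r)"], intro ballI impI)
    fix \<theta> :: real assume \<theta>: "\<theta> \<in> {0..1}" and e: "\<theta> * (1 / p - 1 / DIM('a)) + (1 - \<theta>) * (1 / s) = 1 / r"
    have "\<theta> = \<tau> * (1 - s * (1 / r))"
      unfolding \<tau>_def by (rule supercritical_exponent[OF _ pn s e]) simp
    then have \<theta>1: "\<tau> * ((r - s) / r) = \<theta>" using r0 by (simp add: field_simps)
    have \<theta>2: "(1 - \<tau>) * ((r - s) / r) + s / r = 1 - \<theta>"
      unfolding \<theta>1[symmetric] using r0 by (simp add: field_simps)
    have "u \<in> Lp_space \<Omega> (ereal r) \<and>
      Lp_norm \<Omega> (ereal r) u \<le> B powr ((r - s) / r) * W1p_norm \<Omega> p u powr \<theta> * Lp_norm \<Omega> (ereal s) u powr (1 - \<theta>)"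
      if u: "u \<in> W1p \<Omega> p" "u \<in> Lp_space \<Omega> (ereal s)" for u
    proof -
      define W S where "W = W1p_norm \<Omega> p u" and "S = Lp_norm \<Omega> (ereal s) u"
      define M where "M = B * W powr \<tau> * S powr (1 - \<tau>)"
      have M0: "0 \<le> M" using B by (simp add: M_def)
      have um[measurable]: "u \<in> borel_measurable (lebesgue_on \<Omega>)" using u(2) by (simp add: Lp_space_def)
      have Is: "integrable (lebesgue_on \<Omega>) (\<lambda>x. \<bar>u x\<bar> powr s)" using u(2) by (simp add: Lp_space_def)
      have SS: "(LINT x|lebesgue_on \<Omega>. \<bar>u x\<bar> powr s) = S powr s"
        using s by (simp add: S_def Lp_norm_def powr_powr integral_nonneg_AE)
      have ae: "AE x in lebesgue_on \<Omega>. \<bar>u x\<bar> powr r \<le> M powr (r - s) * \<bar>u x\<bar> powr s"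
        using sup[OF u, folded W_def S_def, folded M_def]
      proof eventually_elim
        case (elim x)
        have "\<bar>u x\<bar> powr r = \<bar>u x\<bar> powr (r - s) * \<bar>u x\<bar> powr s" by (simp add: powr_add[symmetric])
        also have "\<dots> \<le> M powr (r - s) * \<bar>u x\<bar> powr s"
          using elim r by (intro mult_right_mono powr_mono2) auto
        finally show ?case .
      qed
      have gi: "integrable (lebesgue_on \<Omega>) (\<lambda>x. M powr (r - s) * \<bar>u x\<bar> powr s)"
        using Is by (rule integrable_mult_right)
      have Ir: "integrable (lebesgue_on \<Omega>) (\<lambda>x. \<bar>u x\<bar> powr r)"
      proof (rule Bochner_Integration.integrable_bound[OF gi])
        show "(\<lambda>x. \<bar>u x\<bar> powr r) \<in> borel_measurable (lebesgue_on \<Omega>)" by measurable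
        show "AE x in lebesgue_on \<Omega>. norm (\<bar>u x\<bar> powr r) \<le> norm (M powr (r - s) * \<bar>u x\<bar> powr s)"
          using ae by eventually_elim simp
      qed
      have "(LINT x|lebesgue_on \<Omega>. \<bar>u x\<bar> powr r) \<le> (LINT x|lebesgue_on \<Omega>. M powr (r - s) * \<bar>u x\<bar> powr s)"
        by (rule integral_mono_AE[OF Ir gi ae])
      also have "\<dots> = M powr (r - s) * S powr s" by (simp add: SS)
      finally have "Lp_norm \<Omega> (ereal r) u \<le> (M powr (r - s) * S powr s) powr (1 / r)"
        using r0 by (simp add: Lp_norm_def powr_mono2 integral_nonneg_AE)
      also have "\<dots> = B powr ((r - s) / r) * W powr (\<tau> * ((r - s) / r)) * (S powr ((1 - \<tau>) * ((r - s) / r)) * S powr (s / r))"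
        by (simp add: M_def powr_mult powr_powr)
      also have "\<dots> = B powr ((r - s) / r) * W powr \<theta> * S powr (1 - \<theta>)"
        unfolding \<theta>1 powr_add[symmetric] \<theta>2 ..
      finally show ?thesis using um Ir by (simp add: W_def S_def Lp_space_def)
    qed
    then show "W1p \<Omega> p \<inter> Lp_space \<Omega> (ereal s) \<subseteq> Lp_space \<Omega> (ereal r) \<and>
      (\<forall>u \<in> W1p \<Omega> p \<inter> Lp_space \<Omega> (ereal s).
        Lp_norm \<Omega> (ereal r) u \<le> B powr ((r - s) / r) * W1p_norm \<Omega> p u powr \<theta> * Lp_norm \<Omega> (ereal s) u powr (1 - \<theta>))"
      by blast
  qed
qed

lemma interpolation_supercritical_infinity:
  fixes \<Omega> :: "'a::euclidean_space set" and p :: real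
  assumes p: "1 < p" and ext: "W1p_extension_domain \<Omega> p" and s: "0 < s" and pn: "DIM('a) < p"
  shows "\<exists>C::real. \<forall>\<theta>\<in>{0..1}. \<theta> * (1 / p - 1 / DIM('a)) + (1 - \<theta>) * (1 / s) = 0 \<longrightarrow>
    W1p \<Omega> p \<inter> Lp_space \<Omega> (ereal s) \<subseteq> Lp_space \<Omega> \<infinity> \<and>
    (\<forall>u \<in> W1p \<Omega> p \<inter> Lp_space \<Omega> (ereal s).
      Lp_norm \<Omega> \<infinity> u \<le> C * W1p_norm \<Omega> p u powr \<theta> * Lp_norm \<Omega> (ereal s) u powr (1 - \<theta>))"
proof -
  define \<tau> where "\<tau> = p / (p + s * (p / DIM('a) - 1))"
  obtain B where B: "0 < B" and sup: "\<And>u. u \<in> W1p \<Omega> p \<Longrightarrow> u \<in> Lp_space \<Omega> (ereal s) \<Longrightarrow>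
      AE x in lebesgue_on \<Omega>. \<bar>u x\<bar> \<le> B * W1p_norm \<Omega> p u powr \<tau> * Lp_norm \<Omega> (ereal s) u powr (1 - \<tau>)"
    by (rule supercritical_sup_bound[OF p ext s pn, folded \<tau>_def]) (rule that)
  show ?thesis
  proof (rule exI[of _ B], intro ballI impI)
    fix \<theta> :: real assume \<theta>: "\<theta> \<in> {0..1}" and e: "\<theta> * (1 / p - 1 / DIM('a)) + (1 - \<theta>) * (1 / s) = 0"
    have "\<theta> = \<tau> * (1 - s * 0)"
      unfolding \<tau>_def by (rule supercritical_exponent[OF _ pn s e]) simp
    then have \<theta>\<tau>: "\<theta> = \<tau>" by simp
    have "u \<in> Lp_space \<Omega> \<infinity> \<and>
      Lp_norm \<Omega> \<infinity> u \<le> B * W1p_norm \<Omega> p u powr \<theta> * Lp_norm \<Omega> (ereal s) u powr (1 - \<theta>)"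
      if u: "u \<in> W1p \<Omega> p" "u \<in> Lp_space \<Omega> (ereal s)" for u
    proof -
      define M where "M = B * W1p_norm \<Omega> p u powr \<theta> * Lp_norm \<Omega> (ereal s) u powr (1 - \<theta>)"
      have M0: "0 \<le> M" using B by (simp add: M_def)
      have um[measurable]: "u \<in> borel_measurable (lebesgue_on \<Omega>)" using u(2) by (simp add: Lp_space_def)
      have "AE x in lebesgue_on \<Omega>. ereal \<bar>u x\<bar> \<le> ereal M"
        using sup[OF u] unfolding M_def \<theta>\<tau> by eventually_elim simp
      then have le: "esssup (lebesgue_on \<Omega>) (\<lambda>x. ereal \<bar>u x\<bar>) \<le> ereal M"
        by (intro esssup_I) auto
      then have "esssup (lebesgue_on \<Omega>) (\<lambda>x. ereal \<bar>u x\<bar>) < \<infinity>" by (rule le_less_trans) simp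
      \<comment> \<open>The case distinction includes the value \<open>-\<infinity>\<close>, which
        \<open>real_of_ereal\<close> sends to 0; there \<open>M0\<close> is used.\<close>
      moreover have "real_of_ereal (esssup (lebesgue_on \<Omega>) (\<lambda>x. ereal \<bar>u x\<bar>)) \<le> M"
        using le M0 by (cases "esssup (lebesgue_on \<Omega>) (\<lambda>x. ereal \<bar>u x\<bar>)") auto
      ultimately show ?thesis using um by (simp add: Lp_space_def Lp_norm_def M_def)
    qed
    then show "W1p \<Omega> p \<inter> Lp_space \<Omega> (ereal s) \<subseteq> Lp_space \<Omega> \<infinity> \<and>
      (\<forall>u \<in> W1p \<Omega> p \<inter> Lp_space \<Omega> (ereal s).
        Lp_norm \<Omega> \<infinity> u \<le> B * W1p_norm \<Omega> p u powr \<theta> * Lp_norm \<Omega> (ereal s) u powr (1 - \<theta>))"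
      by blast
  qed
qed

text \<open>The constant precedes \<theta> because the relation does not always determine \<theta>:
  for \<open>p < n\<close> and \<open>s = r = np / (n - p)\<close> every weight is admissible, and
  one constant has to serve them all.\<close>

theorem theorem1:
  fixes \<Omega> :: "(real ^ 'n) set" and p s :: real and r :: ereal
  assumes "1 < p"
    and "W1p_extension_domain \<Omega> p"
    and "0 < s"
    and "p < real CARD('n) \<Longrightarrow>
           ereal s \<le> r \<and> r \<le> ereal (real CARD('n) * p / (real CARD('n) - p))"
    and "p = real CARD('n) \<and> real CARD('n) > 1 \<Longrightarrow> ereal s \<le> r \<and> r < \<infinity>"
    and "p > real CARD('n) \<or> (p = real CARD('n) \<and> real CARD('n) = 1) \<Longrightarrow> ereal s \<le> r \<and> r \<le> \<infinity>"
  shows "\<exists>C::real. \<forall>\<theta>\<in>{0..1}.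
           ereal (\<theta> * (1 / p - 1 / real CARD('n)) + (1 - \<theta>) * (1 / s)) = 1 / r \<longrightarrow>
             W1p \<Omega> p \<inter> Lp_space \<Omega> (ereal s) \<subseteq> Lp_space \<Omega> r \<and>
             (\<forall>u \<in> W1p \<Omega> p \<inter> Lp_space \<Omega> (ereal s).
               Lp_norm \<Omega> r u \<le> C * W1p_norm \<Omega> p u powr \<theta> * Lp_norm \<Omega> (ereal s) u powr (1 - \<theta>))"
proof -
  have dim: "DIM(real ^ 'n) = CARD('n)" by simp
  have inv: "1 / ereal x = ereal (1 / x)" if "0 < x" for x
    using that by (simp add: one_ereal_def)
  consider "p < CARD('n)" | "p = CARD('n)" | "CARD('n) < p" by linarith
  then show ?thesis
  proof cases
    case 1
    then have sr: "ereal s \<le> r" "r \<le> ereal (real CARD('n) * p / (real CARD('n) - p))" using assms(4) by auto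
    then obtain r' where r': "r = ereal r'" "0 < r'" using assms(3) by (cases r) auto
    show ?thesis
      using interpolation_subcritical[OF assms(1,2,3) r'(2)] 1 unfolding r'(1) inv[OF r'(2)] dim ereal.inject by simp
  next
    case 2
    \<comment> \<open>Since \<open>1 < p\<close>, the dimension exceeds one here, so the bound
      \<open>r < \<infinity>\<close> is available.\<close>
    then have sr: "ereal s \<le> r" "r < \<infinity>" using assms(1,5) by auto
    then obtain r' where r': "r = ereal r'" "s \<le> r'" by (cases r) auto
    with assms(3) have r0: "0 < r'" by simp
    show ?thesis
      using interpolation_critical[OF assms(1,2,3) r'(2)] 2 unfolding r'(1) inv[OF r0] dim ereal.inject by simp
  next
    case 3
    then have sr: "ereal s \<le> r" using assms(6) by auto
    show ?thesis
    proof (cases "r = \<infinity>")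
      case True
      show ?thesis
        using interpolation_supercritical_infinity[OF assms(1,2,3)] 3
        unfolding True dim by (simp add: zero_ereal_def)
    next
      case False
      with sr obtain r' where r': "r = ereal r'" "s \<le> r'" by (cases r) auto
      with assms(3) have r0: "0 < r'" by simp
      show ?thesis
        using interpolation_supercritical[OF assms(1,2,3) r'(2)] 3 unfolding r'(1) inv[OF r0] dim ereal.inject by simp
    qed
  qed
qed

end
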